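(* Let $M$ be a separable pointed metric space and let $\lambda\ge 1$. Then the free space $\mathfrak{F}(M)$ has the $\lambda$-bounded approximation property if and only if $M$ has the following property: for any Banach space $Y$ and any $f\in \mathrm{Lip}^1(M,Y^{**})$, there is a net $(f_i)_i$ in $\mathrm{Lip}^\lambda(M,Y)$ which converges to $f$ in the pointwise-weak$^*$ topology.
   Context: Banach spaces are real. A pointed metric space is a metric space $(M,d)$ with a distinguished point $0\in M$. $\mathrm{Lip}_0(M)$ is the Banach space of real-valued Lipschitz functions $f$ on $M$ with $f(0)=0$, with norm $\|f\|_L=\sup\{|f(x)-f(y)|/d(x,y): x\ne y\in M\}$. For $x\in M$, $\delta(x)\in \mathrm{Lip}_0(M)^*$ is the evaluation $f\mapsto f(x)$. The free space $\mathfrak{F}(M)$ is the closed linear span of $\{\delta(x): x\in M\}$ in $\mathrm{Lip}_0(M)^*$, with the induced norm. For metric spaces $M$ and $X$, $\mathrm{Lip}^\lambda(M,X)$ denotes the set of all $\lambda$-Lipschitz maps from $M$ into $X$ (no condition at the base point); Banach spaces carry their norm metric. $Y$ is regarded as a subspace of $Y^{**}$ via the canonical embedding, and $f_i\to f$ in the pointwise-weak$^*$ topology means that $f_i(x)\to f(x)$ in the weak$^*$ topology $\sigma(Y^{**},Y^* )$ for every $x\in M$. A Banach space $X$ has the $\lambda$-bounded approximation property ($\lambda$-BAP) if the identity $\mathrm{id}_X$ is in the closure, for the topology of uniform convergence on compact sets, of the set of finite rank bounded linear operators on $X$ of norm at most $\lambda$. *)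

theory Defs
  imports "HOL-Analysis.Analysis" "HOL-Library.Function_Algebras"
begin

instantiation "fun" :: (type, real_vector) real_vector
begin

definition scaleR_fun :: "real \<Rightarrow> ('a \<Rightarrow> 'b) \<Rightarrow> 'a \<Rightarrow> 'b"
  where "scaleR_fun c f = (\<lambda>x. c *\<^sub>R f x)"

instance
  by standard (simp_all add: scaleR_fun_def fun_eq_iff scaleR_add_right scaleR_add_left)

end

text \<open>
  A normed space is given by a linear subspace of some real vector space type together with
  a norm on that subspace, so that one can quantify over Banach spaces inside a formula, and so that
  \<open>Lip\<^sub>0(M)\<close>, which depends on the base point, and duals of normed spaces are again such objects.
  The values of the norm outside the subspace are irrelevant.
\<close>

record 'a nspace =
  pts :: "'a set"
  nrm :: "'a \<Rightarrow> real"

definition normed_space :: "'a::real_vector nspace \<Rightarrow> bool" where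
  "normed_space X \<longleftrightarrow> subspace (pts X) \<and>
     (\<forall>x\<in>pts X. 0 \<le> nrm X x \<and> (nrm X x = 0 \<longleftrightarrow> x = 0)) \<and>
     (\<forall>c. \<forall>x\<in>pts X. nrm X (c *\<^sub>R x) = \<bar>c\<bar> * nrm X x) \<and>
     (\<forall>x\<in>pts X. \<forall>y\<in>pts X. nrm X (x + y) \<le> nrm X x + nrm X y)"

text \<open>
  The case distinction is there because \<open>Metric_space\<close> requires distances to be nonnegative and
  symmetric on the whole type.
\<close>

definition ndist :: "'a::real_vector nspace \<Rightarrow> 'a \<Rightarrow> 'a \<Rightarrow> real" where
  "ndist X x y = (if x \<in> pts X \<and> y \<in> pts X then nrm X (x - y) else 0)"

lemma Metric_space_ndist:
  assumes "normed_space X"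
  shows "Metric_space (pts X) (ndist X)"
proof
  have sub: "subspace (pts X)"
    and pos: "\<And>x. x \<in> pts X \<Longrightarrow> 0 \<le> nrm X x"
    and zero: "\<And>x. x \<in> pts X \<Longrightarrow> nrm X x = 0 \<longleftrightarrow> x = 0"
    and hom: "\<And>c x. x \<in> pts X \<Longrightarrow> nrm X (c *\<^sub>R x) = \<bar>c\<bar> * nrm X x"
    and tri: "\<And>x y. x \<in> pts X \<Longrightarrow> y \<in> pts X \<Longrightarrow> nrm X (x + y) \<le> nrm X x + nrm X y"
    using assms by (auto simp: normed_space_def)
  note diff = subspace_diff[OF sub]
  show "0 \<le> ndist X x y" for x y
    by (simp add: ndist_def pos diff)
  show "ndist X x y = ndist X y x" for x y
    using hom[of "x - y" "-1"] diff by (auto simp: ndist_def)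
  show "ndist X x y = 0 \<longleftrightarrow> x = y" if "x \<in> pts X" "y \<in> pts X" for x y
    using that by (simp add: ndist_def zero diff)
  show "ndist X x w \<le> ndist X x y + ndist X y w"
    if "x \<in> pts X" "y \<in> pts X" "w \<in> pts X" for x y w
    using that tri[of "x - y" "y - w"] by (simp add: ndist_def diff)
qed

abbreviation norm_topology :: "'a::real_vector nspace \<Rightarrow> 'a topology" where
  "norm_topology X \<equiv> Metric_space.mtopology (pts X) (ndist X)"

definition banach_space :: "'a::real_vector nspace \<Rightarrow> bool" where
  "banach_space X \<longleftrightarrow> normed_space X \<and> Metric_space.mcomplete (pts X) (ndist X)"

text \<open>
  The ambient vector space used when quantifying over all Banach spaces. It contains a copy of
  \<open>'u\<close>, so every Banach space whose vectors form a type \<open>'u\<close> occurs (see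
  \<open>banach_space_embed\<close> below). The second factor ensures that every separable
  Banach space occurs up to isometry whatever \<open>'u\<close> is; otherwise a
  quantification over Banach spaces would be nearly void for, say, a one-point type \<open>'u\<close>.
\<close>

type_synonym 'u ambient = "'u \<times> (nat \<Rightarrow> real)"

lemma banach_space_embed:
  "banach_space (\<lparr>pts = UNIV \<times> {0}, nrm = \<lambda>p. norm (fst p)\<rparr> :: 'u::banach ambient nspace)"
    (is "banach_space ?X")
proof -
  have ns: "normed_space ?X"
    unfolding normed_space_def
    by (auto simp: subspace_def zero_prod_def norm_triangle_ineq)
  interpret M: Metric_space "pts ?X" "ndist ?X"
    by (rule Metric_space_ndist[OF ns])
  have d: "ndist ?X p q = dist (fst p) (fst q)" if "p \<in> pts ?X" "q \<in> pts ?X" for p q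
    using that by (auto simp: ndist_def dist_norm)
  have "M.mcomplete"
    unfolding M.mcomplete_def
  proof (intro allI impI)
    fix s assume s: "M.MCauchy s"
    then have r: "s n \<in> pts ?X" for n
      by (auto simp only: M.MCauchy_def)
    have "Cauchy (\<lambda>n. fst (s n))"
      using s unfolding M.MCauchy_def Cauchy_def d[OF r r] by meson
    then obtain l where l: "(\<lambda>n. fst (s n)) \<longlonglongrightarrow> l"
      using Cauchy_convergent convergent_def by blast
    have l0: "(l, 0) \<in> pts ?X"
      by simp
    have "limitin M.mtopology s (l, 0) sequentially"
      unfolding M.limit_metric_sequentially
      using l l0 r by (simp only: LIMSEQ_def d[OF r l0] fst_conv) blast
    then show "\<exists>x. limitin M.mtopology s x sequentially" ..
  qed
  with ns show ?thesis
    by (simp add: banach_space_def)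
qed

definition bounded_ops :: "'a::real_vector nspace \<Rightarrow> 'b::real_vector nspace \<Rightarrow> ('a \<Rightarrow> 'b) set" where
  "bounded_ops X Y = {T. T ` pts X \<subseteq> pts Y \<and>
     (\<forall>x\<in>pts X. \<forall>y\<in>pts X. T (x + y) = T x + T y) \<and>
     (\<forall>c. \<forall>x\<in>pts X. T (c *\<^sub>R x) = c *\<^sub>R T x) \<and>
     (\<exists>C. \<forall>x\<in>pts X. nrm Y (T x) \<le> C * nrm X x)}"

definition op_norm :: "'a::real_vector nspace \<Rightarrow> 'b::real_vector nspace \<Rightarrow> ('a \<Rightarrow> 'b) \<Rightarrow> real" where
  "op_norm X Y T = Sup {nrm Y (T x) | x. x \<in> pts X \<and> nrm X x \<le> 1}"

definition real_line :: "real nspace" where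
  "real_line = \<lparr>pts = UNIV, nrm = abs\<rparr>"

text \<open>
  A functional is represented by the function that is \<open>0\<close> outside the space, so that distinct
  elements of the dual are distinct functions.
\<close>

definition dual :: "'a::real_vector nspace \<Rightarrow> ('a \<Rightarrow> real) nspace" where
  "dual X = \<lparr>pts = {\<phi> \<in> bounded_ops X real_line. \<forall>x. x \<notin> pts X \<longrightarrow> \<phi> x = 0},
             nrm = op_norm X real_line\<rparr>"

definition canon :: "'a::real_vector nspace \<Rightarrow> 'a \<Rightarrow> ('a \<Rightarrow> real) \<Rightarrow> real" where
  "canon X x = (\<lambda>\<phi>. if \<phi> \<in> pts (dual X) then \<phi> x else 0)"

text \<open>
  The topology \<open>\<sigma>(X\<^sup>*, X)\<close>. The Euclidean topology on functions is the product topology; the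
  coordinates outside \<open>pts X\<close> contribute nothing since functionals vanish there.
\<close>

definition weak_star :: "'a::real_vector nspace \<Rightarrow> ('a \<Rightarrow> real) topology" where
  "weak_star X = subtopology euclidean (pts (dual X))"

definition pointwise_weak_star ::
    "'b::real_vector nspace \<Rightarrow> ('m \<Rightarrow> ('b \<Rightarrow> real) \<Rightarrow> real) topology" where
  "pointwise_weak_star Y = product_topology (\<lambda>_. weak_star (dual Y)) UNIV"

definition lip_maps :: "real \<Rightarrow> 'b::real_vector nspace \<Rightarrow> ('m::metric_space \<Rightarrow> 'b) set" where
  "lip_maps c X = {f. range f \<subseteq> pts X \<and> (\<forall>x y. ndist X (f x) (f y) \<le> c * dist x y)}"

text \<open>
  Inserting \<open>0\<close> matters only for a one-point space, where the set of quotients is empty.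
\<close>

definition lip0 :: "'m::metric_space \<Rightarrow> ('m \<Rightarrow> real) nspace" where
  "lip0 z = \<lparr>pts = {f. f z = 0 \<and> (\<exists>L. L-lipschitz_on UNIV f)},
             nrm = \<lambda>f. Sup (insert 0 {\<bar>f x - f y\<bar> / dist x y | x y. x \<noteq> y})\<rparr>"

definition eval_at :: "'m::metric_space \<Rightarrow> 'm \<Rightarrow> ('m \<Rightarrow> real) \<Rightarrow> real" where
  "eval_at z x = (\<lambda>f. if f \<in> pts (lip0 z) then f x else 0)"

definition free_space :: "'m::metric_space \<Rightarrow> (('m \<Rightarrow> real) \<Rightarrow> real) nspace" where
  "free_space z =
     \<lparr>pts = norm_topology (dual (lip0 z)) closure_of
              span (range (eval_at z)),
      nrm = nrm (dual (lip0 z))\<rparr>"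

definition finite_rank :: "'a::real_vector nspace \<Rightarrow> ('a \<Rightarrow> 'b::real_vector) \<Rightarrow> bool" where
  "finite_rank X T \<longleftrightarrow> (\<exists>B. finite B \<and> T ` pts X \<subseteq> span B)"

definition compact_convergence_topology :: "'a::real_vector nspace \<Rightarrow> ('a \<Rightarrow> 'a) topology" where
  "compact_convergence_topology X = topology_generated_by
     {{S \<in> bounded_ops X X. \<forall>x\<in>K. ndist X (S x) (T x) < e} | T K e.
        T \<in> bounded_ops X X \<and> compactin (norm_topology X) K \<and> 0 < e}"

definition bounded_approximation_property :: "real \<Rightarrow> 'a::real_vector nspace \<Rightarrow> bool" where
  "bounded_approximation_property c X \<longleftrightarrow>
     id \<in> compact_convergence_topology X closure_of
            {T \<in> bounded_ops X X. finite_rank X T \<and> op_norm X X T \<le> c}"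

end

theory Submission
  imports Defs
begin

text \<open>
  Let \<open>X\<close> be the free space. If \<open>X\<close> has the approximation property, extend \<open>f - f 0\<close> linearly to \<open>X\<close>
  and compose it with a finite rank operator \<open>T\<close> on \<open>X\<close> that is close to the identity on finitely many
  \<open>\<delta>(x)\<close>. On the range of \<open>T\<close>, local reflexivity replaces the extension by an operator into \<open>Y\<close> without
  increasing the norm, and the composition restricts to a \<open>\<lambda>\<close>-Lipschitz map on \<open>M\<close>.

  Conversely, let \<open>X\<^sub>n\<close> be the span of the first \<open>n\<close> points of a dense sequence and let \<open>Y\<close> be the
  space of convergent sequences \<open>(x\<^sub>n)\<close> with \<open>x\<^sub>n \<in> X\<^sub>n\<close>, with the supremum norm. Choosing \<open>a\<^sub>n(x) \<rightarrow> x\<close>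
  among these points, the tails \<open>(0, \<dots>, 0, \<delta>(a\<^sub>k(x)), \<delta>(a\<^sub>k\<^sub>+\<^sub>1(x)), \<dots>)\<close> converge weak* in \<open>Y\<^sup>*\<^sup>*\<close>, which gives a
  1-Lipschitz lift \<open>f : M \<rightarrow> Y\<^sup>*\<^sup>*\<close> of \<open>\<delta>\<close> along the limit map \<open>q : Y \<rightarrow> X\<close>. If \<open>\<lambda>\<close>-Lipschitz maps \<open>g\<close> into
  \<open>Y\<close> approximate \<open>f\<close> weak*, then by convexity some \<open>q \<circ> (g - g 0)\<close> is close to \<open>\<delta>\<close> in norm on a given finite
  set, and the linearization of a late coordinate of \<open>g - g 0\<close> is the required operator of finite rank.
\<close>

section \<open>Separation of convex sets\<close>

text \<open>Two constraints shape the proof. Banach spaces are quantified over a fixed ambient type,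
  so the space used in the converse must be carried into it. This is why its n-th coordinates lie in
  a finite-dimensional space of functions: such functions are determined by values at finitely many
  sample points, and a whole sequence becomes one sequence of reals. The same sample points replace
  compactness arguments in finite dimension, since they give explicit bounded coordinates. The
  constant \<lambda> must be kept exactly. In local reflexivity the small excess of the norm is
  removed by rescaling, paid for in the approximation of functionals. In the converse nothing is
  lost because coordinates and limits are contractions on \<open>Y\<close>, and because a tail
  forgets the terms in which the approximating point is still far from x. Nets are reduced to finite
  data: finitely many points, finitely many functionals and a tolerance. In this form both
  directions become Hahn-Banach separation arguments with finitely many relevant
  coordinates.\<close>

lemma sum_fun_app: "(\<Sum>i\<in>I. f i) x = (\<Sum>i\<in>I. f i x)"
  by (induction I rule: infinite_finite_induct) auto

lemma scaleR_fun_app [simp]: "(c *\<^sub>R f) x = c *\<^sub>R f x"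
  by (simp add: scaleR_fun_def)

definition sublinear :: "('a::real_vector \<Rightarrow> real) \<Rightarrow> bool" where
  "sublinear p \<longleftrightarrow> (\<forall>x y. p (x + y) \<le> p x + p y) \<and> (\<forall>c x. 0 \<le> c \<longrightarrow> p (c *\<^sub>R x) = c * p x)"

lemma sublinear_add: "sublinear p \<Longrightarrow> p (x + y) \<le> p x + p y"
  and sublinear_scale: "sublinear p \<Longrightarrow> 0 \<le> c \<Longrightarrow> p (c *\<^sub>R x) = c * p x"
  by (auto simp: sublinear_def)

lemma sublinear_0: "sublinear p \<Longrightarrow> p 0 = 0"
  using sublinear_scale[of p 0 0] by simp

lemma sublinear_neg: "sublinear p \<Longrightarrow> - p (- x) \<le> p x"
  using sublinear_add[of p x "- x"] sublinear_0[of p] by simp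

text \<open>
  With \<open>D = {y}\<close> and \<open>e = p y\<close> this perturbation is what forces a minimal sublinear functional
  to be additive, and with a general \<open>D\<close> it yields the separation theorem.
\<close>

lemma sublinear_lower:
  fixes p :: "'a::real_vector \<Rightarrow> real"
  assumes p: "sublinear p" and D: "convex D" "D \<noteq> {}" "\<And>d. d \<in> D \<Longrightarrow> e \<le> p d"
  obtains q where "sublinear q" "\<And>x. q x \<le> p x" "\<And>d x. d \<in> D \<Longrightarrow> q x \<le> p (x + d) - e"
proof -
  define A where "A x = {p (x + t *\<^sub>R d) - t * e | t d. 0 \<le> t \<and> d \<in> D}" for x
  define q where "q x = Inf (A x)" for x
  \<comment> \<open>The bound \<open>e \<le> p d\<close> on \<open>D\<close> keeps the infimum
    finite: \<open>t * e\<close> is at most \<open>p (t *\<^sub>R d)\<close>, hence at most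
    \<open>p (x + t *\<^sub>R d) + p (- x)\<close>.\<close>
  have lb: "- p (- x) \<le> a" if "a \<in> A x" for a x
  proof -
    from that obtain t d where a: "a = p (x + t *\<^sub>R d) - t * e" and t: "0 \<le> t" "d \<in> D"
      by (auto simp: A_def)
    have "t * e \<le> p (t *\<^sub>R d)"
      using t D(3) by (simp add: sublinear_scale[OF p] mult_left_mono)
    also have "\<dots> \<le> p (x + t *\<^sub>R d) + p (- x)"
      using sublinear_add[OF p, of "x + t *\<^sub>R d" "- x"] by simp
    finally show ?thesis using a by simp
  qed
  have bdd: "bdd_below (A x)" for x
    using lb by (meson bdd_belowI)
  have q_le: "q x \<le> p (x + t *\<^sub>R d) - t * e" if "0 \<le> t" "d \<in> D" for x t d
    unfolding q_def by (rule cInf_lower[OF _ bdd]) (use that in \<open>auto simp: A_def\<close>)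
  have ne: "A x \<noteq> {}" for x
    using D(2) by (auto simp: A_def intro: exI[of _ 0])
  have q_ge: "c \<le> q x" if "\<And>t d. 0 \<le> t \<Longrightarrow> d \<in> D \<Longrightarrow> c \<le> p (x + t *\<^sub>R d) - t * e" for c x
    unfolding q_def by (rule cInf_greatest[OF ne]) (use that in \<open>auto simp: A_def\<close>)
  \<comment> \<open>Convexity of \<open>D\<close>: a sum of two points on rays through
    \<open>D\<close> is again on such a ray, with the parameters added. This makes the infimum
    subadditive.\<close>
  have comb: "\<exists>s d. 0 \<le> s \<and> d \<in> D \<and> s = t + t' \<and> s *\<^sub>R d = t *\<^sub>R a + t' *\<^sub>R b"
    if "0 \<le> t" "0 \<le> t'" "a \<in> D" "b \<in> D" for t t' :: real and a b
  proof (cases "t + t' = 0")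
    case True
    then have "t = 0" "t' = 0" using that by auto
    then show ?thesis using that by (intro exI[of _ 0] exI[of _ a]) auto
  next
    case False
    then have "(t / (t + t')) *\<^sub>R a + (t' / (t + t')) *\<^sub>R b \<in> D"
      using that by (intro convexD[OF D(1)]) (auto simp: add_divide_distrib[symmetric])
    moreover have "(t + t') *\<^sub>R ((t / (t + t')) *\<^sub>R a + (t' / (t + t')) *\<^sub>R b) = t *\<^sub>R a + t' *\<^sub>R b"
      using False by (simp add: scaleR_add_right)
    ultimately show ?thesis
      using that by (intro exI[of _ "t + t'"] exI[of _ "(t / (t + t')) *\<^sub>R a + (t' / (t + t')) *\<^sub>R b"]) simp
  qed
  have sub: "q (x + y) \<le> q x + q y" for x y
  proof -
    have *: "q (x + y) - (p (y + t' *\<^sub>R b) - t' * e) \<le> p (x + t *\<^sub>R a) - t * e"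
      if ab: "0 \<le> t" "a \<in> D" "0 \<le> t'" "b \<in> D" for t t' a b
    proof -
      obtain s d where s: "0 \<le> s" "d \<in> D" "s = t + t'" "s *\<^sub>R d = t *\<^sub>R a + t' *\<^sub>R b"
        using comb[of t t' a b] ab by auto
      have "q (x + y) \<le> p ((x + t *\<^sub>R a) + (y + t' *\<^sub>R b)) - s * e"
        using q_le[OF s(1,2), of "x + y"] s(4) by (simp add: algebra_simps)
      also have "\<dots> \<le> p (x + t *\<^sub>R a) + p (y + t' *\<^sub>R b) - s * e"
        using sublinear_add[OF p] by simp
      finally show ?thesis by (simp add: s(3) algebra_simps)
    qed
    have "q (x + y) - q x \<le> p (y + t' *\<^sub>R b) - t' * e" if "0 \<le> t'" "b \<in> D" for t' b
      using q_ge[of "q (x + y) - (p (y + t' *\<^sub>R b) - t' * e)" x, OF *] that by auto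
    from q_ge[OF this] show ?thesis by simp
  qed
  have scale_le: "q (c *\<^sub>R x) \<le> c * q x" if c: "0 < c" for c x
  proof -
    have "q (c *\<^sub>R x) / c \<le> p (x + t *\<^sub>R d) - t * e" if "0 \<le> t" "d \<in> D" for t d
    proof -
      have "q (c *\<^sub>R x) \<le> p (c *\<^sub>R (x + t *\<^sub>R d)) - (c * t) * e"
        using q_le[of "c * t" d "c *\<^sub>R x"] that c by (simp add: algebra_simps)
      also have "\<dots> = c * (p (x + t *\<^sub>R d) - t * e)"
        using c sublinear_scale[OF p, of c "x + t *\<^sub>R d"] by (simp add: right_diff_distrib)
      finally show ?thesis using c by (simp add: field_simps)
    qed
    from q_ge[OF this] show ?thesis using c by (simp add: field_simps)
  qed
  have q0: "q 0 = 0"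
  proof (rule antisym)
    show "q 0 \<le> 0" using q_le[of 0 _ 0] D(2) by (auto simp: sublinear_0[OF p])
    show "0 \<le> q 0" by (rule q_ge) (use D(3) in \<open>simp add: sublinear_scale[OF p] mult_left_mono\<close>)
  qed
  have "q (c *\<^sub>R x) = c * q x" if "0 \<le> c" for c x
  proof (cases "c = 0")
    case False
    then have "c * q x \<le> q (c *\<^sub>R x)"
      using scale_le[of "1 / c" "c *\<^sub>R x"] that by (simp add: field_simps)
    with scale_le[of c x] False that show ?thesis by simp
  qed (simp add: q0)
  with sub have "sublinear q" by (simp add: sublinear_def)
  moreover have "q x \<le> p x" for x
    using q_le[of 0] D(2) by auto
  moreover have "q x \<le> p (x + d) - e" if "d \<in> D" for d x
    using q_le[of 1 d x] that by simp
  ultimately show ?thesis using that by blast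
qed

text \<open>Zorn's lemma yields a minimal sublinear functional below \<open>p\<close>, since a chain
  has its pointwise infimum as lower bound. A minimal one is linear: perturbing it at a point
  \<open>y\<close> by \<open>sublinear_lower\<close> cannot decrease it, and that is
  additivity.\<close>

lemma sublinear_minorant:
  fixes p :: "'a::real_vector \<Rightarrow> real"
  assumes p: "sublinear p"
  obtains h where "linear h" "\<And>x. h x \<le> p x"
proof -
  define A where "A = {q. sublinear q \<and> (\<forall>x. q x \<le> p x)}"
  \<comment> \<open>The order is reversed, so that the maximal element of Zorn's lemma is a minimal
    functional.\<close>
  define P where "P = (\<lambda>q r :: 'a \<Rightarrow> real. \<forall>x. r x \<le> q x)"
  have "\<exists>m\<in>A. \<forall>a\<in>A. P m a \<longrightarrow> a = m"
  proof (rule predicate_Zorn)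
    show "partial_order_on A (relation_of P A)"
      by (rule partial_order_on_relation_ofI) (auto simp: P_def fun_eq_iff intro: order_trans antisym)
    fix C assume "C \<in> Chains (relation_of P A)"
    then have CA: "C \<subseteq> A" and ch: "\<And>q r. q \<in> C \<Longrightarrow> r \<in> C \<Longrightarrow> P q r \<or> P r q"
      by (auto simp: Chains_def relation_of_def)
    show "\<exists>u\<in>A. \<forall>a\<in>C. P a u"
    proof (cases "C = {}")
      case True
      then show ?thesis using p by (auto simp: A_def intro: exI[of _ p])
    next
      case False
      define u where "u x = (INF q\<in>C. q x)" for x
      have sub: "sublinear q" "q x \<le> p x" if "q \<in> C" for q x
        using CA that by (auto simp: A_def)
      have "- p (- x) \<le> q x" if "q \<in> C" for q x
        using sublinear_neg[OF sub(1)[OF that], of x] sub(2)[OF that, of "- x"] by linarith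
      then have bdd: "bdd_below ((\<lambda>q. q x) ` C)" for x
        by (auto intro!: bdd_belowI)
      have u_le: "u x \<le> q x" if "q \<in> C" for q x
        unfolding u_def using bdd that by (rule cINF_lower)
      have u_ge: "c \<le> u x" if "\<And>q. q \<in> C \<Longrightarrow> c \<le> q x" for c x
        unfolding u_def using False that by (rule cINF_greatest)
      have "u (x + y) \<le> u x + u y" for x y
      proof -
        \<comment> \<open>The infima at \<open>x\<close> and at \<open>y\<close> may be approached
          by different members \<open>q\<close> and \<open>r\<close> of the chain; the smaller of
          the two serves at both points.\<close>
        have "u (x + y) - r y \<le> q x" if qr: "q \<in> C" "r \<in> C" for q r
        proof -
          obtain s where s: "s \<in> C" "s x \<le> q x" "s y \<le> r y"
            using ch[OF qr] qr unfolding P_def by (metis order_refl)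
          show ?thesis
            using u_le[OF s(1), of "x + y"] sublinear_add[OF sub(1)[OF s(1)], of x y] s by linarith
        qed
        then have *: "u (x + y) - u x \<le> r y" if "r \<in> C" for r
          using u_ge[of "u (x + y) - r y" x] that by fastforce
        have "u (x + y) - u x \<le> u y" by (rule u_ge) (rule *)
        then show ?thesis by simp
      qed
      moreover have "u (c *\<^sub>R x) = c * u x" if c: "0 \<le> c" for c x
      proof (cases "c = 0")
        case True
        have "u 0 = 0"
          using u_ge[of 0 0] u_le[of _ 0] False sublinear_0[OF sub(1)] by force
        then show ?thesis using True by simp
      next
        case False
        with c have "0 < c" by simp
        have "u (c *\<^sub>R x) / c \<le> u x"
          using u_le[of _ "c *\<^sub>R x"] sublinear_scale[OF sub(1)] \<open>0 < c\<close>
          by (intro u_ge) (fastforce simp: field_simps)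
        moreover have "c * u x \<le> u (c *\<^sub>R x)"
          using u_le \<open>0 < c\<close> by (intro u_ge) (simp add: sublinear_scale[OF sub(1)])
        ultimately show ?thesis using \<open>0 < c\<close> by (simp add: field_simps)
      qed
      ultimately have "sublinear u" by (simp add: sublinear_def)
      moreover have "u x \<le> p x" for x
        using False u_le sub(2) by (meson ex_in_conv order_trans)
      ultimately show ?thesis using u_le by (auto simp: A_def P_def)
    qed
  qed
  then obtain m where mA: "m \<in> A" and mmin: "\<And>a. a \<in> A \<Longrightarrow> P m a \<Longrightarrow> a = m"
    by blast
  have m: "sublinear m" "m x \<le> p x" for x
    using mA by (auto simp: A_def)
  have min: "a = m" if "sublinear a" "\<And>x. a x \<le> m x" for a
    by (rule mmin) (use that m(2) in \<open>auto simp: A_def P_def intro: order_trans[OF that(2)]\<close>)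
  have add: "m (x + y) = m x + m y" for x y
  proof -
    obtain q where "sublinear q" "\<And>x. q x \<le> m x" and q: "\<And>d x. d \<in> {y} \<Longrightarrow> q x \<le> m (x + d) - m y"
      using sublinear_lower[OF m(1), of "{y}" "m y"] by auto
    then have "q = m" using min by blast
    with q[of y x] sublinear_add[OF m(1), of x y] show ?thesis by simp
  qed
  have neg: "m (- x) = - m x" for x
    using add[of x "- x"] sublinear_0[OF m(1)] by simp
  have "m (c *\<^sub>R x) = c * m x" for c x
    using sublinear_scale[OF m(1), of c x] sublinear_scale[OF m(1), of "- c" x] neg[of "c *\<^sub>R x"]
    by (cases "0 \<le> c") auto
  then have "linear m" using add by (intro linearI) auto
  then show ?thesis using m(2) that by blast
qed

text \<open>A linear minorant \<open>h\<close> of the perturbed functional satisfies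
  \<open>h (- d) \<le> p 0 - e\<close> with \<open>p 0 = 0\<close>, which is the lower bound on
  \<open>D\<close>. Domination by \<open>p\<close> takes the place of continuity.\<close>

lemma separation:
  fixes p :: "'a::real_vector \<Rightarrow> real"
  assumes p: "sublinear p" and D: "convex D" "D \<noteq> {}" "\<And>d. d \<in> D \<Longrightarrow> e \<le> p d"
  obtains h where "linear h" "\<And>x. h x \<le> p x" "\<And>d. d \<in> D \<Longrightarrow> e \<le> h d"
proof -
  obtain q where q: "sublinear q" "\<And>x. q x \<le> p x" "\<And>d x. d \<in> D \<Longrightarrow> q x \<le> p (x + d) - e"
    using sublinear_lower[OF p D] by blast
  obtain h where h: "linear h" "\<And>x. h x \<le> q x"
    using sublinear_minorant[OF q(1)] by blast
  have "e \<le> h d" if "d \<in> D" for d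
    using h(2)[of "- d"] q(3)[OF that, of "- d"] linear_neg[OF h(1), of d] sublinear_0[OF p] by simp
  then show ?thesis using that h q(2) order_trans by blast
qed

text \<open>Coordinates that are point evaluations: the functions \<open>e\<close> interpolate at
  the sample points \<open>S\<close>. When the functions are functionals, a sample point is an
  element on which they act, so the coordinates are bounded by its norm and survive pointwise
  limits. The clause with \<open>v s \<noteq> 0\<close> forces the sample points into the domain of
  the functionals, which are zero elsewhere.\<close>

lemma finite_dim_functions_samples:
  fixes B :: "('a \<Rightarrow> real) set"
  assumes "finite B"
  obtains S e where "finite S" "\<And>s. s \<in> S \<Longrightarrow> \<exists>v\<in>B. v s \<noteq> 0"
    "\<And>s. s \<in> S \<Longrightarrow> e s \<in> span B" "\<And>v. v \<in> span B \<Longrightarrow> v = (\<Sum>s\<in>S. v s *\<^sub>R e s)"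
    "\<And>s t. s \<in> S \<Longrightarrow> t \<in> S \<Longrightarrow> e s t = (if s = t then 1 else 0)"
proof -
  have "\<exists>S e. finite S \<and> (\<forall>s\<in>S. e s \<in> span B) \<and>
    (\<forall>s\<in>S. \<forall>t\<in>S. e s t = (if s = t then 1 else 0)) \<and> (\<forall>v\<in>span B. v = (\<Sum>s\<in>S. v s *\<^sub>R e s))"
    using assms
  proof (induction B)
    case empty
    show ?case by (rule exI[of _ "{}"]) auto
  next
    case (insert b B)
    from insert.IH obtain S e where *: "finite S \<and> (\<forall>s\<in>S. e s \<in> span B) \<and>
      (\<forall>s\<in>S. \<forall>t\<in>S. e s t = (if s = t then 1 else 0)) \<and> (\<forall>v\<in>span B. v = (\<Sum>s\<in>S. v s *\<^sub>R e s))"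
      by (elim exE)
    have S: "finite S" and e: "\<And>s. s \<in> S \<Longrightarrow> e s \<in> span B"
      and bi: "\<And>s t. s \<in> S \<Longrightarrow> t \<in> S \<Longrightarrow> e s t = (if s = t then 1 else 0)"
      using * by simp_all
    have rep: "v = (\<Sum>s\<in>S. v s *\<^sub>R e s)" if "v \<in> span B" for v
      using * that by simp
    have mono: "span B \<subseteq> span (insert b B)"
      by (intro span_mono) auto
    \<comment> \<open>\<open>Q\<close> interpolates at the old sample points, so the residual
      \<open>r\<close> of the new generator vanishes on \<open>S\<close>. Either it is zero and the
      span does not grow, or any \<open>t\<close> with \<open>r t \<noteq> 0\<close> is a new sample
      point.\<close>
    define Q where "Q v = (\<Sum>s\<in>S. v s *\<^sub>R e s)" for v :: "'a \<Rightarrow> real"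
    have Qin: "Q v \<in> span B" for v
      unfolding Q_def using e by (intro span_sum span_scale) auto
    define r where "r = b - Q b"
    have r_in: "r \<in> span (insert b B)"
      unfolding r_def using Qin mono by (intro span_diff) (auto intro: span_base)
    have dec: "\<exists>k u. u \<in> span B \<and> v = k *\<^sub>R r + u" if "v \<in> span (insert b B)" for v
    proof -
      from that obtain k where k: "v - k *\<^sub>R b \<in> span B" by (auto simp: span_insert)
      have "v = k *\<^sub>R r + ((v - k *\<^sub>R b) + k *\<^sub>R Q b)"
        by (simp add: r_def algebra_simps)
      moreover have "(v - k *\<^sub>R b) + k *\<^sub>R Q b \<in> span B"
        using k Qin by (intro span_add span_scale)
      ultimately show ?thesis by blast
    qed
    show ?case
    proof (cases "r = 0")
      case True
      then have "span (insert b B) \<subseteq> span B" using dec by fastforce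
      then have eq: "span (insert b B) = span B" using mono by blast
      show ?thesis unfolding eq using * by (intro exI[of _ S] exI[of _ e])
    next
      case False
      then obtain t where t: "r t \<noteq> 0" by (auto simp: fun_eq_iff)
      have rS: "r s = 0" if "s \<in> S" for s
      proof -
        have "Q b s = (\<Sum>u\<in>S. if u = s then b u else 0)"
          unfolding Q_def sum_fun_app by (rule sum.cong) (use bi that in auto)
        then show ?thesis using S that by (simp add: r_def)
      qed
      have tS: "t \<notin> S" using rS t by auto
      define r' where "r' = (1 / r t) *\<^sub>R r"
      have r': "r' t = 1" "\<And>s. s \<in> S \<Longrightarrow> r' s = 0" "r = r t *\<^sub>R r'" "r' \<in> span (insert b B)"
        using t rS r_in by (auto simp: r'_def intro: span_scale)
      \<comment> \<open>The old functions are corrected by multiples of \<open>r'\<close> so that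
        they vanish at \<open>t\<close>; since \<open>r'\<close> vanishes on \<open>S\<close>, their
        values there do not change.\<close>
      define e' where "e' s = (if s = t then r' else e s - e s t *\<^sub>R r')" for s
      have "v = (\<Sum>s\<in>insert t S. v s *\<^sub>R e' s)" if v: "v \<in> span (insert b B)" for v
      proof -
        obtain k u where u: "u \<in> span B" and v: "v = k *\<^sub>R r + u" using dec[OF v] by blast
        have vs: "v s = u s" if "s \<in> S" for s using rS that v by simp
        have ut: "u t = (\<Sum>s\<in>S. u s * e s t)"
          using fun_cong[OF rep[OF u], of t] by (simp add: sum_fun_app)
        have "(\<Sum>s\<in>insert t S. v s *\<^sub>R e' s) = v t *\<^sub>R r' + (\<Sum>s\<in>S. u s *\<^sub>R (e s - e s t *\<^sub>R r'))"
          using S tS vs by (simp add: e'_def) (rule sum.cong, auto)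
        also have "\<dots> = v t *\<^sub>R r' + (u - u t *\<^sub>R r')"
          using rep[OF u] by (simp add: ut scaleR_diff_right sum_subtractf scaleR_sum_left)
        also have "\<dots> = (k * r t) *\<^sub>R r' + u"
          by (simp add: v algebra_simps)
        also have "\<dots> = k *\<^sub>R (r t *\<^sub>R r') + u"
          by simp
        finally show ?thesis using v r'(3) by simp
      qed
      moreover have "e' s \<in> span (insert b B)" if "s \<in> insert t S" for s
        using that e mono r' by (auto simp: e'_def intro!: span_diff span_scale)
      moreover have "e' s u = (if s = u then 1 else 0)" if "s \<in> insert t S" "u \<in> insert t S" for s u
        using that bi r' tS by (auto simp: e'_def)
      ultimately show ?thesis using S
        by (intro exI[of _ "insert t S"] exI[of _ e'] conjI ballI) (simp, blast, blast, blast)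
    qed
  qed
  then obtain S e where *: "finite S \<and> (\<forall>s\<in>S. e s \<in> span B) \<and>
      (\<forall>s\<in>S. \<forall>t\<in>S. e s t = (if s = t then 1 else 0)) \<and> (\<forall>v\<in>span B. v = (\<Sum>s\<in>S. v s *\<^sub>R e s))"
    by (elim exE)
  have S: "finite S" "\<And>s. s \<in> S \<Longrightarrow> e s \<in> span B"
    "\<And>s t. s \<in> S \<Longrightarrow> t \<in> S \<Longrightarrow> e s t = (if s = t then 1 else 0)"
    using * by simp_all
  have rep: "v = (\<Sum>s\<in>S. v s *\<^sub>R e s)" if "v \<in> span B" for v
    using * that by simp
  have "\<exists>v\<in>B. v s \<noteq> 0" if "s \<in> S" for s
  proof (rule ccontr)
    assume "\<not> ?thesis"
    then have "B \<subseteq> {v. v s = 0}" by auto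
    moreover have "subspace {v :: 'a \<Rightarrow> real. v s = 0}" by (auto simp: subspace_def)
    ultimately have "span B \<subseteq> {v. v s = 0}" by (rule span_minimal)
    then show False using S(2,3)[OF that] that by (metis (mono_tags) mem_Collect_eq one_neq_zero subset_eq)
  qed
  then show ?thesis using that[OF S(1) _ S(2) rep S(3)] by blast
qed

section \<open>Normed spaces and their duals\<close>

locale normed =
  fixes X :: "'a::real_vector nspace"
  assumes normed_space: "normed_space X"
begin

lemma subspace: "subspace (pts X)"
  using normed_space by (simp add: normed_space_def)

lemmas zero_in = subspace_0[OF subspace]
  and add_in = subspace_add[OF subspace]
  and diff_in = subspace_diff[OF subspace]
  and scale_in = subspace_scale[OF subspace]
  and neg_in = subspace_neg[OF subspace]
  and sum_in = subspace_sum[OF subspace]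

lemma nonneg: "x \<in> pts X \<Longrightarrow> 0 \<le> nrm X x"
  and eq_0: "x \<in> pts X \<Longrightarrow> nrm X x = 0 \<longleftrightarrow> x = 0"
  and scale: "x \<in> pts X \<Longrightarrow> nrm X (c *\<^sub>R x) = \<bar>c\<bar> * nrm X x"
  and triangle: "x \<in> pts X \<Longrightarrow> y \<in> pts X \<Longrightarrow> nrm X (x + y) \<le> nrm X x + nrm X y"
  using normed_space by (auto simp: normed_space_def)

lemma zero [simp]: "nrm X 0 = 0"
  using eq_0 zero_in by blast

lemma neg: "x \<in> pts X \<Longrightarrow> nrm X (- x) = nrm X x"
  using scale[of x "-1"] by simp

lemma commute: "x \<in> pts X \<Longrightarrow> y \<in> pts X \<Longrightarrow> nrm X (x - y) = nrm X (y - x)"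
  using neg[of "x - y"] diff_in by simp

lemma triangle_diff: "x \<in> pts X \<Longrightarrow> y \<in> pts X \<Longrightarrow> nrm X (x - y) \<le> nrm X x + nrm X y"
  using triangle[of x "- y"] neg neg_in by simp

lemma triangle_via:
  "x \<in> pts X \<Longrightarrow> y \<in> pts X \<Longrightarrow> w \<in> pts X \<Longrightarrow> nrm X (x - w) \<le> nrm X (x - y) + nrm X (y - w)"
  using triangle[of "x - y" "y - w"] diff_in by simp

lemma triangle_sub: "x \<in> pts X \<Longrightarrow> y \<in> pts X \<Longrightarrow> nrm X x \<le> nrm X y + nrm X (x - y)"
  using triangle[of y "x - y"] diff_in by simp

lemma sum_le:
  "(\<And>i. i \<in> I \<Longrightarrow> f i \<in> pts X) \<Longrightarrow> nrm X (\<Sum>i\<in>I. f i) \<le> (\<Sum>i\<in>I. nrm X (f i))"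
proof (induction I rule: infinite_finite_induct)
  case (insert i I)
  have "nrm X (\<Sum>i\<in>insert i I. f i) \<le> nrm X (f i) + nrm X (\<Sum>i\<in>I. f i)"
    using insert by (simp add: triangle sum_in)
  also have "\<dots> \<le> (\<Sum>i\<in>insert i I. nrm X (f i))"
    using insert by simp
  finally show ?case .
qed auto

sublocale Metric_space "pts X" "ndist X"
  by (rule Metric_space_ndist[OF normed_space])

lemma in_closure_of:
  assumes "S \<subseteq> pts X"
  shows "x \<in> norm_topology X closure_of S \<longleftrightarrow> x \<in> pts X \<and> (\<forall>e>0. \<exists>y\<in>S. nrm X (x - y) < e)"
  unfolding metric_closure_of using assms by (auto simp: ndist_def mball_def) blast+

lemma banach_spaceI:
  assumes "\<And>s :: nat \<Rightarrow> 'a. (\<And>n. s n \<in> pts X) \<Longrightarrow>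
    (\<And>e. 0 < e \<Longrightarrow> \<exists>N. \<forall>m\<ge>N. \<forall>n\<ge>N. nrm X (s m - s n) < e) \<Longrightarrow>
    \<exists>l\<in>pts X. \<forall>e>0. \<exists>N. \<forall>n\<ge>N. nrm X (s n - l) < e"
  shows "banach_space X"
  unfolding banach_space_def mcomplete_def
proof (intro conjI allI impI normed_space)
  fix s assume s: "MCauchy s"
  then have r: "s n \<in> pts X" for n
    by (auto simp only: MCauchy_def)
  have "\<exists>N. \<forall>m\<ge>N. \<forall>n\<ge>N. nrm X (s m - s n) < e" if "0 < e" for e
  proof -
    obtain N where "\<forall>m n. N \<le> m \<longrightarrow> N \<le> n \<longrightarrow> ndist X (s m) (s n) < e"
      using s \<open>0 < e\<close> unfolding MCauchy_def by blast
    then show ?thesis using r by (auto simp: ndist_def)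
  qed
  from assms[of s, OF r this] obtain l where l: "l \<in> pts X" "\<forall>e>0. \<exists>N. \<forall>n\<ge>N. nrm X (s n - l) < e"
    by blast
  then have "limitin mtopology s l sequentially"
    unfolding limit_metric_sequentially using r by (auto simp: ndist_def)
  then show "\<exists>x. limitin mtopology s x sequentially" ..
qed

lemma banach_spaceD:
  fixes s :: "nat \<Rightarrow> 'a"
  assumes "banach_space X" and r: "\<And>n. s n \<in> pts X"
    and "\<And>e. 0 < e \<Longrightarrow> \<exists>N. \<forall>m\<ge>N. \<forall>n\<ge>N. nrm X (s m - s n) < e"
  shows "\<exists>l\<in>pts X. \<forall>e>0. \<exists>N. \<forall>n\<ge>N. nrm X (s n - l) < e"
proof -
  have "MCauchy s"
    unfolding MCauchy_def ndist_def using r assms(3) by auto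
  then obtain l where "limitin mtopology s l sequentially"
    using assms(1) by (auto simp: banach_space_def mcomplete_def)
  then show ?thesis
    using r by (intro bexI[of _ l]) (auto simp: limit_metric_sequentially ndist_def)
qed

end

section \<open>Bounded operators, functionals and the dual norm\<close>

lemma normed_real_line: "normed real_line"
  by unfold_locales (auto simp: normed_space_def real_line_def abs_mult)

lemma real_line_simps [simp]: "pts real_line = UNIV" "nrm real_line x = \<bar>x\<bar>"
  by (simp_all add: real_line_def)

lemma bounded_opsI:
  assumes "\<And>x. x \<in> pts X \<Longrightarrow> T x \<in> pts Y"
    "\<And>x y. x \<in> pts X \<Longrightarrow> y \<in> pts X \<Longrightarrow> T (x + y) = T x + T y"
    "\<And>c x. x \<in> pts X \<Longrightarrow> T (c *\<^sub>R x) = c *\<^sub>R T x"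
    "\<And>x. x \<in> pts X \<Longrightarrow> nrm Y (T x) \<le> C * nrm X x"
  shows "T \<in> bounded_ops X Y"
proof -
  have "\<exists>C. \<forall>x\<in>pts X. nrm Y (T x) \<le> C * nrm X x" using assms(4) by blast
  then show ?thesis unfolding bounded_ops_def using assms(1-3) by blast
qed

lemma bounded_ops_in: "T \<in> bounded_ops X Y \<Longrightarrow> x \<in> pts X \<Longrightarrow> T x \<in> pts Y"
  and bounded_ops_add: "T \<in> bounded_ops X Y \<Longrightarrow> x \<in> pts X \<Longrightarrow> y \<in> pts X \<Longrightarrow> T (x + y) = T x + T y"
  and bounded_ops_scale: "T \<in> bounded_ops X Y \<Longrightarrow> x \<in> pts X \<Longrightarrow> T (c *\<^sub>R x) = c *\<^sub>R T x"
  by (auto simp: bounded_ops_def)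

context
  fixes X :: "'a::real_vector nspace" and Y :: "'b::real_vector nspace" and T
  assumes X: "normed X" and Y: "normed Y" and T: "T \<in> bounded_ops X Y"
begin

interpretation X: normed X by (rule X)
interpretation Y: normed Y by (rule Y)

lemma bounded_ops_diff: "x \<in> pts X \<Longrightarrow> y \<in> pts X \<Longrightarrow> T (x - y) = T x - T y"
  using bounded_ops_add[OF T, of x "- y"] bounded_ops_scale[OF T, of y "-1"] X.neg_in by simp

lemma bounded_ops_zero: "T 0 = 0"
  using bounded_ops_scale[OF T, of 0 0] X.zero_in by simp

lemma bounded_ops_sum:
  "(\<And>i. i \<in> I \<Longrightarrow> f i \<in> pts X) \<Longrightarrow> T (\<Sum>i\<in>I. f i) = (\<Sum>i\<in>I. T (f i))"
  by (induction I rule: infinite_finite_induct)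
     (auto simp: bounded_ops_zero bounded_ops_add[OF T] X.sum_in)

lemma bounded_ops_bdd: "bdd_above {nrm Y (T x) | x. x \<in> pts X \<and> nrm X x \<le> 1}"
proof -
  obtain C where C: "\<And>x. x \<in> pts X \<Longrightarrow> nrm Y (T x) \<le> C * nrm X x"
    using T unfolding bounded_ops_def by blast
  have "nrm Y (T x) \<le> \<bar>C\<bar>" if "x \<in> pts X" "nrm X x \<le> 1" for x
  proof -
    have "C * nrm X x \<le> \<bar>C\<bar> * nrm X x"
      using X.nonneg[OF that(1)] by (intro mult_right_mono) auto
    also have "\<dots> \<le> \<bar>C\<bar> * 1"
      using that by (intro mult_left_mono) auto
    finally show ?thesis using C[OF that(1)] by simp
  qed
  then show ?thesis by (intro bdd_aboveI) auto
qed

lemma op_norm_nonneg: "0 \<le> op_norm X Y T"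
  unfolding op_norm_def
  by (rule cSup_upper[OF _ bounded_ops_bdd]) (use X.zero_in bounded_ops_zero in force)

lemma op_norm_bound:
  assumes x: "x \<in> pts X"
  shows "nrm Y (T x) \<le> op_norm X Y T * nrm X x"
proof (cases "x = 0")
  case True
  then show ?thesis by (simp add: bounded_ops_zero)
next
  case False
  then have pos: "0 < nrm X x"
    using X.nonneg[OF x] X.eq_0[OF x] by simp
  have in': "(1 / nrm X x) *\<^sub>R x \<in> pts X"
    using x by (rule X.scale_in)
  have "nrm Y (T ((1 / nrm X x) *\<^sub>R x)) \<le> op_norm X Y T"
    unfolding op_norm_def
    by (rule cSup_upper[OF _ bounded_ops_bdd]) (use in' pos x in \<open>auto simp: X.scale\<close>)
  then show ?thesis
    using pos x by (simp add: bounded_ops_scale[OF T] Y.scale bounded_ops_in[OF T] field_simps)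
qed

end

lemma op_norm_le:
  assumes "normed X" "0 \<le> C" "\<And>x. x \<in> pts X \<Longrightarrow> nrm Y (T x) \<le> C * nrm X x"
  shows "op_norm X Y T \<le> C"
  unfolding op_norm_def
proof (rule cSup_least)
  interpret X: normed X by fact
  show "{nrm Y (T x) | x. x \<in> pts X \<and> nrm X x \<le> 1} \<noteq> {}"
    using X.zero_in by force
  fix r assume "r \<in> {nrm Y (T x) | x. x \<in> pts X \<and> nrm X x \<le> 1}"
  then obtain x where x: "r = nrm Y (T x)" "x \<in> pts X" "nrm X x \<le> 1" by blast
  then have "C * nrm X x \<le> C * 1" using assms(2) by (intro mult_left_mono)
  then show "r \<le> C" using assms(3)[OF x(2)] x(1) by simp
qed

lemma dualI:
  assumes "\<And>x y. x \<in> pts X \<Longrightarrow> y \<in> pts X \<Longrightarrow> \<phi> (x + y) = \<phi> x + \<phi> y"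
    "\<And>c x. x \<in> pts X \<Longrightarrow> \<phi> (c *\<^sub>R x) = c * \<phi> x"
    "\<And>x. x \<in> pts X \<Longrightarrow> \<bar>\<phi> x\<bar> \<le> C * nrm X x"
    "\<And>x. x \<notin> pts X \<Longrightarrow> \<phi> x = 0"
  shows "\<phi> \<in> pts (dual X)"
  using assms by (auto simp: dual_def intro!: bounded_opsI)

lemma dual_bounded_ops: "\<phi> \<in> pts (dual X) \<Longrightarrow> \<phi> \<in> bounded_ops X real_line"
  and dual_outside: "\<phi> \<in> pts (dual X) \<Longrightarrow> x \<notin> pts X \<Longrightarrow> \<phi> x = 0"
  by (auto simp: dual_def)

lemma dual_nrm_le:
  assumes "normed X" "0 \<le> C" "\<And>x. x \<in> pts X \<Longrightarrow> \<bar>\<phi> x\<bar> \<le> C * nrm X x"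
  shows "nrm (dual X) \<phi> \<le> C"
  unfolding dual_def using op_norm_le[of X C real_line \<phi>] assms by simp

lemma dual_restrict:
  assumes "normed X" "linear h" "\<And>x. x \<in> pts X \<Longrightarrow> \<bar>h x\<bar> \<le> C * nrm X x"
  shows "(\<lambda>x. if x \<in> pts X then h x else 0) \<in> pts (dual X)"
proof -
  interpret X: normed X by fact
  show ?thesis
    by (rule dualI[of _ _ C])
       (use assms in \<open>auto simp: X.add_in X.scale_in linear_add linear_scale\<close>)
qed

context normed begin

lemmas dual_add = bounded_ops_add[OF dual_bounded_ops]
  and dual_diff = bounded_ops_diff[OF normed_axioms normed_real_line dual_bounded_ops]
  and dual_zero = bounded_ops_zero[OF normed_axioms normed_real_line dual_bounded_ops]
  and dual_sum = bounded_ops_sum[OF normed_axioms normed_real_line dual_bounded_ops]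

lemma dual_scale: "\<phi> \<in> pts (dual X) \<Longrightarrow> x \<in> pts X \<Longrightarrow> \<phi> (c *\<^sub>R x) = c * \<phi> x"
  using bounded_ops_scale[OF dual_bounded_ops] by fastforce

lemma dual_bound:
  assumes "\<phi> \<in> pts (dual X)" "x \<in> pts X"
  shows "\<bar>\<phi> x\<bar> \<le> nrm (dual X) \<phi> * nrm X x"
  using op_norm_bound[OF normed_axioms normed_real_line dual_bounded_ops[OF assms(1)] assms(2)]
  by (simp add: dual_def)

lemma dual_nrm_nonneg: "\<phi> \<in> pts (dual X) \<Longrightarrow> 0 \<le> nrm (dual X) \<phi>"
  using op_norm_nonneg[OF normed_axioms normed_real_line dual_bounded_ops] by (simp add: dual_def)

lemma normed_dual: "normed (dual X)"
proof
  have sub: "subspace (pts (dual X))"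
    unfolding subspace_def
  proof (intro conjI ballI allI)
    show "0 \<in> pts (dual X)"
      by (rule dualI[of _ _ 0]) auto
    fix \<phi> assume p: "\<phi> \<in> pts (dual X)"
    show "c *\<^sub>R \<phi> \<in> pts (dual X)" for c
    proof (rule dualI[of _ _ "\<bar>c\<bar> * nrm (dual X) \<phi>"])
      show "\<bar>(c *\<^sub>R \<phi>) x\<bar> \<le> \<bar>c\<bar> * nrm (dual X) \<phi> * nrm X x" if "x \<in> pts X" for x
        using mult_left_mono[OF dual_bound[OF p that], of "\<bar>c\<bar>"] by (simp add: abs_mult mult.assoc)
    qed (use p in \<open>auto simp: dual_add dual_scale dual_outside algebra_simps\<close>)
    fix \<psi> assume q: "\<psi> \<in> pts (dual X)"
    show "\<phi> + \<psi> \<in> pts (dual X)"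
    proof (rule dualI[of _ _ "nrm (dual X) \<phi> + nrm (dual X) \<psi>"])
      show "\<bar>(\<phi> + \<psi>) x\<bar> \<le> (nrm (dual X) \<phi> + nrm (dual X) \<psi>) * nrm X x" if "x \<in> pts X" for x
        using dual_bound[OF p that] dual_bound[OF q that] by (simp add: algebra_simps)
    qed (use p q in \<open>auto simp: dual_add dual_scale dual_outside algebra_simps\<close>)
  qed
  have "\<phi> = 0" if p: "\<phi> \<in> pts (dual X)" and "nrm (dual X) \<phi> = 0" for \<phi>
    using dual_bound[OF p] that(2) dual_outside[OF p] by (fastforce simp: fun_eq_iff)
  moreover have "nrm (dual X) 0 = 0"
    by (rule antisym) (use subspace_0[OF sub] in \<open>auto intro!: dual_nrm_le dual_nrm_nonneg normed_axioms\<close>)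
  moreover have sc: "nrm (dual X) (c *\<^sub>R \<phi>) \<le> \<bar>c\<bar> * nrm (dual X) \<phi>" if "\<phi> \<in> pts (dual X)" for c \<phi>
    by (rule dual_nrm_le[OF normed_axioms])
       (use that in \<open>auto simp: dual_nrm_nonneg abs_mult mult.assoc intro!: mult_left_mono dual_bound\<close>)
  moreover have "\<bar>c\<bar> * nrm (dual X) \<phi> \<le> nrm (dual X) (c *\<^sub>R \<phi>)" if p: "\<phi> \<in> pts (dual X)" for c \<phi>
  proof (cases "c = 0")
    case False
    then show ?thesis
      using sc[OF subspace_scale[OF sub p, of c], of "1 / c"] by (simp add: field_simps)
  qed (use dual_nrm_nonneg subspace_0[OF sub] in simp)
  moreover have "nrm (dual X) (\<phi> + \<psi>) \<le> nrm (dual X) \<phi> + nrm (dual X) \<psi>"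
    if p: "\<phi> \<in> pts (dual X)" and q: "\<psi> \<in> pts (dual X)" for \<phi> \<psi>
  proof (rule dual_nrm_le[OF normed_axioms])
    show "0 \<le> nrm (dual X) \<phi> + nrm (dual X) \<psi>"
      using p q by (simp add: dual_nrm_nonneg)
    show "\<bar>(\<phi> + \<psi>) x\<bar> \<le> (nrm (dual X) \<phi> + nrm (dual X) \<psi>) * nrm X x" if "x \<in> pts X" for x
      using dual_bound[OF p that] dual_bound[OF q that] by (simp add: algebra_simps)
  qed
  ultimately show "normed_space (dual X)"
    unfolding normed_space_def using sub dual_nrm_nonneg by (auto intro: antisym)
qed

text \<open>Linearity and the bound survive pointwise limits. The same fact gives completeness of
  the dual and places the weak* limits of tails in the bidual.\<close>

lemma dual_limit:
  assumes s: "\<And>n. s n \<in> pts (dual X)" and B: "\<And>n. nrm (dual X) (s n) \<le> C"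
    and lim: "\<And>x. x \<in> pts X \<Longrightarrow> (\<lambda>n. s n x) \<longlonglongrightarrow> l x" and out: "\<And>x. x \<notin> pts X \<Longrightarrow> l x = 0"
  shows "l \<in> pts (dual X)" "nrm (dual X) l \<le> C"
proof -
  have C: "0 \<le> C"
    using dual_nrm_nonneg[OF s] B order_trans by blast
  have bd: "\<bar>l x\<bar> \<le> C * nrm X x" if "x \<in> pts X" for x
  proof (rule LIMSEQ_le_const2[OF tendsto_rabs[OF lim[OF that]]])
    show "\<exists>N. \<forall>n\<ge>N. \<bar>s n x\<bar> \<le> C * nrm X x"
      using dual_bound[OF s that] mult_right_mono[OF B nonneg[OF that]] order_trans by blast
  qed
  show "l \<in> pts (dual X)"
  proof (rule dualI[OF _ _ bd out])
    fix x y assume xy: "x \<in> pts X" "y \<in> pts X"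
    have "(\<lambda>n. s n (x + y)) \<longlonglongrightarrow> l x + l y"
      using tendsto_add[OF lim[OF xy(1)] lim[OF xy(2)]] xy by (simp add: dual_add[OF s])
    then show "l (x + y) = l x + l y"
      using lim[OF add_in[OF xy]] LIMSEQ_unique by blast
  next
    fix c x assume x: "x \<in> pts X"
    have "(\<lambda>n. s n (c *\<^sub>R x)) \<longlonglongrightarrow> c * l x"
      using tendsto_mult_left[OF lim[OF x]] x by (simp add: dual_scale[OF s])
    then show "l (c *\<^sub>R x) = c * l x"
      using lim[OF scale_in[OF x]] LIMSEQ_unique by blast
  qed
  show "nrm (dual X) l \<le> C"
    by (rule dual_nrm_le[OF normed_axioms C bd])
qed

lemma banach_dual: "banach_space (dual X)"
proof -
  interpret D: normed "dual X" by (rule normed_dual)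
  show ?thesis
  proof (rule D.banach_spaceI)
    fix s :: "nat \<Rightarrow> 'a \<Rightarrow> real" assume s: "\<And>n. s n \<in> pts (dual X)"
      and cau: "\<And>e. 0 < e \<Longrightarrow> \<exists>N. \<forall>m\<ge>N. \<forall>n\<ge>N. nrm (dual X) (s m - s n) < e"
    have "convergent (\<lambda>n. s n x)" if x: "x \<in> pts X" for x
    proof (rule Cauchy_convergent, rule CauchyI')
      fix e :: real assume "0 < e"
      then have "0 < e / (nrm X x + 1)" using nonneg[OF x] by simp
      then obtain N where N: "\<And>m n. m \<ge> N \<Longrightarrow> n \<ge> N \<Longrightarrow> nrm (dual X) (s m - s n) < e / (nrm X x + 1)"
        using cau by blast
      have "dist (s m x) (s n x) < e" if "m \<ge> N" "n \<ge> N" for m n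
      proof -
        have "\<bar>(s m - s n) x\<bar> \<le> nrm (dual X) (s m - s n) * nrm X x"
          using s x by (intro dual_bound D.diff_in)
        also have "\<dots> \<le> nrm (dual X) (s m - s n) * (nrm X x + 1)"
          using s by (intro mult_left_mono D.nonneg D.diff_in) auto
        also have "\<dots> < e"
          using N[OF that] nonneg[OF x] by (simp add: field_simps)
        finally show ?thesis by (simp add: dist_real_def)
      qed
      then show "\<exists>M. \<forall>m\<ge>M. \<forall>n>m. dist (s m x) (s n x) < e"
        by (meson le_trans less_imp_le)
    qed
    then have "\<exists>l. \<forall>x. (x \<in> pts X \<longrightarrow> (\<lambda>n. s n x) \<longlonglongrightarrow> l x) \<and> (x \<notin> pts X \<longrightarrow> l x = 0)"
      unfolding convergent_def by (intro choice) auto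
    then obtain l where l: "\<And>x. x \<in> pts X \<Longrightarrow> (\<lambda>n. s n x) \<longlonglongrightarrow> l x" "\<And>x. x \<notin> pts X \<Longrightarrow> l x = 0"
      by blast
    \<comment> \<open>For fixed \<open>n\<close> the differences \<open>s (k + N) - s n\<close>
      converge pointwise in \<open>k\<close>, and the limit inherits the bound \<open>e\<close>. The
      case \<open>n = N\<close> puts \<open>l - s N\<close>, and with it \<open>l\<close>, in the
      dual.\<close>
    have near: "l - s n \<in> pts (dual X) \<and> nrm (dual X) (l - s n) \<le> e"
      if N: "\<And>m n. m \<ge> N \<Longrightarrow> n \<ge> N \<Longrightarrow> nrm (dual X) (s m - s n) < e" and n: "n \<ge> N" for n N e
    proof -
      have *: "s (k + N) - s n \<in> pts (dual X)" "nrm (dual X) (s (k + N) - s n) \<le> e"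
        "x \<in> pts X \<Longrightarrow> (\<lambda>k. (s (k + N) - s n) x) \<longlonglongrightarrow> (l - s n) x"
        "x \<notin> pts X \<Longrightarrow> (l - s n) x = 0" for k x
        using N[of "k + N" n] n s D.diff_in LIMSEQ_ignore_initial_segment[OF l(1)]
        by (auto simp: l(2) dual_outside dual_outside[OF s] intro!: tendsto_diff less_imp_le)
      show ?thesis using dual_limit[OF *] by blast
    qed
    obtain N where "\<And>m n. m \<ge> N \<Longrightarrow> n \<ge> N \<Longrightarrow> nrm (dual X) (s m - s n) < 1"
      using cau[of 1] by auto
    from near[OF this order_refl] have "l - s N \<in> pts (dual X)" by blast
    from D.add_in[OF this s[of N]] have lin: "l \<in> pts (dual X)" by simp
    moreover have "\<exists>N. \<forall>n\<ge>N. nrm (dual X) (s n - l) < e" if "0 < e" for e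
    proof -
      obtain N where N: "\<And>m n. m \<ge> N \<Longrightarrow> n \<ge> N \<Longrightarrow> nrm (dual X) (s m - s n) < e / 2"
        using cau[OF half_gt_zero[OF \<open>0 < e\<close>]] by blast
      have "nrm (dual X) (s n - l) < e" if "n \<ge> N" for n
        using near[OF N that] D.commute[OF s lin, of n] \<open>0 < e\<close> by simp
      then show ?thesis by blast
    qed
    ultimately show "\<exists>l\<in>pts (dual X). \<forall>e>0. \<exists>N. \<forall>n\<ge>N. nrm (dual X) (s n - l) < e" by blast
  qed
qed

end

section \<open>Local reflexivity\<close>

text \<open>The norm has arbitrary values outside the space, while \<open>separation\<close> needs a
  functional that is sublinear on the whole type. Composing the norm with an algebraic projection,
  which need not be continuous in any sense, repairs this.\<close>

lemma (in normed) projection: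
  obtains \<pi> :: "'a \<Rightarrow> 'a" where "linear \<pi>" "\<And>x. \<pi> x \<in> pts X" "\<And>x. x \<in> pts X \<Longrightarrow> \<pi> x = x"
proof -
  have "\<exists>g. g ` UNIV \<subseteq> pts X \<and> linear g \<and> (\<forall>v\<in>pts X. g (id v) = v)"
    by (rule linear_exists_left_inverse_on) (auto simp: subspace linear_ident)
  then show ?thesis using that by auto
qed

lemma (in normed) sublinear_nrm:
  assumes "linear \<pi>" "\<And>x. \<pi> x \<in> pts X"
  shows "sublinear (\<lambda>x. nrm X (\<pi> x))"
  using assms by (auto simp: sublinear_def linear_add linear_scale triangle scale)

definition single :: "'i \<Rightarrow> 'a \<Rightarrow> 'i \<Rightarrow> 'a::zero" where
  "single i v = (\<lambda>j. if j = i then v else 0)"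

lemma linear_single: "linear (single i)"
  by (rule linearI) (auto simp: single_def fun_eq_iff)

lemma sum_single: "finite A \<Longrightarrow> (\<Sum>i\<in>A. single i (u i)) = (\<lambda>j. if j \<in> A then u j else 0)"
  by (auto simp: fun_eq_iff sum_fun_app single_def)

lemma (in normed) dual_nrm_lessE:
  assumes \<psi>: "\<psi> \<in> pts (dual X)" and t: "t < nrm (dual X) \<psi>"
  obtains x where "x \<in> pts X" "nrm X x \<le> 1" "t < \<psi> x"
proof -
  have "\<exists>r\<in>{nrm real_line (\<psi> x) | x. x \<in> pts X \<and> nrm X x \<le> 1}. t < r"
    using t less_cSup_iff[OF _ bounded_ops_bdd[OF normed_axioms normed_real_line dual_bounded_ops[OF \<psi>]]]
      zero_in by (force simp: dual_def op_norm_def)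
  then obtain x where x: "x \<in> pts X" "nrm X x \<le> 1" "t < \<bar>\<psi> x\<bar>" by auto
  show ?thesis
  proof (cases "0 \<le> \<psi> x")
    case True
    then show ?thesis using x that by simp
  next
    case False
    then show ?thesis
      using x that[of "- x"] neg_in[OF x(1)] neg[OF x(1)] dual_scale[OF \<psi> x(1), of "-1"] by simp
  qed
qed

text \<open>A form of Helly's theorem. If no \<open>y\<close> worked, the convex set of all pairs of
  combinations and errors would avoid the open unit ball of a seminorm. The separating functional
  consists of functionals \<open>\<psi> i\<close> in the dual of \<open>Y\<close> and scalars
  \<open>c\<close>, and its linear part vanishes on all families in \<open>Y\<close>. That vanishing
  is an identity between elements of the dual, so \<open>\<eta> k\<close> may be applied to it, and
  the outcome contradicts \<open>dom\<close>.\<close>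

lemma helly_bidual:
  fixes Y :: "'y::real_vector nspace" and K :: "'k set" and A :: "'i set"
    and a :: "'i \<Rightarrow> 'k \<Rightarrow> real" and N :: "'i \<Rightarrow> real"
  assumes Y: "normed Y" and fin: "finite K" "finite A" "finite \<Phi>" and \<Phi>: "\<Phi> \<subseteq> pts (dual Y)"
    and \<eta>: "\<And>k. k \<in> K \<Longrightarrow> \<eta> k \<in> pts (dual (dual Y))" and N: "\<And>i. i \<in> A \<Longrightarrow> 0 \<le> N i"
    and dom: "\<And>i \<psi>. i \<in> A \<Longrightarrow> \<psi> \<in> pts (dual Y) \<Longrightarrow>
      (\<Sum>k\<in>K. a i k * \<eta> k \<psi>) \<le> N i * nrm (dual Y) \<psi>"
    and e: "0 < e"
  obtains y where "\<And>k. y k \<in> pts Y" "\<And>i. i \<in> A \<Longrightarrow> nrm Y (\<Sum>k\<in>K. a i k *\<^sub>R y k) \<le> N i + e"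
    "\<And>k \<phi>. k \<in> K \<Longrightarrow> \<phi> \<in> \<Phi> \<Longrightarrow> \<bar>\<phi> (y k) - \<eta> k \<phi>\<bar> \<le> e"
proof (rule ccontr)
  assume contra: "\<not> thesis"
  note witness = that
  interpret Y: normed Y by (rule Y)
  interpret Y': normed "dual Y" by (rule Y.normed_dual)
  obtain \<pi> where \<pi>: "linear \<pi>" "\<And>x. \<pi> x \<in> pts Y" "\<And>x. x \<in> pts Y \<Longrightarrow> \<pi> x = x"
    using Y.projection by blast
  define n where "n v = nrm Y (\<pi> v)" for v
  have n: "sublinear n" using Y.sublinear_nrm[OF \<pi>(1,2)] by (simp add: n_def [abs_def])
  have n_nonneg: "0 \<le> n v" and n_minus: "n (- v) = n v" for v
    by (simp_all add: n_def Y.nonneg \<pi> linear_neg Y.neg)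
  \<comment> \<open>Each norm is divided by its permitted bound, so \<open>P u \<le> 1\<close>
    states all norm conditions at once. The inserted 0 covers an empty \<open>A\<close>.\<close>
  define P where "P u = Max (insert 0 ((\<lambda>i. n (u i) / (N i + e)) ` A))" for u :: "'i \<Rightarrow> 'y"
  have P_le: "P u \<le> c \<longleftrightarrow> 0 \<le> c \<and> (\<forall>i\<in>A. n (u i) / (N i + e) \<le> c)" for u c
    unfolding P_def using fin(2) by (subst Max_le_iff) auto
  have P_ge: "0 \<le> P u" "i \<in> A \<Longrightarrow> n (u i) / (N i + e) \<le> P u" for u and i
    using P_le[of u "P u"] by auto
  have Ne: "0 < N i + e" if "i \<in> A" for i using N[OF that] e by simp
  define L where "L = K \<times> \<Phi>"
  have finL: "finite L" using fin by (simp add: L_def)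
  \<comment> \<open>With the total error divided by \<open>e\<close>, a value of \<open>p\<close>
    below 1 implies the norm conditions and the closeness conditions together, so every
    \<open>d y\<close> has \<open>p\<close>-value at least 1.\<close>
  define p where "p = (\<lambda>(u, w :: 'k \<times> ('y \<Rightarrow> real) \<Rightarrow> real). P u + (\<Sum>x\<in>L. \<bar>w x\<bar>) / e)"
  have p: "sublinear p"
  proof -
    have "P (u + u') \<le> P u + P u'" for u u'
      unfolding P_le
    proof (intro conjI ballI add_nonneg_nonneg P_ge)
      fix i assume i: "i \<in> A"
      have "n ((u + u') i) / (N i + e) \<le> n (u i) / (N i + e) + n (u' i) / (N i + e)"
        using Ne[OF i] sublinear_add[OF n, of "u i" "u' i"]
        by (simp add: add_divide_distrib[symmetric] divide_right_mono)
      also have "\<dots> \<le> P u + P u'"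
        using i by (intro add_mono P_ge)
      finally show "n ((u + u') i) / (N i + e) \<le> P u + P u'" .
    qed
    moreover have "P (c *\<^sub>R u) = c * P u" if "0 \<le> c" for c u
    proof (cases "c = 0")
      case True
      then show ?thesis using P_le[of "0 :: 'i \<Rightarrow> 'y" 0] P_ge(1)[of "0 :: 'i \<Rightarrow> 'y"] sublinear_0[OF n] by simp
    next
      case False
      with that have c: "0 < c" by simp
      have "P (c *\<^sub>R u) \<le> c * P u" if c: "0 < c" for c u
        unfolding P_le using c P_ge(1)[of u] P_ge(2)[of _ u]
        by (auto simp: sublinear_scale[OF n] times_divide_eq_right[symmetric] simp del: times_divide_eq_right
            intro!: mult_left_mono)
      from this[OF c, of u] this[of "1 / c" "c *\<^sub>R u"] c show ?thesis
        by (simp add: field_simps)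
    qed
    moreover have "(\<Sum>x\<in>L. \<bar>w x + w' x\<bar>) / e \<le> (\<Sum>x\<in>L. \<bar>w x\<bar>) / e + (\<Sum>x\<in>L. \<bar>w' x\<bar>) / e"
      for w w' :: "'k \<times> ('y \<Rightarrow> real) \<Rightarrow> real"
      using e by (simp add: add_divide_distrib[symmetric] sum.distrib[symmetric] divide_right_mono sum_mono)
    moreover have "(\<Sum>x\<in>L. \<bar>c * w x\<bar>) / e = c * ((\<Sum>x\<in>L. \<bar>w x\<bar>) / e)"
      if "0 \<le> c" for c and w :: "'k \<times> ('y \<Rightarrow> real) \<Rightarrow> real"
      using that by (simp add: abs_mult sum_distrib_left)
    ultimately show ?thesis
      unfolding sublinear_def p_def
      by (auto simp: distrib_left add_mono add.assoc add.left_commute split: prod.splits)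
        (smt (verit, best))
  qed
  define d where "d y = (\<lambda>i. \<Sum>k\<in>K. a i k *\<^sub>R y k, \<lambda>x. if x \<in> L then snd x (y (fst x)) - \<eta> (fst x) (snd x) else 0)"
    for y :: "'k \<Rightarrow> 'y"
  define U where "U = {y :: 'k \<Rightarrow> 'y. \<forall>k. y k \<in> pts Y}"
  have dual_L: "snd x \<in> pts (dual Y)" "fst x \<in> K" if "x \<in> L" for x
    using that \<Phi> by (auto simp: L_def)
  have "1 \<le> p (d y)" if y: "y \<in> U" for y
  proof (rule ccontr)
    assume "\<not> 1 \<le> p (d y)"
    then have p1: "P (fst (d y)) + (\<Sum>x\<in>L. \<bar>snd (d y) x\<bar>) / e < 1"
      by (simp add: p_def case_prod_beta)
    have s0: "0 \<le> (\<Sum>x\<in>L. \<bar>snd (d y) x\<bar>) / e" using e by (simp add: sum_nonneg)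
    have "nrm Y (\<Sum>k\<in>K. a i k *\<^sub>R y k) \<le> N i + e" if i: "i \<in> A" for i
    proof -
      have "n (fst (d y) i) / (N i + e) \<le> 1"
        using P_ge(2)[OF i, of "fst (d y)"] p1 s0 by linarith
      then have "n (fst (d y) i) \<le> N i + e" using Ne[OF i] by simp
      moreover have "(\<Sum>k\<in>K. a i k *\<^sub>R y k) \<in> pts Y"
        using y by (auto simp: U_def intro!: Y.sum_in Y.scale_in)
      ultimately show ?thesis by (simp add: d_def n_def \<pi>)
    qed
    moreover have "\<bar>\<phi> (y k) - \<eta> k \<phi>\<bar> \<le> e" if "k \<in> K" "\<phi> \<in> \<Phi>" for k \<phi>
    proof -
      have kL: "(k, \<phi>) \<in> L" using that by (simp add: L_def)
      have "\<bar>snd (d y) (k, \<phi>)\<bar> \<le> (\<Sum>x\<in>L. \<bar>snd (d y) x\<bar>)"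
        by (rule member_le_sum[OF kL _ finL]) simp
      also have "\<dots> \<le> e" using p1 P_ge(1)[of "fst (d y)"] e by (simp add: field_simps) (smt (verit, best) mult_nonneg_nonneg)
      finally show ?thesis using kL by (simp add: d_def)
    qed
    ultimately show False using witness[of y] y contra by (auto simp: U_def)
  qed
  moreover have "convex (d ` U)"
  proof (rule convexI)
    fix f g and s t :: real
    assume "f \<in> d ` U" "g \<in> d ` U" and st: "0 \<le> s" "0 \<le> t" "s + t = 1"
    then obtain y y' where y: "f = d y" "g = d y'" "y \<in> U" "y' \<in> U" by blast
    have "s *\<^sub>R f + t *\<^sub>R g = d (s *\<^sub>R y + t *\<^sub>R y')"
    proof (rule prod_eqI)
      show "fst (s *\<^sub>R f + t *\<^sub>R g) = fst (d (s *\<^sub>R y + t *\<^sub>R y'))"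
        by (auto simp: y d_def fun_eq_iff scaleR_sum_right sum.distrib algebra_simps)
      have "s * (snd x (y (fst x)) - \<eta> (fst x) (snd x)) + t * (snd x (y' (fst x)) - \<eta> (fst x) (snd x))
        = snd x (s *\<^sub>R y (fst x) + t *\<^sub>R y' (fst x)) - \<eta> (fst x) (snd x)" if x: "x \<in> L" for x
      proof -
        have "snd x (s *\<^sub>R y (fst x) + t *\<^sub>R y' (fst x)) = s * snd x (y (fst x)) + t * snd x (y' (fst x))"
          using y dual_L[OF x] by (simp add: U_def Y.dual_add Y.dual_scale Y.scale_in)
        moreover have "s * \<eta> (fst x) (snd x) + t * \<eta> (fst x) (snd x) = \<eta> (fst x) (snd x)"
          using st(3) by (simp add: distrib_right[symmetric])
        ultimately show ?thesis by (simp add: algebra_simps)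
      qed
      then show "snd (s *\<^sub>R f + t *\<^sub>R g) = snd (d (s *\<^sub>R y + t *\<^sub>R y'))"
        by (auto simp: y d_def fun_eq_iff)
    qed
    moreover have "s *\<^sub>R y + t *\<^sub>R y' \<in> U"
      using y by (simp add: U_def Y.add_in Y.scale_in)
    ultimately show "s *\<^sub>R f + t *\<^sub>R g \<in> d ` U" by blast
  qed
  moreover have U0: "0 \<in> U" by (simp add: U_def Y.zero_in)
  ultimately obtain h where h: "linear h" "\<And>x. h x \<le> p x" "\<And>y. y \<in> U \<Longrightarrow> 1 \<le> h (d y)"
    using separation[OF p, of "d ` U" 1] by (metis (no_types, lifting) empty_iff image_iff image_is_empty)
  define \<psi>0 where "\<psi>0 i v = h (single i v, 0)" for i v
  define c where "c x = h (0, single x 1)" for x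
  have lin0: "linear (\<psi>0 i)" for i
    unfolding \<psi>0_def
    by (rule linear_compose[OF _ h(1), unfolded o_def])
       (use linear_single[of i] in \<open>auto simp: linear_iff\<close>)
  \<comment> \<open>\<open>p\<close> ignores the coordinates outside \<open>A\<close> and
    \<open>L\<close>, and so does \<open>h\<close>, being bounded by \<open>p\<close> on both
    \<open>r\<close> and \<open>- r\<close>; what remains is a finite sum.\<close>
  have split: "h (u, w) = (\<Sum>i\<in>A. \<psi>0 i (u i)) + (\<Sum>x\<in>L. w x * c x)" for u w
  proof -
    define r where "r = (u, w) - ((\<Sum>i\<in>A. (single i (u i), 0)) + (\<Sum>x\<in>L. w x *\<^sub>R (0, single x 1)))"
    have "fst r i = 0" if "i \<in> A" for i
      using that fin(2) by (simp add: r_def fst_sum sum_single)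
    moreover have "snd r x = 0" if "x \<in> L" for x
    proof -
      have "w x *\<^sub>R single x 1 = single x (w x)" for x
        by (auto simp: single_def fun_eq_iff)
      then show ?thesis
        using that finL by (simp add: r_def snd_sum sum_single)
    qed
    ultimately have "p r = 0" "p (- r) = 0"
      using P_le[of "fst r" 0] P_ge(1)[of "fst r"] P_le[of "- fst r" 0] P_ge(1)[of "- fst r"] sublinear_0[OF n]
      by (auto simp: p_def case_prod_beta)
    then have "h r = 0"
      using h(2)[of r] h(2)[of "- r"] linear_neg[OF h(1), of r] by simp
    moreover have "h (0, w x *\<^sub>R single x 1) = w x * c x" for x
      using linear_scale[OF h(1), of "w x" "(0, single x 1)"] by (simp add: c_def)
    ultimately show ?thesis
      by (simp add: r_def linear_diff[OF h(1)] linear_add[OF h(1)] linear_sum[OF h(1)] \<psi>0_def)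
  qed
  have P_single: "P (single i v) \<le> n v / (N i + e)" if "i \<in> A" for i v
    using divide_nonneg_pos[OF n_nonneg Ne[OF that]] sublinear_0[OF n] by (auto simp: P_le single_def)
  have \<psi>0_le: "\<bar>\<psi>0 i v\<bar> \<le> 1 / (N i + e) * nrm Y v" if "i \<in> A" "v \<in> pts Y" for i v
    using h(2)[of "(single i v, 0)"] h(2)[of "(single i (- v), 0)"] P_single[OF that(1), of v]
      P_single[OF that(1), of "- v"] linear_neg[OF lin0, of i v] that(2)
    by (simp add: p_def \<psi>0_def[symmetric] n_minus n_def[of v] \<pi>)
  define \<psi> where "\<psi> i v = (if v \<in> pts Y then \<psi>0 i v else 0)" for i v
  have \<psi>: "\<psi> i \<in> pts (dual Y)" if "i \<in> A" for i
    unfolding \<psi>_def using dual_restrict[OF Y lin0 \<psi>0_le[OF that]] by simp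
  define cv where "cv = (\<Sum>x\<in>L. \<eta> (fst x) (snd x) * c x)"
  define G where "G y = (\<Sum>i\<in>A. \<psi>0 i (\<Sum>k\<in>K. a i k *\<^sub>R y k)) + (\<Sum>x\<in>L. snd x (y (fst x)) * c x)" for y
  have hd: "h (d y) = G y - cv" for y
    unfolding d_def split G_def cv_def by (simp add: algebra_simps sum_subtractf)
  have cv: "cv \<le> -1"
  proof -
    have "snd x 0 = 0" if "x \<in> L" for x using Y.dual_zero dual_L that by blast
    then have "G 0 = 0" by (simp add: G_def linear_0[OF lin0])
    then show ?thesis using h(3)[OF U0] hd[of 0] by simp
  qed
  \<comment> \<open>\<open>G\<close> is homogeneous on \<open>U\<close> and bounded below there, so
    it vanishes: the multiple with factor \<open>cv / G y\<close> would give
    \<open>1 \<le> 0\<close>.\<close>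
  have G0: "G y = 0" if y: "y \<in> U" for y
  proof (rule ccontr)
    assume nz: "G y \<noteq> 0"
    have "G (t *\<^sub>R y) = t * G y" for t
    proof -
      have "snd x (t *\<^sub>R y (fst x)) = t * snd x (y (fst x))" if "x \<in> L" for x
        using y dual_L[OF that] by (simp add: U_def Y.dual_scale)
      moreover have "(\<Sum>k\<in>K. a i k *\<^sub>R t *\<^sub>R y k) = t *\<^sub>R (\<Sum>k\<in>K. a i k *\<^sub>R y k)" for i
        by (simp add: scaleR_sum_right mult.commute)
      ultimately show ?thesis
        by (simp add: G_def linear_scale[OF lin0] sum_distrib_left distrib_left mult.assoc)
    qed
    moreover have "t *\<^sub>R y \<in> U" for t using y by (simp add: U_def Y.scale_in)
    ultimately have "1 \<le> t * G y - cv" for t using h(3) hd by metis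
    from this[of "(cv - 0) / G y"] nz show False by simp
  qed
  \<comment> \<open>Testing \<open>G\<close> on families supported at the single index
    \<open>k\<close> gives a linear relation in the dual of \<open>Y\<close>, to which
    \<open>\<eta> k\<close> is applied.\<close>
  have "(\<Sum>i\<in>A. a i k * \<eta> k (\<psi> i)) + (\<Sum>\<phi>\<in>\<Phi>. c (k, \<phi>) * \<eta> k \<phi>) = 0" if k: "k \<in> K" for k
  proof -
    have "(\<Sum>i\<in>A. a i k *\<^sub>R \<psi> i) + (\<Sum>\<phi>\<in>\<Phi>. c (k, \<phi>) *\<^sub>R \<phi>) = 0"
    proof
      fix v
      show "((\<Sum>i\<in>A. a i k *\<^sub>R \<psi> i) + (\<Sum>\<phi>\<in>\<Phi>. c (k, \<phi>) *\<^sub>R \<phi>)) v = 0 v"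
      proof (cases "v \<in> pts Y")
        case False
        then show ?thesis using \<Phi> by (auto simp: sum_fun_app \<psi>_def dual_outside subset_iff intro!: sum.neutral)
      next
        case True
        have "single k v \<in> U" using True by (simp add: U_def single_def Y.zero_in)
        from G0[OF this]
        have "0 = (\<Sum>i\<in>A. \<psi>0 i (\<Sum>k'\<in>K. a i k' *\<^sub>R single k v k')) + (\<Sum>x\<in>L. snd x (single k v (fst x)) * c x)"
          by (simp add: G_def)
        also have "(\<Sum>i\<in>A. \<psi>0 i (\<Sum>k'\<in>K. a i k' *\<^sub>R single k v k')) = (\<Sum>i\<in>A. a i k * \<psi> i v)"
        proof (rule sum.cong)
          fix i
          have "(\<Sum>k'\<in>K. a i k' *\<^sub>R single k v k') = (\<Sum>k'\<in>K. if k' = k then a i k *\<^sub>R v else 0)"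
            by (rule sum.cong) (auto simp: single_def)
          also have "\<dots> = a i k *\<^sub>R v" using k fin(1) by simp
          finally show "\<psi>0 i (\<Sum>k'\<in>K. a i k' *\<^sub>R single k v k') = a i k * \<psi> i v"
            using True by (simp add: linear_scale[OF lin0] \<psi>_def)
        qed simp
        also have "(\<Sum>x\<in>L. snd x (single k v (fst x)) * c x) = (\<Sum>k'\<in>K. \<Sum>\<phi>\<in>\<Phi>. \<phi> (single k v k') * c (k', \<phi>))"
          unfolding L_def by (simp add: sum.cartesian_product case_prod_beta)
        also have "\<dots> = (\<Sum>k'\<in>K. if k' = k then (\<Sum>\<phi>\<in>\<Phi>. \<phi> v * c (k, \<phi>)) else 0)"
        proof (rule sum.cong)
          fix k'
          have "\<phi> 0 = 0" if "\<phi> \<in> \<Phi>" for \<phi> using that \<Phi> Y.dual_zero by blast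
          then show "(\<Sum>\<phi>\<in>\<Phi>. \<phi> (single k v k') * c (k', \<phi>)) = (if k' = k then (\<Sum>\<phi>\<in>\<Phi>. \<phi> v * c (k, \<phi>)) else 0)"
            by (simp add: single_def sum.neutral)
        qed simp
        also have "\<dots> = (\<Sum>\<phi>\<in>\<Phi>. \<phi> v * c (k, \<phi>))" using k fin(1) by simp
        finally show ?thesis by (simp add: sum_fun_app mult.commute)
      qed
    qed
    then have "\<eta> k ((\<Sum>i\<in>A. a i k *\<^sub>R \<psi> i) + (\<Sum>\<phi>\<in>\<Phi>. c (k, \<phi>) *\<^sub>R \<phi>)) = 0"
      using Y'.dual_zero[OF \<eta>[OF k]] by simp
    moreover have "\<phi> \<in> pts (dual Y)" if "\<phi> \<in> \<Phi>" for \<phi> using that \<Phi> by blast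
    ultimately show ?thesis
      by (simp add: Y'.dual_add[OF \<eta>[OF k]] Y'.dual_sum[OF \<eta>[OF k]] Y'.dual_scale[OF \<eta>[OF k]]
          Y'.sum_in Y'.scale_in \<psi>)
  qed
  then have "0 = (\<Sum>k\<in>K. (\<Sum>i\<in>A. a i k * \<eta> k (\<psi> i)) + (\<Sum>\<phi>\<in>\<Phi>. c (k, \<phi>) * \<eta> k \<phi>))"
    by simp
  also have "\<dots> = (\<Sum>i\<in>A. \<Sum>k\<in>K. a i k * \<eta> k (\<psi> i)) + cv"
    unfolding sum.distrib cv_def L_def
    by (subst sum.swap) (simp add: sum.cartesian_product case_prod_beta mult.commute)
  also have "\<dots> \<le> (\<Sum>i\<in>A. N i * nrm (dual Y) (\<psi> i)) + cv"
    by (intro add_mono sum_mono dom \<psi> order_refl)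
  finally have big: "1 \<le> (\<Sum>i\<in>A. N i * nrm (dual Y) (\<psi> i))" using cv by simp
  \<comment> \<open>The slack in \<open>N i + e\<close> compensates for a norm that may not be
    attained and still leaves a strict inequality wherever \<open>\<psi> i\<close> is nonzero. Such
    an index exists since the weighted sum of norms is at least 1, and then \<open>h\<close> exceeds
    1 at the family \<open>(N i + e) *\<^sub>R v i\<close>, where \<open>p\<close> is at most
    1.\<close>
  have "\<exists>v\<in>pts Y. nrm Y v \<le> 1 \<and> N i * nrm (dual Y) (\<psi> i) \<le> (N i + e) * \<psi> i v \<and>
     (nrm (dual Y) (\<psi> i) \<noteq> 0 \<longrightarrow> N i * nrm (dual Y) (\<psi> i) < (N i + e) * \<psi> i v)" if i: "i \<in> A" for i
  proof (cases "nrm (dual Y) (\<psi> i) = 0")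
    case True
    then show ?thesis using Y.zero_in Y.dual_zero[OF \<psi>[OF i]] by (intro bexI[of _ 0]) auto
  next
    case False
    then have "0 < nrm (dual Y) (\<psi> i)" using Y.dual_nrm_nonneg[OF \<psi>[OF i]] by simp
    then have "N i * nrm (dual Y) (\<psi> i) / (N i + e) < nrm (dual Y) (\<psi> i)"
      using Ne[OF i] e by (simp add: field_simps)
    then obtain v where "v \<in> pts Y" "nrm Y v \<le> 1" "N i * nrm (dual Y) (\<psi> i) / (N i + e) < \<psi> i v"
      by (rule Y.dual_nrm_lessE[OF \<psi>[OF i]])
    then show ?thesis using Ne[OF i] by (intro bexI[of _ v]) (auto simp: field_simps)
  qed
  then obtain v where v: "\<And>i. i \<in> A \<Longrightarrow> v i \<in> pts Y" "\<And>i. i \<in> A \<Longrightarrow> nrm Y (v i) \<le> 1"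
    "\<And>i. i \<in> A \<Longrightarrow> N i * nrm (dual Y) (\<psi> i) \<le> (N i + e) * \<psi> i (v i)"
    "\<And>i. i \<in> A \<Longrightarrow> nrm (dual Y) (\<psi> i) \<noteq> 0 \<Longrightarrow> N i * nrm (dual Y) (\<psi> i) < (N i + e) * \<psi> i (v i)"
    by metis
  obtain i0 where i0: "i0 \<in> A" "nrm (dual Y) (\<psi> i0) \<noteq> 0"
  proof (rule ccontr)
    assume nz: "\<not> thesis"
    have "(\<Sum>i\<in>A. N i * nrm (dual Y) (\<psi> i)) = 0" using nz that by (intro sum.neutral) auto
    then show False using big by simp
  qed
  have "(\<Sum>i\<in>A. N i * nrm (dual Y) (\<psi> i)) < (\<Sum>i\<in>A. (N i + e) * \<psi> i (v i))"
    by (intro sum_strict_mono_ex1 fin) (use v i0 in blast)+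
  also have "\<dots> = h (\<lambda>i. (N i + e) *\<^sub>R v i, 0)"
    unfolding split by (simp add: linear_scale[OF lin0] \<psi>_def v)
  also have "\<dots> \<le> P (\<lambda>i. (N i + e) *\<^sub>R v i)"
    using h(2)[of "(\<lambda>i. (N i + e) *\<^sub>R v i, 0)"] by (simp add: p_def)
  also have "\<dots> \<le> 1"
    unfolding P_le
  proof (intro conjI ballI)
    fix i assume i: "i \<in> A"
    show "n ((N i + e) *\<^sub>R v i) / (N i + e) \<le> 1"
      using Ne[OF i] v(1,2)[OF i] sublinear_scale[OF n, of "N i + e" "v i"] by (simp add: n_def \<pi>)
  qed simp
  finally show False using big by simp
qed


text \<open>
  The part of the principle of local reflexivity that is needed: it suffices to control the norm
  of the operator on a grid of the unit ball and on the \<open>e s\<close>.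
\<close>

lemma local_reflexivity:
  fixes Y :: "'y::real_vector nspace" and Z :: "'z::real_vector nspace" and S :: "'k set"
  assumes Y: "normed Y" and Z: "normed Z" and fin: "finite S" "finite \<Phi>"
    and \<Phi>: "\<Phi> \<subseteq> pts (dual Y)" and \<eta>: "\<And>s. s \<in> S \<Longrightarrow> \<eta> s \<in> pts (dual (dual Y))"
    and e: "\<And>s. s \<in> S \<Longrightarrow> e s \<in> pts Z"
    and coord: "\<And>b s. s \<in> S \<Longrightarrow> \<bar>b s\<bar> \<le> C * nrm Z (\<Sum>s\<in>S. b s *\<^sub>R e s)"
    and dom: "\<And>b \<psi>. \<psi> \<in> pts (dual Y) \<Longrightarrow>
      (\<Sum>s\<in>S. b s * \<eta> s \<psi>) \<le> nrm Z (\<Sum>s\<in>S. b s *\<^sub>R e s) * nrm (dual Y) \<psi>"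
    and eps: "0 < \<epsilon>"
  obtains y where "\<And>s. y s \<in> pts Y"
    "\<And>b. nrm Y (\<Sum>s\<in>S. b s *\<^sub>R y s) \<le> nrm Z (\<Sum>s\<in>S. b s *\<^sub>R e s)"
    "\<And>s \<phi>. s \<in> S \<Longrightarrow> \<phi> \<in> \<Phi> \<Longrightarrow> \<bar>\<phi> (y s) - \<eta> s \<phi>\<bar> \<le> \<epsilon>"
proof -
  interpret Y: normed Y by (rule Y)
  interpret Z: normed Z by (rule Z)
  define N where "N b = nrm Z (\<Sum>s\<in>S. b s *\<^sub>R e s)" for b
  have in_Z: "(\<Sum>s\<in>S. b s *\<^sub>R e s) \<in> pts Z" for b
    using e by (intro Z.sum_in Z.scale_in)
  have N_nonneg: "0 \<le> N b" for b unfolding N_def using in_Z by (rule Z.nonneg)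
  have N_scale: "N (\<lambda>s. c * b s) = \<bar>c\<bar> * N b" for c b
    using Z.scale[OF in_Z, of c b] by (simp add: N_def scaleR_sum_right)
  define H where "H = (\<Sum>s\<in>S. \<Sum>\<phi>\<in>\<Phi>. \<bar>\<eta> s \<phi>\<bar>)"
  have H: "\<bar>\<eta> s \<phi>\<bar> \<le> H" if "s \<in> S" "\<phi> \<in> \<Phi>" for s \<phi>
  proof -
    have "\<bar>\<eta> s \<phi>\<bar> \<le> (\<Sum>\<phi>\<in>\<Phi>. \<bar>\<eta> s \<phi>\<bar>)" using that fin by (intro member_le_sum) auto
    also have "\<dots> \<le> H" unfolding H_def using that fin
      by (intro member_le_sum) (auto intro: sum_nonneg)
    finally show ?thesis .
  qed
  have H0: "0 \<le> H" by (simp add: H_def sum_nonneg)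
  \<comment> \<open>The final error is \<open>\<delta>\<close> from Helly's theorem and at most
    \<open>3 * \<delta> * H\<close> from the rescaling by \<open>c\<close> below.\<close>
  define \<delta> where "\<delta> = min 1 (\<epsilon> / (1 + 3 * H))"
  have \<delta>: "0 < \<delta>" "\<delta> \<le> 1" "\<delta> + 3 * \<delta> * H \<le> \<epsilon>"
  proof -
    have "\<delta> \<le> \<epsilon> / (1 + 3 * H)" by (simp add: \<delta>_def)
    then show "\<delta> + 3 * \<delta> * H \<le> \<epsilon>" using H0 by (simp add: field_simps)
  qed (use eps H0 in \<open>auto simp: \<delta>_def\<close>)
  define R where "R = (\<Sum>s\<in>S. nrm Z (e s) + 1)"
  have R0: "0 \<le> R" unfolding R_def using e Z.nonneg by (intro sum_nonneg) force
  \<comment> \<open>Mesh of the grid: rounding all coordinates moves a combination by at most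
    \<open>h * R \<le> \<delta>\<close>, both for the \<open>e s\<close> and for the
    \<open>y s\<close>, whose norms exceed those of the \<open>e s\<close> by at most 1.\<close>
  define h where "h = \<delta> / (1 + R)"
  have h: "0 < h" "h * R \<le> \<delta>"
    using \<delta>(1) R0 by (auto simp: h_def field_simps)
  \<comment> \<open>Coordinates of points of the unit ball are at most \<open>\<bar>C\<bar>\<close>
    in absolute value, so this range contains their quotients by \<open>h\<close> after rounding
    down.\<close>
  define m where "m = \<lceil>\<bar>C\<bar> / h\<rceil> + 1"
  define Gr where "Gr = {g. \<forall>s. (s \<in> S \<longrightarrow> g s \<in> (\<lambda>j. h * real_of_int j) ` {-m..m}) \<and> (s \<notin> S \<longrightarrow> g s = 0)}"
  have fin_Gr: "finite Gr"
    unfolding Gr_def by (intro finite_set_of_finite_funs fin finite_imageI) auto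
  define A where "A = Gr \<union> (\<lambda>s. single s 1) ` S"
  have N_single: "N (single s 1) = nrm Z (e s)" if "s \<in> S" for s
  proof -
    have "(\<Sum>t\<in>S. single s 1 t *\<^sub>R e t) = (\<Sum>t\<in>S. if t = s then e s else 0)"
      by (rule sum.cong) (auto simp: single_def)
    then show ?thesis using that fin(1) by (simp add: N_def)
  qed
  have finA: "finite A" using fin_Gr fin by (simp add: A_def)
  obtain y where y: "\<And>s. y s \<in> pts Y" "\<And>b. b \<in> A \<Longrightarrow> nrm Y (\<Sum>s\<in>S. b s *\<^sub>R y s) \<le> N b + \<delta>"
    "\<And>s \<phi>. s \<in> S \<Longrightarrow> \<phi> \<in> \<Phi> \<Longrightarrow> \<bar>\<phi> (y s) - \<eta> s \<phi>\<bar> \<le> \<delta>"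
    by (rule helly_bidual[OF Y fin(1) finA fin(2) \<Phi> \<eta>, where N = N and a = "\<lambda>b. b" and e = \<delta>])
      (use dom N_nonneg \<delta>(1) in \<open>auto simp: N_def\<close>)
  have y_in: "(\<Sum>s\<in>S. b s *\<^sub>R y s) \<in> pts Y" for b
    using y(1) by (intro Y.sum_in Y.scale_in)
  have y_nrm: "nrm Y (y s) \<le> nrm Z (e s) + 1" if s: "s \<in> S" for s
  proof -
    have "(\<Sum>t\<in>S. single s 1 t *\<^sub>R y t) = (\<Sum>t\<in>S. if t = s then y s else 0)"
      by (rule sum.cong) (auto simp: single_def)
    then show ?thesis using y(2)[of "single s 1"] s fin(1) \<delta>(2) by (simp add: A_def N_single)
  qed
  \<comment> \<open>The three \<open>\<delta>\<close> come from rounding in \<open>Z\<close>, from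
    Helly's theorem, and from rounding in \<open>Y\<close>.\<close>
  have unit: "nrm Y (\<Sum>s\<in>S. b s *\<^sub>R y s) \<le> 1 + 3 * \<delta>" if b: "N b \<le> 1" for b
  proof -
    define g where "g s = (if s \<in> S then h * real_of_int \<lfloor>b s / h\<rfloor> else 0)" for s
    have near: "\<bar>b s - g s\<bar> \<le> h" if "s \<in> S" for s
    proof -
      have "b s - g s = h * (b s / h - \<lfloor>b s / h\<rfloor>)"
        using h that by (simp add: g_def algebra_simps)
      moreover have "\<bar>b s / h - \<lfloor>b s / h\<rfloor>\<bar> \<le> 1" by linarith
      ultimately show ?thesis using h mult_left_mono[of _ 1 h] by (simp add: abs_mult)
    qed
    have "\<lfloor>b s / h\<rfloor> \<in> {-m..m}" if "s \<in> S" for s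
    proof -
      have "\<bar>b s\<bar> \<le> \<bar>C\<bar>"
      proof -
        have "\<bar>b s\<bar> \<le> C * N b" using coord[OF that] by (simp add: N_def)
        also have "\<dots> \<le> \<bar>C\<bar> * N b" using N_nonneg by (intro mult_right_mono) auto
        also have "\<dots> \<le> \<bar>C\<bar> * 1" using b by (intro mult_left_mono) auto
        finally show ?thesis by simp
      qed
      then have "\<bar>b s / h\<bar> \<le> \<bar>C\<bar> / h" using h by (simp add: divide_right_mono)
      moreover have "\<bar>C\<bar> / h \<le> real_of_int m - 1"
        using le_of_int_ceiling[of "\<bar>C\<bar> / h"] by (simp add: m_def)
      ultimately have "- real_of_int m \<le> b s / h" "b s / h < real_of_int m + 1" by linarith+
      then show ?thesis by (simp add: floor_le_iff le_floor_iff)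
    qed
    then have gGr: "g \<in> Gr" by (auto simp: Gr_def g_def)
    have "N g \<le> N b + h * R"
    proof -
      have "N g \<le> N b + nrm Z ((\<Sum>s\<in>S. g s *\<^sub>R e s) - (\<Sum>s\<in>S. b s *\<^sub>R e s))"
        unfolding N_def by (rule Z.triangle_sub[OF in_Z in_Z])
      also have "(\<Sum>s\<in>S. g s *\<^sub>R e s) - (\<Sum>s\<in>S. b s *\<^sub>R e s) = (\<Sum>s\<in>S. (g s - b s) *\<^sub>R e s)"
        by (simp add: sum_subtractf scaleR_diff_left)
      also have "nrm Z (\<Sum>s\<in>S. (g s - b s) *\<^sub>R e s) \<le> (\<Sum>s\<in>S. nrm Z ((g s - b s) *\<^sub>R e s))"
        using e by (intro Z.sum_le Z.scale_in)
      also have "\<dots> \<le> (\<Sum>s\<in>S. h * (nrm Z (e s) + 1))"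
      proof (rule sum_mono)
        fix s assume s: "s \<in> S"
        show "nrm Z ((g s - b s) *\<^sub>R e s) \<le> h * (nrm Z (e s) + 1)"
          using near[OF s] Z.nonneg[OF e[OF s]] h(1) Z.scale[OF e[OF s]]
          by (auto simp: abs_minus_commute intro!: mult_mono)
      qed
      finally show ?thesis by (simp add: R_def sum_distrib_left)
    qed
    then have Ng: "N g \<le> 1 + \<delta>" using b h by simp
    have "nrm Y (\<Sum>s\<in>S. b s *\<^sub>R y s) \<le> nrm Y (\<Sum>s\<in>S. g s *\<^sub>R y s) + nrm Y ((\<Sum>s\<in>S. b s *\<^sub>R y s) - (\<Sum>s\<in>S. g s *\<^sub>R y s))"
      by (rule Y.triangle_sub[OF y_in y_in])
    also have "(\<Sum>s\<in>S. b s *\<^sub>R y s) - (\<Sum>s\<in>S. g s *\<^sub>R y s) = (\<Sum>s\<in>S. (b s - g s) *\<^sub>R y s)"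
      by (simp add: sum_subtractf scaleR_diff_left)
    also have "nrm Y (\<Sum>s\<in>S. (b s - g s) *\<^sub>R y s) \<le> (\<Sum>s\<in>S. nrm Y ((b s - g s) *\<^sub>R y s))"
      using y(1) by (intro Y.sum_le Y.scale_in)
    also have "\<dots> \<le> (\<Sum>s\<in>S. h * (nrm Z (e s) + 1))"
    proof (rule sum_mono)
      fix s assume s: "s \<in> S"
      show "nrm Y ((b s - g s) *\<^sub>R y s) \<le> h * (nrm Z (e s) + 1)"
        using near[OF s] y_nrm[OF s] Y.nonneg[OF y(1)[of s]] h(1)
        by (auto simp: Y.scale[OF y(1)] intro!: mult_mono)
    qed
    also have "\<dots> \<le> \<delta>" using h by (simp add: R_def sum_distrib_left)
    finally show ?thesis using y(2)[of g] gGr Ng by (simp add: A_def)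
  qed
  have bound: "nrm Y (\<Sum>s\<in>S. b s *\<^sub>R y s) \<le> (1 + 3 * \<delta>) * N b" for b
  proof (cases "N b = 0")
    case True
    then have "b s = 0" if "s \<in> S" for s using coord[OF that, of b] by (simp add: N_def)
    then show ?thesis using True by simp
  next
    case False
    then have pos: "0 < N b" using N_nonneg[of b] by simp
    have "nrm Y (\<Sum>s\<in>S. (1 / N b * b s) *\<^sub>R y s) \<le> 1 + 3 * \<delta>"
      by (rule unit) (use N_scale[of "1 / N b" b] pos in simp)
    moreover have "(\<Sum>s\<in>S. (1 / N b * b s) *\<^sub>R y s) = (1 / N b) *\<^sub>R (\<Sum>s\<in>S. b s *\<^sub>R y s)"
      by (simp add: scaleR_sum_right)
    ultimately have "1 / N b * nrm Y (\<Sum>s\<in>S. b s *\<^sub>R y s) \<le> 1 + 3 * \<delta>"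
      using pos Y.scale[OF y_in, of "1 / N b" b] by simp
    then show ?thesis using pos by (simp add: divide_le_eq)
  qed
  \<comment> \<open>Rescaling turns the bound \<open>1 + 3 * \<delta>\<close> into 1 exactly. The
    loss \<open>1 - c\<close>, at most \<open>3 * \<delta>\<close>, falls on the values of the
    functionals, where an error is allowed.\<close>
  define c where "c = 1 / (1 + 3 * \<delta>)"
  have c: "0 < c" "c * (1 + 3 * \<delta>) = 1" "c \<le> 1" using \<delta> by (auto simp: c_def)
  show ?thesis
  proof (rule that[of "\<lambda>s. c *\<^sub>R y s"])
    show "c *\<^sub>R y s \<in> pts Y" for s using y(1) by (rule Y.scale_in)
    show "nrm Y (\<Sum>s\<in>S. b s *\<^sub>R c *\<^sub>R y s) \<le> nrm Z (\<Sum>s\<in>S. b s *\<^sub>R e s)" for b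
    proof -
      have "(\<Sum>s\<in>S. b s *\<^sub>R c *\<^sub>R y s) = c *\<^sub>R (\<Sum>s\<in>S. b s *\<^sub>R y s)"
        by (simp add: scaleR_sum_right mult.commute)
      then have "nrm Y (\<Sum>s\<in>S. b s *\<^sub>R c *\<^sub>R y s) = c * nrm Y (\<Sum>s\<in>S. b s *\<^sub>R y s)"
        using Y.scale[OF y_in] c by simp
      also have "\<dots> \<le> c * ((1 + 3 * \<delta>) * N b)" using bound c by (intro mult_left_mono) auto
      also have "\<dots> = N b" using c(2) by (simp add: mult.assoc[symmetric])
      finally show ?thesis by (simp add: N_def)
    qed
    show "\<bar>\<phi> (c *\<^sub>R y s) - \<eta> s \<phi>\<bar> \<le> \<epsilon>" if s: "s \<in> S" and p: "\<phi> \<in> \<Phi>" for s \<phi>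
    proof -
      have "\<phi> (c *\<^sub>R y s) - \<eta> s \<phi> = c * (\<phi> (y s) - \<eta> s \<phi>) - (1 - c) * \<eta> s \<phi>"
        using p \<Phi> y(1) by (auto simp: Y.dual_scale algebra_simps)
      then have "\<bar>\<phi> (c *\<^sub>R y s) - \<eta> s \<phi>\<bar> \<le> c * \<bar>\<phi> (y s) - \<eta> s \<phi>\<bar> + (1 - c) * \<bar>\<eta> s \<phi>\<bar>"
        using abs_triangle_ineq4[of "c * (\<phi> (y s) - \<eta> s \<phi>)" "(1 - c) * \<eta> s \<phi>"] c by (simp add: abs_mult)
      also have "\<dots> \<le> 1 * \<delta> + (3 * \<delta>) * H"
      proof (intro add_mono mult_mono)
        have "1 - c = 3 * \<delta> * c" using c(2) by (simp add: algebra_simps)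
        also have "\<dots> \<le> 3 * \<delta> * 1" using c(3) \<delta>(1) by (intro mult_left_mono) auto
        finally show "1 - c \<le> 3 * \<delta>" by simp
      qed (use c y(3)[OF s p] H[OF s p] \<delta>(1) in auto)
      finally show ?thesis using \<delta>(3) by simp
    qed
  qed
qed

section \<open>Lipschitz functions and the free space\<close>

lemma lip0_iff: "f \<in> pts (lip0 z) \<longleftrightarrow> f z = 0 \<and> (\<exists>L\<ge>0. \<forall>x y. \<bar>f x - f y\<bar> \<le> L * dist x y)"
  by (auto simp: lip0_def lipschitz_on_def dist_real_def)

lemma lip0_bdd:
  assumes "f \<in> pts (lip0 z)"
  shows "bdd_above (insert 0 {\<bar>f x - f y\<bar> / dist x y | x y. x \<noteq> y})"
proof -
  obtain L where "0 \<le> L" "\<And>x y. \<bar>f x - f y\<bar> \<le> L * dist x y"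
    using assms by (auto simp: lip0_iff)
  then show ?thesis by (intro bdd_aboveI[of _ L]) (auto simp: divide_le_eq)
qed

lemma lip0_nrm_nonneg: "f \<in> pts (lip0 z) \<Longrightarrow> 0 \<le> nrm (lip0 z) f"
  unfolding lip0_def nspace.simps by (rule cSup_upper) (use lip0_bdd[of f z] in \<open>auto simp: lip0_def\<close>)

lemma lip0_bound:
  assumes "f \<in> pts (lip0 z)"
  shows "\<bar>f x - f y\<bar> \<le> nrm (lip0 z) f * dist x y"
proof (cases "x = y")
  case False
  then have "\<bar>f x - f y\<bar> / dist x y \<le> Sup (insert 0 {\<bar>f x - f y\<bar> / dist x y | x y. x \<noteq> y})"
    by (intro cSup_upper[OF _ lip0_bdd[OF assms]]) blast
  then show ?thesis using False by (simp add: lip0_def divide_le_eq)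
qed simp

lemma lip0_nrm_le: "0 \<le> L \<Longrightarrow> (\<And>x y. \<bar>f x - f y\<bar> \<le> L * dist x y) \<Longrightarrow> nrm (lip0 z) f \<le> L"
  unfolding lip0_def nspace.simps by (rule cSup_least) (auto simp: divide_le_eq)

lemma normed_lip0: "normed (lip0 z)"
proof
  have bound0: "\<bar>f x\<bar> \<le> nrm (lip0 z) f * dist x z" if "f \<in> pts (lip0 z)" for f x
    using lip0_bound[OF that, of x z] that by (simp add: lip0_iff)
  have add: "0 \<le> nrm (lip0 z) f + nrm (lip0 z) g"
    "\<bar>(f + g) x - (f + g) y\<bar> \<le> (nrm (lip0 z) f + nrm (lip0 z) g) * dist x y"
    if "f \<in> pts (lip0 z)" "g \<in> pts (lip0 z)" for f g x y
    using lip0_bound[OF that(1), of x y] lip0_bound[OF that(2), of x y] lip0_nrm_nonneg[OF that(1)]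
      lip0_nrm_nonneg[OF that(2)] by (simp_all add: algebra_simps)
  have sc: "0 \<le> \<bar>c\<bar> * nrm (lip0 z) f"
    "\<bar>(c *\<^sub>R f) x - (c *\<^sub>R f) y\<bar> \<le> (\<bar>c\<bar> * nrm (lip0 z) f) * dist x y"
    if "f \<in> pts (lip0 z)" for c f x y
    using lip0_nrm_nonneg[OF that] mult_left_mono[OF lip0_bound[OF that, of x y], of "\<bar>c\<bar>"]
    by (simp_all add: abs_mult[symmetric] right_diff_distrib mult.assoc)
  have sub: "subspace (pts (lip0 z))"
    unfolding subspace_def
  proof (intro conjI ballI allI)
    show "f + g \<in> pts (lip0 z)" if "f \<in> pts (lip0 z)" "g \<in> pts (lip0 z)" for f g
      using add[OF that] that by (auto simp: lip0_iff simp del: plus_fun_apply) auto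
    show "c *\<^sub>R f \<in> pts (lip0 z)" if "f \<in> pts (lip0 z)" for c f
      using sc[OF that, of c] that unfolding lip0_iff by (metis mult_zero_right real_scaleR_def scaleR_fun_app)
  qed (auto simp: lip0_iff)
  have sc_le: "nrm (lip0 z) (c *\<^sub>R f) \<le> \<bar>c\<bar> * nrm (lip0 z) f" if "f \<in> pts (lip0 z)" for c f
    using sc[OF that] by (intro lip0_nrm_le) auto
  have nrm0: "nrm (lip0 z) 0 = 0"
    by (rule antisym) (auto intro!: lip0_nrm_le lip0_nrm_nonneg subspace_0[OF sub])
  show "normed_space (lip0 z)"
    unfolding normed_space_def
  proof (intro conjI ballI allI sub)
    fix f assume f: "f \<in> pts (lip0 z)"
    show "0 \<le> nrm (lip0 z) f" using f by (rule lip0_nrm_nonneg)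
    show "(nrm (lip0 z) f = 0) = (f = 0)"
      using bound0[OF f] nrm0 by (fastforce simp: fun_eq_iff)
    show "nrm (lip0 z) (c *\<^sub>R f) = \<bar>c\<bar> * nrm (lip0 z) f" for c
    proof (cases "c = 0")
      case False
      then have "\<bar>c\<bar> * nrm (lip0 z) f \<le> nrm (lip0 z) (c *\<^sub>R f)"
        using sc_le[OF subspace_scale[OF sub f, of c], of "1 / c"] by (simp add: field_simps)
      then show ?thesis using sc_le[OF f, of c] by simp
    qed (simp add: nrm0)
    fix g assume g: "g \<in> pts (lip0 z)"
    show "nrm (lip0 z) (f + g) \<le> nrm (lip0 z) f + nrm (lip0 z) g"
      using add[OF f g] by (intro lip0_nrm_le) auto
  qed
qed

section \<open>Evaluations, the free space and linearization\<close>

abbreviation lip0_dual :: "'m::metric_space \<Rightarrow> (('m \<Rightarrow> real) \<Rightarrow> real) nspace" where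
  "lip0_dual z \<equiv> dual (lip0 z)"

lemma normed_lip0_dual: "normed (lip0_dual z)"
  by (rule normed.normed_dual[OF normed_lip0])

lemma eval_at_apply: "f \<in> pts (lip0 z) \<Longrightarrow> eval_at z x f = f x"
  by (simp add: eval_at_def)

lemma eval_at_in: "eval_at z x \<in> pts (lip0_dual z)"
proof -
  interpret L: normed "lip0 z" by (rule normed_lip0)
  show ?thesis
  proof (rule dualI[of _ _ "dist x z"])
    show "\<bar>eval_at z x f\<bar> \<le> dist x z * nrm (lip0 z) f" if "f \<in> pts (lip0 z)" for f
      using lip0_bound[OF that, of x z] that by (simp add: eval_at_apply lip0_iff mult.commute)
  qed (auto simp: eval_at_def L.add_in L.scale_in)
qed

lemma eval_at_base: "eval_at z z = 0"
  by (auto simp: eval_at_def lip0_iff fun_eq_iff)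

lemma eval_at_lipschitz: "nrm (lip0_dual z) (eval_at z x - eval_at z y) \<le> dist x y"
  by (rule dual_nrm_le[OF normed_lip0])
     (use lip0_bound in \<open>auto simp: eval_at_apply mult.commute\<close>)

lemma free_space_iff:
  "\<mu> \<in> pts (free_space z) \<longleftrightarrow> \<mu> \<in> pts (lip0_dual z) \<and>
    (\<forall>e>0. \<exists>\<nu>\<in>span (range (eval_at z)). nrm (lip0_dual z) (\<mu> - \<nu>) < e)"
  and nrm_free_space [simp]: "nrm (free_space z) = nrm (lip0_dual z)"
proof -
  interpret D: normed "lip0_dual z" by (rule normed_lip0_dual)
  have "span (range (eval_at z)) \<subseteq> pts (lip0_dual z)"
    by (rule span_minimal) (use eval_at_in D.subspace in auto)
  then show "\<mu> \<in> pts (free_space z) \<longleftrightarrow> \<mu> \<in> pts (lip0_dual z) \<and>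
    (\<forall>e>0. \<exists>\<nu>\<in>span (range (eval_at z)). nrm (lip0_dual z) (\<mu> - \<nu>) < e)"
    by (simp add: free_space_def D.in_closure_of)
  show "nrm (free_space z) = nrm (lip0_dual z)"
    by (simp add: free_space_def)
qed

lemma free_space_subset: "\<mu> \<in> pts (free_space z) \<Longrightarrow> \<mu> \<in> pts (lip0_dual z)"
  by (simp add: free_space_iff)

lemma span_subset_free_space: "span (range (eval_at z)) \<subseteq> pts (free_space z)"
proof
  interpret D: normed "lip0_dual z" by (rule normed_lip0_dual)
  fix \<mu> assume "\<mu> \<in> span (range (eval_at z))"
  moreover have "span (range (eval_at z)) \<subseteq> pts (lip0_dual z)"
    by (rule span_minimal) (use eval_at_in D.subspace in auto)
  ultimately show "\<mu> \<in> pts (free_space z)"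
    by (auto simp: free_space_iff intro!: bexI[of _ \<mu>])
qed

lemma eval_at_in_free_space: "eval_at z x \<in> pts (free_space z)"
  by (rule subsetD[OF span_subset_free_space span_base[OF rangeI]])

lemma normed_free_space: "normed (free_space z)"
proof
  interpret D: normed "lip0_dual z" by (rule normed_lip0_dual)
  let ?S = "span (range (eval_at z))"
  have S: "\<nu> \<in> pts (lip0_dual z)" if "\<nu> \<in> ?S" for \<nu>
    using that span_subset_free_space free_space_subset by blast
  have "subspace (pts (free_space z))"
    unfolding subspace_def
  proof (intro conjI ballI allI)
    show "0 \<in> pts (free_space z)" using span_subset_free_space span_zero by blast
    fix \<mu> assume m: "\<mu> \<in> pts (free_space z)"
    note m' = free_space_subset[OF m]
    show "c *\<^sub>R \<mu> \<in> pts (free_space z)" for c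
      unfolding free_space_iff
    proof (intro conjI allI impI)
      fix e :: real assume e: "0 < e"
      then have "0 < e / (\<bar>c\<bar> + 1)" by simp
      then obtain \<nu> where n: "\<nu> \<in> ?S" "nrm (lip0_dual z) (\<mu> - \<nu>) < e / (\<bar>c\<bar> + 1)"
        using m unfolding free_space_iff by blast
      have "nrm (lip0_dual z) (c *\<^sub>R \<mu> - c *\<^sub>R \<nu>) = \<bar>c\<bar> * nrm (lip0_dual z) (\<mu> - \<nu>)"
        using D.scale[OF D.diff_in[OF m' S[OF n(1)]]] by (simp add: scaleR_diff_right)
      also have "\<dots> \<le> (\<bar>c\<bar> + 1) * nrm (lip0_dual z) (\<mu> - \<nu>)"
        using D.nonneg[OF D.diff_in[OF m' S[OF n(1)]]] by (intro mult_right_mono) auto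
      also have "\<dots> < e" using n(2) by (simp add: field_simps)
      finally show "\<exists>\<nu>\<in>?S. nrm (lip0_dual z) (c *\<^sub>R \<mu> - \<nu>) < e"
        using n(1) span_scale by blast
    qed (use m' D.scale_in in blast)
    fix \<mu>2 assume m2: "\<mu>2 \<in> pts (free_space z)"
    note m2' = free_space_subset[OF m2]
    show "\<mu> + \<mu>2 \<in> pts (free_space z)"
      unfolding free_space_iff
    proof (intro conjI allI impI)
      fix e :: real assume e: "0 < e"
      then obtain \<nu> \<nu>2 where n: "\<nu> \<in> ?S" "nrm (lip0_dual z) (\<mu> - \<nu>) < e / 2"
        "\<nu>2 \<in> ?S" "nrm (lip0_dual z) (\<mu>2 - \<nu>2) < e / 2"
        using m m2 unfolding free_space_iff by (meson half_gt_zero)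
      have "(\<mu> + \<mu>2) - (\<nu> + \<nu>2) = (\<mu> - \<nu>) + (\<mu>2 - \<nu>2)" by simp
      then have "nrm (lip0_dual z) ((\<mu> + \<mu>2) - (\<nu> + \<nu>2)) \<le> nrm (lip0_dual z) (\<mu> - \<nu>) + nrm (lip0_dual z) (\<mu>2 - \<nu>2)"
        using D.triangle[OF D.diff_in[OF m' S[OF n(1)]] D.diff_in[OF m2' S[OF n(3)]]] by metis
      then show "\<exists>\<nu>\<in>?S. nrm (lip0_dual z) (\<mu> + \<mu>2 - \<nu>) < e"
        using n span_add by (intro bexI[of _ "\<nu> + \<nu>2"]) auto
    qed (use m' m2' D.add_in in blast)
  qed
  then show "normed_space (free_space z)"
    using D.normed_space free_space_subset by (auto simp: normed_space_def)
qed

text \<open>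
  The linearization of a Lipschitz map \<open>u\<close> into a dual space; no limiting process is needed
  since \<open>u\<close> pulls \<open>B\<close> back into \<open>Lip\<^sub>0(M)\<close>.
\<close>

definition linearization :: "'b nspace \<Rightarrow> ('m \<Rightarrow> 'b \<Rightarrow> real) \<Rightarrow> (('m \<Rightarrow> real) \<Rightarrow> real) \<Rightarrow> 'b \<Rightarrow> real" where
  "linearization B u \<mu> = (\<lambda>b. if b \<in> pts B then \<mu> (\<lambda>x. u x b) else 0)"

lemma linearization_apply: "b \<in> pts B \<Longrightarrow> linearization B u \<mu> b = \<mu> (\<lambda>x. u x b)"
  by (simp add: linearization_def)

lemma linear_linearization: "linear (linearization B u)"
  by (rule linearI) (auto simp: linearization_def fun_eq_iff)

context
  fixes B :: "'b::real_vector nspace" and z :: "'m::metric_space" and u :: "'m \<Rightarrow> 'b \<Rightarrow> real" and c :: real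
  assumes B: "normed B" and u: "\<And>x. u x \<in> pts (dual B)" "u z = 0" and c: "0 \<le> c"
    and lip: "\<And>x y. nrm (dual B) (u x - u y) \<le> c * dist x y"
begin

interpretation B: normed B by (rule B)
interpretation B': normed "dual B" by (rule B.normed_dual)
interpretation L: normed "lip0 z" by (rule normed_lip0)

lemma pullback_lip0:
  assumes b: "b \<in> pts B"
  shows "(\<lambda>x. u x b) \<in> pts (lip0 z)" "nrm (lip0 z) (\<lambda>x. u x b) \<le> c * nrm B b"
proof -
  have *: "\<bar>u x b - u y b\<bar> \<le> c * nrm B b * dist x y" for x y
  proof -
    have "\<bar>(u x - u y) b\<bar> \<le> nrm (dual B) (u x - u y) * nrm B b"
      by (intro B.dual_bound B'.diff_in u b)
    also have "\<dots> \<le> (c * dist x y) * nrm B b"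
      by (intro mult_right_mono lip B.nonneg b)
    finally show ?thesis by (simp add: mult.commute mult.left_commute)
  qed
  have "0 \<le> c * nrm B b" using c B.nonneg[OF b] by simp
  with * show "(\<lambda>x. u x b) \<in> pts (lip0 z)" "nrm (lip0 z) (\<lambda>x. u x b) \<le> c * nrm B b"
    using u(2) by (auto simp: lip0_iff intro!: lip0_nrm_le)
qed

lemma linearization_in:
  assumes \<mu>: "\<mu> \<in> pts (lip0_dual z)"
  shows "linearization B u \<mu> \<in> pts (dual B)"
    and "nrm (dual B) (linearization B u \<mu>) \<le> c * nrm (lip0_dual z) \<mu>"
proof -
  have m0: "0 \<le> nrm (lip0_dual z) \<mu>" using \<mu> by (rule L.dual_nrm_nonneg)
  have bd: "\<bar>linearization B u \<mu> b\<bar> \<le> (c * nrm (lip0_dual z) \<mu>) * nrm B b" if b: "b \<in> pts B" for b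
  proof -
    have "\<bar>\<mu> (\<lambda>x. u x b)\<bar> \<le> nrm (lip0_dual z) \<mu> * nrm (lip0 z) (\<lambda>x. u x b)"
      by (intro L.dual_bound \<mu> pullback_lip0 b)
    also have "\<dots> \<le> nrm (lip0_dual z) \<mu> * (c * nrm B b)"
      by (intro mult_left_mono pullback_lip0 b m0)
    finally show ?thesis using b by (simp add: linearization_def mult_ac)
  qed
  show "nrm (dual B) (linearization B u \<mu>) \<le> c * nrm (lip0_dual z) \<mu>"
    by (rule dual_nrm_le[OF B _ bd]) (use c m0 in simp)
  show "linearization B u \<mu> \<in> pts (dual B)"
  proof (rule dualI[OF _ _ bd])
    fix b b' assume b: "b \<in> pts B" "b' \<in> pts B"
    have "(\<lambda>x. u x (b + b')) = (\<lambda>x. u x b) + (\<lambda>x. u x b')"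
      using B.dual_add[OF u(1)] b by (auto simp: fun_eq_iff)
    then show "linearization B u \<mu> (b + b') = linearization B u \<mu> b + linearization B u \<mu> b'"
      using L.dual_add[OF \<mu>] pullback_lip0 b B.add_in by (simp add: linearization_def)
  next
    fix s b assume b: "b \<in> pts B"
    have "(\<lambda>x. u x (s *\<^sub>R b)) = s *\<^sub>R (\<lambda>x. u x b)"
      using B.dual_scale[OF u(1)] b by (auto simp: fun_eq_iff)
    then show "linearization B u \<mu> (s *\<^sub>R b) = s * linearization B u \<mu> b"
      using L.dual_scale[OF \<mu>] pullback_lip0 b B.scale_in by (simp add: linearization_def)
  qed (simp_all add: linearization_def)
qed

lemma linearization_eval_at: "linearization B u (eval_at z x) = u x"
  by (auto simp: linearization_def fun_eq_iff eval_at_apply pullback_lip0 dual_outside[OF u(1)])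

end

section \<open>From finite rank operators to Lipschitz maps into \<open>Y\<close>\<close>

lemma bounded_approximation_property_finite:
  assumes X: "normed X" and bap: "bounded_approximation_property c X"
    and J: "finite J" "J \<subseteq> pts X" and e: "0 < e"
  obtains T where "T \<in> bounded_ops X X" "finite_rank X T" "op_norm X X T \<le> c"
    "\<And>x. x \<in> J \<Longrightarrow> nrm X (T x - x) < e"
proof -
  interpret X: normed X by (rule X)
  let ?U = "{S \<in> bounded_ops X X. \<forall>x\<in>J. ndist X (S x) (id x) < e}"
  have id: "id \<in> bounded_ops X X"
    by (rule bounded_opsI[of _ _ _ 1]) auto
  have "compactin (norm_topology X) J"
    using J by (intro finite_imp_compactin) auto
  then have "openin (compact_convergence_topology X) ?U"
    unfolding compact_convergence_topology_def using id e
    by (intro topology_generated_by_Basis) blast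
  moreover have "id \<in> ?U" using id e X.mdist_zero J by (auto simp: subset_iff)
  ultimately have "\<exists>T\<in>{T \<in> bounded_ops X X. finite_rank X T \<and> op_norm X X T \<le> c}. T \<in> ?U"
    using bap[unfolded bounded_approximation_property_def in_closure_of, THEN conjunct2,
      THEN spec, of ?U] by (rule_tac mp) auto
  then obtain T where T: "T \<in> ?U" "T \<in> bounded_ops X X" "finite_rank X T" "op_norm X X T \<le> c"
    by auto
  have "nrm X (T x - x) < e" if "x \<in> J" for x
    using T that J bounded_ops_in[OF T(2)] by (force simp: ndist_def)
  then show ?thesis using that T by blast
qed

text \<open>The set in the definition of \<open>finite_rank\<close> may lie outside the space.
  Generators inside the range are, in the application, functionals on \<open>lip0 z\<close>, and
  this makes their sample points Lipschitz functions.\<close>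

lemma finite_rank_range:
  assumes X: "normed X" and Y: "normed Y" and T: "T \<in> bounded_ops X Y" "finite_rank X T"
  obtains B where "finite B" "span B = T ` pts X"
proof -
  interpret X: normed X by (rule X)
  have sub: "subspace (T ` pts X)"
    unfolding subspace_def
  proof (intro conjI ballI allI)
    show "0 \<in> T ` pts X" using bounded_ops_zero[OF X Y T(1)] X.zero_in by force
    show "v + w \<in> T ` pts X" if vw: "v \<in> T ` pts X" "w \<in> T ` pts X" for v w
    proof -
      obtain x y where "v = T x" "x \<in> pts X" "w = T y" "y \<in> pts X" using vw by blast
      then show ?thesis using bounded_ops_add[OF T(1), of x y] X.add_in by (metis image_eqI)
    qed
    show "c *\<^sub>R v \<in> T ` pts X" if "v \<in> T ` pts X" for c v
      using that bounded_ops_scale[OF T(1), symmetric] X.scale_in by auto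
  qed
  obtain B0 where B0: "finite B0" "T ` pts X \<subseteq> span B0"
    using T(2) by (auto simp: finite_rank_def)
  obtain B where B: "B \<subseteq> T ` pts X" "independent B" "T ` pts X \<subseteq> span B"
    using maximal_independent_subset by blast
  have "finite B" using independent_span_bound[OF B0(1) B(2)] B(1) B0(2) by blast
  moreover have "span B = T ` pts X"
    using B span_minimal[OF B(1) sub] by blast
  ultimately show ?thesis using that by blast
qed

text \<open>\<open>g\<close> is \<open>eval_at z\<close> followed by \<open>T\<close> and by the
  operator sending \<open>e s\<close> to \<open>y s\<close>, plus a constant \<open>y0\<close> that
  stands for the value of \<open>f\<close> at the base point. Here \<open>\<eta> s\<close> is the
  image of \<open>e s\<close> under the linearization of \<open>f - f z\<close>; that this
  linearization has norm at most 1 is the hypothesis \<open>dom\<close> of local reflexivity. The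
  coordinates on the range of \<open>T\<close> are values at finitely many Lipschitz functions,
  which gives \<open>coord\<close>.\<close>

lemma lip_approximation_of_bap:
  fixes z :: "'m::metric_space" and Y :: "'y::real_vector nspace"
    and f :: "'m \<Rightarrow> ('y \<Rightarrow> real) \<Rightarrow> real"
  assumes bap: "bounded_approximation_property lam (free_space z)" and lam: "0 \<le> lam"
    and Y: "normed Y" and f: "f \<in> lip_maps 1 (dual (dual Y))"
    and fin: "finite J" "finite \<Phi>" and \<Phi>: "\<Phi> \<subseteq> pts (dual Y)" and eps: "0 < \<epsilon>"
  obtains g where "g \<in> lip_maps lam Y" "\<And>x \<phi>. x \<in> J \<Longrightarrow> \<phi> \<in> \<Phi> \<Longrightarrow> \<bar>\<phi> (g x) - f x \<phi>\<bar> < \<epsilon>"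
proof -
  interpret Y: normed Y by (rule Y)
  interpret Y': normed "dual Y" by (rule Y.normed_dual)
  interpret Y'': normed "dual (dual Y)" by (rule Y'.normed_dual)
  interpret L: normed "lip0 z" by (rule normed_lip0)
  interpret D: normed "lip0_dual z" by (rule normed_lip0_dual)
  interpret X: normed "free_space z" by (rule normed_free_space)
  have f_in: "f x \<in> pts (dual (dual Y))" for x
    using f by (auto simp: lip_maps_def)
  have f_lip: "nrm (dual (dual Y)) (f x - f y) \<le> dist x y" for x y
    using f f_in by (auto simp: lip_maps_def ndist_def)
  define u where "u x = f x - f z" for x
  have u: "u x \<in> pts (dual (dual Y))" "u z = 0" "nrm (dual (dual Y)) (u x - u y) \<le> 1 * dist x y" for x y
    using f_in f_lip by (auto simp: u_def Y''.diff_in)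
  note lin = pullback_lip0[OF Y.normed_dual u(1,2) zero_le_one u(3)]
    linearization_in[OF Y.normed_dual u(1,2) zero_le_one u(3)]
  define W where "W = (\<Sum>\<phi>\<in>\<Phi>. nrm (dual Y) \<phi>)"
  have W: "nrm (dual Y) \<phi> \<le> W" if "\<phi> \<in> \<Phi>" for \<phi>
    unfolding W_def using that fin \<Phi> by (intro member_le_sum Y'.nonneg) auto
  have W0: "0 \<le> W" unfolding W_def using \<Phi> by (intro sum_nonneg Y'.nonneg) auto
  \<comment> \<open>A quarter of \<open>\<epsilon>\<close> goes to each of three errors:
    \<open>T\<close> against the identity, \<open>y s\<close> against \<open>\<eta> s\<close>, and
    \<open>y0\<close> against \<open>f z\<close>. The added 1 avoids division by zero.\<close>
  define e1 where "e1 = \<epsilon> / (4 * (1 + W))"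
  have e1: "0 < e1" "e1 * W \<le> \<epsilon> / 4"
    using W0 eps by (auto simp: e1_def field_simps)
  obtain T where T: "T \<in> bounded_ops (free_space z) (free_space z)" "finite_rank (free_space z) T"
      "op_norm (free_space z) (free_space z) T \<le> lam"
    and Tnear: "\<And>x. x \<in> J \<Longrightarrow> nrm (free_space z) (T (eval_at z x) - eval_at z x) < e1"
    by (rule bounded_approximation_property_finite[OF normed_free_space bap, of "eval_at z ` J" e1])
      (use fin(1) eval_at_in_free_space e1(1) in blast)+
  obtain B where B: "finite B" "span B = T ` pts (free_space z)"
    by (rule finite_rank_range[OF normed_free_space normed_free_space T(1,2)])
  have span_D: "v \<in> pts (lip0_dual z)" if "v \<in> span B" for v
    using that bounded_ops_in[OF T(1)] free_space_subset by (auto simp: B(2))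
  obtain S e where S: "finite S" "\<And>s. s \<in> S \<Longrightarrow> \<exists>v\<in>B. v s \<noteq> 0"
    and e: "\<And>s. s \<in> S \<Longrightarrow> e s \<in> span B" "\<And>v. v \<in> span B \<Longrightarrow> v = (\<Sum>s\<in>S. v s *\<^sub>R e s)"
      "\<And>s t. s \<in> S \<Longrightarrow> t \<in> S \<Longrightarrow> e s t = (if s = t then 1 else 0)"
    by (rule finite_dim_functions_samples[OF B(1)]) (rule that)
  \<comment> \<open>Elements of the dual are zero outside \<open>lip0 z\<close>, so a point where
    one of them is nonzero is a Lipschitz function vanishing at \<open>z\<close>.\<close>
  have S_in: "s \<in> pts (lip0 z)" if s: "s \<in> S" for s
  proof -
    obtain v where "v \<in> B" "v s \<noteq> 0" using S(2)[OF s] by blast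
    then show ?thesis using span_D[OF span_base] dual_outside by blast
  qed
  define C where "C = (\<Sum>s\<in>S. nrm (lip0 z) s)"
  have comb_in: "(\<Sum>s\<in>S. b s *\<^sub>R e s) \<in> pts (lip0_dual z)" for b
    using e(1) span_D by (intro D.sum_in D.scale_in) auto
  have coord: "\<bar>b s\<bar> \<le> C * nrm (lip0_dual z) (\<Sum>s\<in>S. b s *\<^sub>R e s)" if s: "s \<in> S" for b s
  proof -
    have "(\<Sum>t\<in>S. b t *\<^sub>R e t) s = (\<Sum>t\<in>S. if t = s then b s else 0)"
      unfolding sum_fun_app by (rule sum.cong) (use e(3) s in auto)
    then have "b s = (\<Sum>t\<in>S. b t *\<^sub>R e t) s" using s S(1) by simp
    then have "\<bar>b s\<bar> \<le> nrm (lip0_dual z) (\<Sum>s\<in>S. b s *\<^sub>R e s) * nrm (lip0 z) s"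
      using L.dual_bound[OF comb_in S_in[OF s], of b] by simp
    also have "\<dots> \<le> nrm (lip0_dual z) (\<Sum>s\<in>S. b s *\<^sub>R e s) * C"
      unfolding C_def using S(1) s S_in by (intro mult_left_mono member_le_sum D.nonneg comb_in L.nonneg) auto
    finally show ?thesis by (simp add: mult.commute)
  qed
  define \<eta> where "\<eta> s = linearization (dual Y) u (e s)" for s
  have \<eta>: "\<eta> s \<in> pts (dual (dual Y))" if "s \<in> S" for s
    unfolding \<eta>_def using e(1) span_D that by (intro lin) auto
  have comb_\<eta>: "(\<Sum>s\<in>S. b s * \<eta> s \<psi>) = (\<Sum>s\<in>S. b s *\<^sub>R e s) (\<lambda>x. u x \<psi>)" if "\<psi> \<in> pts (dual Y)" for b \<psi>
    using that by (simp add: \<eta>_def linearization_apply sum_fun_app)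
  have dom: "(\<Sum>s\<in>S. b s * \<eta> s \<psi>) \<le> nrm (lip0_dual z) (\<Sum>s\<in>S. b s *\<^sub>R e s) * nrm (dual Y) \<psi>"
    if p: "\<psi> \<in> pts (dual Y)" for b \<psi>
  proof -
    have "\<bar>(\<Sum>s\<in>S. b s *\<^sub>R e s) (\<lambda>x. u x \<psi>)\<bar> \<le> nrm (lip0_dual z) (\<Sum>s\<in>S. b s *\<^sub>R e s) * nrm (lip0 z) (\<lambda>x. u x \<psi>)"
      by (intro L.dual_bound comb_in lin p)
    also have "\<dots> \<le> nrm (lip0_dual z) (\<Sum>s\<in>S. b s *\<^sub>R e s) * nrm (dual Y) \<psi>"
      using lin(2)[OF p] by (intro mult_left_mono D.nonneg comb_in) simp
    finally show ?thesis unfolding comb_\<eta>[OF p] by simp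
  qed
  \<comment> \<open>The tolerance \<open>e2\<close> is chosen after \<open>T\<close>, because it is
    multiplied by the coordinates of the vectors \<open>T (eval_at z x)\<close>.\<close>
  define Q where "Q = (\<Sum>x\<in>J. \<Sum>s\<in>S. \<bar>T (eval_at z x) s\<bar>)"
  have Q: "(\<Sum>s\<in>S. \<bar>T (eval_at z x) s\<bar>) \<le> Q" if "x \<in> J" for x
    unfolding Q_def using that fin(1) by (intro member_le_sum) (auto intro: sum_nonneg)
  have Q0: "0 \<le> Q" by (simp add: Q_def sum_nonneg)
  define e2 where "e2 = \<epsilon> / (4 * (1 + Q))"
  have e2: "0 < e2" "e2 * Q \<le> \<epsilon> / 4"
    using Q0 eps by (auto simp: e2_def field_simps)
  obtain y where y: "\<And>s. y s \<in> pts Y"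
    "\<And>b. nrm Y (\<Sum>s\<in>S. b s *\<^sub>R y s) \<le> nrm (lip0_dual z) (\<Sum>s\<in>S. b s *\<^sub>R e s)"
    "\<And>s \<phi>. s \<in> S \<Longrightarrow> \<phi> \<in> \<Phi> \<Longrightarrow> \<bar>\<phi> (y s) - \<eta> s \<phi>\<bar> \<le> e2"
    by (rule local_reflexivity[OF Y normed_lip0_dual S(1) fin(2) \<Phi> \<eta> _ coord dom e2(1)])
      (use e(1) span_D in auto)
  \<comment> \<open>Helly's theorem with an empty set of norm conditions: adding a constant does not
    affect the Lipschitz bound.\<close>
  obtain y0 where y0: "y0 \<in> pts Y" "\<And>\<phi>. \<phi> \<in> \<Phi> \<Longrightarrow> \<bar>\<phi> y0 - f z \<phi>\<bar> \<le> \<epsilon> / 4"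
  proof -
    obtain w :: "unit \<Rightarrow> 'y" where "\<And>k. w k \<in> pts Y"
      "\<And>k \<phi>. k \<in> {()} \<Longrightarrow> \<phi> \<in> \<Phi> \<Longrightarrow> \<bar>\<phi> (w k) - f z \<phi>\<bar> \<le> \<epsilon> / 4"
      by (rule helly_bidual[OF Y, of "{()}" "{}" \<Phi> "\<lambda>_. f z" "\<lambda>_. 0" "\<lambda>_ _. 0" "\<epsilon> / 4"])
        (use fin \<Phi> f_in eps in auto)
    then show ?thesis using that by blast
  qed
  define g where "g x = (\<Sum>s\<in>S. T (eval_at z x) s *\<^sub>R y s) + y0" for x
  have comb_Y: "(\<Sum>s\<in>S. b s *\<^sub>R y s) \<in> pts Y" for b using y(1) by (intro Y.sum_in Y.scale_in)
  have g_in: "g x \<in> pts Y" for x unfolding g_def by (intro Y.add_in comb_Y y0)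
  have T_in: "T \<mu> \<in> span B" if "\<mu> \<in> pts (free_space z)" for \<mu> using that B(2) by blast
  have "ndist Y (g x) (g x') \<le> lam * dist x x'" for x x'
  proof -
    define v where "v = T (eval_at z x - eval_at z x')"
    have dx: "eval_at z x - eval_at z x' \<in> pts (free_space z)"
      by (intro X.diff_in eval_at_in_free_space)
    have v_eq: "v = T (eval_at z x) - T (eval_at z x')"
      unfolding v_def by (intro bounded_ops_diff[OF normed_free_space normed_free_space T(1)] eval_at_in_free_space)
    have "g x - g x' = (\<Sum>s\<in>S. v s *\<^sub>R y s)"
      by (simp add: g_def v_eq sum_subtractf scaleR_diff_left)
    then have "nrm Y (g x - g x') \<le> nrm (lip0_dual z) (\<Sum>s\<in>S. v s *\<^sub>R e s)"
      using y(2) by metis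
    also have "(\<Sum>s\<in>S. v s *\<^sub>R e s) = v"
      using e(2)[OF T_in[OF dx]] unfolding v_def by simp
    also have "nrm (lip0_dual z) v \<le> op_norm (free_space z) (free_space z) T * nrm (lip0_dual z) (eval_at z x - eval_at z x')"
      using op_norm_bound[OF normed_free_space normed_free_space T(1) dx] by (simp add: v_def)
    also have "\<dots> \<le> lam * dist x x'"
      by (intro mult_mono T(3) eval_at_lipschitz lam D.nonneg free_space_subset[OF dx])
    finally show ?thesis using g_in by (simp add: ndist_def)
  qed
  then have "g \<in> lip_maps lam Y" using g_in by (auto simp: lip_maps_def)
  moreover have "\<bar>\<phi> (g x) - f x \<phi>\<bar> < \<epsilon>" if x: "x \<in> J" and p: "\<phi> \<in> \<Phi>" for x \<phi>
  proof -
    have p': "\<phi> \<in> pts (dual Y)" using p \<Phi> by blast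
    define v where "v = T (eval_at z x)"
    have v: "v \<in> span B" unfolding v_def by (intro T_in eval_at_in_free_space)
    have phi_g: "\<phi> (g x) = (\<Sum>s\<in>S. v s * \<phi> (y s)) + \<phi> y0"
      using y(1) y0(1) comb_Y Y.scale_in
      by (simp add: g_def v_def Y.dual_add[OF p'] Y.dual_sum[OF p'] Y.dual_scale[OF p'])
    have "(\<Sum>s\<in>S. v s * \<eta> s \<phi>) = v (\<lambda>x. u x \<phi>)"
      unfolding comb_\<eta>[OF p'] using e(2)[OF v] by simp
    \<comment> \<open>The function \<open>\<lambda>x. u x \<phi>\<close> has Lipschitz norm at most
      \<open>W\<close>, so closeness of \<open>T\<close> to the identity on the evaluations controls
      this difference.\<close>
    then have mid: "(\<Sum>s\<in>S. v s * \<eta> s \<phi>) - u x \<phi> = (v - eval_at z x) (\<lambda>x. u x \<phi>)"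
      using lin(1)[OF p'] by (simp add: eval_at_apply)
    have A1: "\<bar>(\<Sum>s\<in>S. v s * (\<phi> (y s) - \<eta> s \<phi>))\<bar> \<le> \<epsilon> / 4"
    proof -
      have "\<bar>(\<Sum>s\<in>S. v s * (\<phi> (y s) - \<eta> s \<phi>))\<bar> \<le> (\<Sum>s\<in>S. \<bar>v s * (\<phi> (y s) - \<eta> s \<phi>)\<bar>)"
        by (rule sum_abs)
      also have "\<dots> \<le> (\<Sum>s\<in>S. \<bar>v s\<bar> * e2)"
        by (intro sum_mono) (auto simp: abs_mult intro!: mult_left_mono y(3) p)
      also have "\<dots> = (\<Sum>s\<in>S. \<bar>v s\<bar>) * e2" by (simp add: sum_distrib_right)
      also have "\<dots> \<le> Q * e2" using Q[OF x] e2(1) by (intro mult_right_mono) (auto simp: v_def)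
      finally show ?thesis using e2(2) by (simp add: mult.commute)
    qed
    have A2: "\<bar>(v - eval_at z x) (\<lambda>x. u x \<phi>)\<bar> \<le> \<epsilon> / 4"
    proof -
      have "v - eval_at z x \<in> pts (lip0_dual z)"
        using span_D[OF v] eval_at_in by (rule D.diff_in)
      from L.dual_bound[OF this lin(1)[OF p']]
      have "\<bar>(v - eval_at z x) (\<lambda>x. u x \<phi>)\<bar> \<le> nrm (lip0_dual z) (v - eval_at z x) * nrm (lip0 z) (\<lambda>x. u x \<phi>)" .
      also have "\<dots> \<le> e1 * W"
        using Tnear[OF x] lin(2)[OF p'] W[OF p] e1(1) L.nonneg[OF lin(1)[OF p']]
        by (intro mult_mono) (auto simp: v_def)
      finally show ?thesis using e1(2) by simp
    qed
    have "\<phi> (g x) - f x \<phi> = (\<Sum>s\<in>S. v s * (\<phi> (y s) - \<eta> s \<phi>)) + (v - eval_at z x) (\<lambda>x. u x \<phi>) + (\<phi> y0 - f z \<phi>)"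
      unfolding phi_g mid[symmetric] by (simp add: u_def right_diff_distrib sum_subtractf)
    then show ?thesis using A1 A2 y0(2)[OF p] eps by linarith
  qed
  ultimately show ?thesis using that by blast
qed

section \<open>Convergent sequences in an exhausted space\<close>

lemma canon_in:
  assumes Y: "normed Y" and y: "y \<in> pts Y"
  shows "canon Y y \<in> pts (dual (dual Y))" "nrm (dual (dual Y)) (canon Y y) \<le> nrm Y y"
proof -
  interpret Y: normed Y by (rule Y)
  interpret Y': normed "dual Y" by (rule Y.normed_dual)
  have bd: "\<bar>canon Y y \<phi>\<bar> \<le> nrm Y y * nrm (dual Y) \<phi>" if "\<phi> \<in> pts (dual Y)" for \<phi>
    using Y.dual_bound[OF that y] that by (simp add: canon_def mult.commute)
  show "nrm (dual (dual Y)) (canon Y y) \<le> nrm Y y"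
    by (rule dual_nrm_le[OF Y.normed_dual Y.nonneg[OF y] bd])
  show "canon Y y \<in> pts (dual (dual Y))"
    by (rule dualI[OF _ _ bd]) (auto simp: canon_def Y'.add_in Y'.scale_in)
qed

definition conv_space :: "'a::real_vector nspace \<Rightarrow> (nat \<Rightarrow> 'a set) \<Rightarrow> (nat \<Rightarrow> 'a) nspace" where
  "conv_space D E = \<lparr>pts = {\<mu>. (\<forall>n. \<mu> n \<in> E n) \<and> (\<exists>l\<in>pts D. (\<lambda>n. nrm D (\<mu> n - l)) \<longlonglongrightarrow> 0)},
                     nrm = \<lambda>\<mu>. SUP n. nrm D (\<mu> n)\<rparr>"

definition nlim :: "'a::real_vector nspace \<Rightarrow> (nat \<Rightarrow> 'a) \<Rightarrow> 'a" where
  "nlim D \<mu> = (SOME l. l \<in> pts D \<and> (\<lambda>n. nrm D (\<mu> n - l)) \<longlonglongrightarrow> 0)"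

text \<open>\<open>E_closed\<close> keeps coordinatewise limits in \<open>E n\<close>, which
  together with completeness of \<open>D\<close> makes the sequence space complete. Limits are taken
  in all of \<open>D\<close>, so that \<open>D\<close> may be a space already known to be complete,
  such as a dual.\<close>

locale exhausted = normed D for D :: "'a::real_vector nspace" +
  fixes E :: "nat \<Rightarrow> 'a set"
  assumes banach: "banach_space D"
    and E_sub: "\<And>n. subspace (E n)" and E_in: "\<And>n. E n \<subseteq> pts D"
    and E_closed: "\<And>n v l. (\<And>k. v k \<in> E n) \<Longrightarrow> l \<in> pts D \<Longrightarrow> (\<lambda>k. nrm D (v k - l)) \<longlonglongrightarrow> 0 \<Longrightarrow> l \<in> E n"
begin

abbreviation "Ys \<equiv> conv_space D E"

lemma Ys_iff: "\<mu> \<in> pts Ys \<longleftrightarrow> (\<forall>n. \<mu> n \<in> E n) \<and> (\<exists>l\<in>pts D. (\<lambda>n. nrm D (\<mu> n - l)) \<longlonglongrightarrow> 0)"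
  by (simp add: conv_space_def)

lemma Ys_comp: "\<mu> \<in> pts Ys \<Longrightarrow> \<mu> n \<in> pts D"
  using E_in by (auto simp: Ys_iff)

lemma nlim:
  assumes "\<mu> \<in> pts Ys"
  shows "nlim D \<mu> \<in> pts D" "(\<lambda>n. nrm D (\<mu> n - nlim D \<mu>)) \<longlonglongrightarrow> 0"
proof -
  have "\<exists>l. l \<in> pts D \<and> (\<lambda>n. nrm D (\<mu> n - l)) \<longlonglongrightarrow> 0" using assms by (auto simp: Ys_iff)
  from someI_ex[OF this] show "nlim D \<mu> \<in> pts D" "(\<lambda>n. nrm D (\<mu> n - nlim D \<mu>)) \<longlonglongrightarrow> 0"
    by (auto simp: nlim_def)
qed

lemma nrm_le_limit:
  assumes mem: "\<And>n. \<mu> n \<in> pts D" and l: "l \<in> pts D" and lim: "(\<lambda>n. nrm D (\<mu> n - l)) \<longlonglongrightarrow> 0"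
    and le: "\<And>n. N \<le> n \<Longrightarrow> nrm D (\<mu> n) \<le> C"
  shows "nrm D l \<le> C"
proof (rule LIMSEQ_le_const)
  show "(\<lambda>n. C + nrm D (\<mu> n - l)) \<longlonglongrightarrow> C" using tendsto_add[OF tendsto_const lim, of C] by simp
  show "\<exists>N. \<forall>n\<ge>N. nrm D l \<le> C + nrm D (\<mu> n - l)"
    using triangle_sub[OF l mem] commute[OF l mem] le by (intro exI[of _ N]) (smt (verit))
qed

lemma null_add:
  assumes mem: "\<And>n. \<mu> n \<in> pts D" "l \<in> pts D" "\<And>n. \<nu> n \<in> pts D" "m \<in> pts D"
    and lim: "(\<lambda>n. nrm D (\<mu> n - l)) \<longlonglongrightarrow> 0" "(\<lambda>n. nrm D (\<nu> n - m)) \<longlonglongrightarrow> 0"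
  shows "(\<lambda>n. nrm D ((\<mu> n + \<nu> n) - (l + m))) \<longlonglongrightarrow> 0"
proof (rule Lim_null_comparison)
  show "(\<lambda>n. nrm D (\<mu> n - l) + nrm D (\<nu> n - m)) \<longlonglongrightarrow> 0"
    using tendsto_add[OF lim] by simp
  have "nrm D ((\<mu> n + \<nu> n) - (l + m)) \<le> nrm D (\<mu> n - l) + nrm D (\<nu> n - m)" for n
    using triangle[of "\<mu> n - l" "\<nu> n - m"] mem by (simp add: diff_in algebra_simps)
  then show "\<forall>\<^sub>F n in sequentially. norm (nrm D ((\<mu> n + \<nu> n) - (l + m))) \<le> nrm D (\<mu> n - l) + nrm D (\<nu> n - m)"
    using mem by (intro always_eventually allI) (simp add: nonneg diff_in add_in)
qed

lemma null_scale:
  assumes mem: "\<And>n. \<mu> n \<in> pts D" "l \<in> pts D" and lim: "(\<lambda>n. nrm D (\<mu> n - l)) \<longlonglongrightarrow> 0"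
  shows "(\<lambda>n. nrm D (c *\<^sub>R \<mu> n - c *\<^sub>R l)) \<longlonglongrightarrow> 0"
proof -
  have "nrm D (c *\<^sub>R \<mu> n - c *\<^sub>R l) = \<bar>c\<bar> * nrm D (\<mu> n - l)" for n
    using scale[OF diff_in[OF mem]] by (simp add: scaleR_diff_right)
  then show ?thesis using tendsto_mult_right_zero[OF lim, of "\<bar>c\<bar>"] by simp
qed

lemma limit_unique:
  assumes mem: "\<And>n. \<mu> n \<in> pts D" "l \<in> pts D" "m \<in> pts D"
    and lim: "(\<lambda>n. nrm D (\<mu> n - l)) \<longlonglongrightarrow> 0" "(\<lambda>n. nrm D (\<mu> n - m)) \<longlonglongrightarrow> 0"
  shows "l = m"
proof -
  have "nrm D (l - m) \<le> 0"
  proof (rule LIMSEQ_le_const)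
    show "(\<lambda>n. nrm D (\<mu> n - l) + nrm D (\<mu> n - m)) \<longlonglongrightarrow> 0"
      using tendsto_add[OF lim] by simp
    show "\<exists>N. \<forall>n\<ge>N. nrm D (l - m) \<le> nrm D (\<mu> n - l) + nrm D (\<mu> n - m)"
      using triangle_via[OF mem(2) mem(1) mem(3)] commute[OF mem(2,1)] by auto
  qed
  then show ?thesis
    using nonneg[OF diff_in[OF mem(2,3)]] eq_0[OF diff_in[OF mem(2,3)]] by simp
qed

lemma nlim_eqI:
  assumes "\<mu> \<in> pts Ys" "l \<in> pts D" "(\<lambda>n. nrm D (\<mu> n - l)) \<longlonglongrightarrow> 0"
  shows "nlim D \<mu> = l"
  by (rule limit_unique[OF Ys_comp[OF assms(1)] nlim(1)[OF assms(1)] assms(2) nlim(2)[OF assms(1)] assms(3)])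

lemma subspace_Ys: "subspace (pts Ys)"
  unfolding subspace_def
proof (intro conjI ballI allI)
  show "0 \<in> pts Ys" using subspace_0[OF E_sub] zero_in by (auto simp: Ys_iff intro!: bexI[of _ 0])
  fix \<mu> assume m: "\<mu> \<in> pts Ys"
  show "c *\<^sub>R \<mu> \<in> pts Ys" for c
    using null_scale[OF Ys_comp[OF m] nlim[OF m], of c] m subspace_scale[OF E_sub]
      scale_in[OF nlim(1)[OF m], of c]
    unfolding Ys_iff by auto
  fix \<nu> assume n: "\<nu> \<in> pts Ys"
  show "\<mu> + \<nu> \<in> pts Ys"
    using null_add[OF Ys_comp[OF m] nlim(1)[OF m] Ys_comp[OF n] nlim(1)[OF n] nlim(2)[OF m] nlim(2)[OF n]]
      m n subspace_add[OF E_sub] add_in nlim(1)[OF m] nlim(1)[OF n]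
    unfolding Ys_iff by (auto intro!: bexI[of _ "nlim D \<mu> + nlim D \<nu>"])
qed

lemma nlim_add: "\<mu> \<in> pts Ys \<Longrightarrow> \<nu> \<in> pts Ys \<Longrightarrow> nlim D (\<mu> + \<nu>) = nlim D \<mu> + nlim D \<nu>"
  using null_add[OF Ys_comp nlim(1) Ys_comp nlim(1) nlim(2) nlim(2)]
  by (intro nlim_eqI add_in nlim subspace_add[OF subspace_Ys]) auto

lemma nlim_scale: "\<mu> \<in> pts Ys \<Longrightarrow> nlim D (c *\<^sub>R \<mu>) = c *\<^sub>R nlim D \<mu>"
  using null_scale[OF Ys_comp nlim]
  by (intro nlim_eqI scale_in nlim subspace_scale[OF subspace_Ys]) auto

lemma Ys_bdd:
  assumes m: "\<mu> \<in> pts Ys"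
  shows "bdd_above (range (\<lambda>n. nrm D (\<mu> n)))"
proof -
  obtain K where K: "\<And>n. nrm D (\<mu> n - nlim D \<mu>) \<le> K"
    using Bseq_bdd_above[OF convergent_imp_Bseq[OF convergentI[OF nlim(2)[OF m]]]]
    by (auto simp: bdd_above_def)
  have "nrm D (\<mu> n) \<le> nrm D (nlim D \<mu>) + K" for n
    using triangle_sub[OF Ys_comp[OF m] nlim(1)[OF m], of n] K[of n] by linarith
  then show ?thesis by (intro bdd_aboveI[of _ "nrm D (nlim D \<mu>) + K"]) auto
qed

lemma Ys_nrm_ge: "\<mu> \<in> pts Ys \<Longrightarrow> nrm D (\<mu> n) \<le> nrm Ys \<mu>"
  using cSUP_upper[OF UNIV_I Ys_bdd] by (simp add: conv_space_def)

lemma Ys_nrm_le: "(\<And>n. nrm D (\<mu> n) \<le> C) \<Longrightarrow> nrm Ys \<mu> \<le> C"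
  by (simp add: conv_space_def cSUP_least)

lemma nlim_nrm_le:
  assumes "\<mu> \<in> pts Ys"
  shows "nrm D (nlim D \<mu>) \<le> nrm Ys \<mu>"
  by (rule nrm_le_limit[OF Ys_comp nlim Ys_nrm_ge]) (rule assms)+

lemma normed_Ys: "normed Ys"
proof
  have sc: "nrm Ys (c *\<^sub>R \<mu>) \<le> \<bar>c\<bar> * nrm Ys \<mu>" if "\<mu> \<in> pts Ys" for c \<mu>
    using Ys_nrm_ge[OF that] scale[OF Ys_comp[OF that]]
    by (intro Ys_nrm_le) (simp add: mult_left_mono)
  have nn: "0 \<le> nrm Ys \<mu>" if "\<mu> \<in> pts Ys" for \<mu>
    using Ys_nrm_ge[OF that, of 0] nonneg[OF Ys_comp[OF that, of 0]] by simp
  have "nrm Ys 0 = 0"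
    by (rule antisym) (auto intro!: Ys_nrm_le nn subspace_0[OF subspace_Ys])
  moreover have "\<mu> = 0" if m: "\<mu> \<in> pts Ys" and "nrm Ys \<mu> = 0" for \<mu>
  proof
    fix n
    show "\<mu> n = 0 n"
      using Ys_nrm_ge[OF m, of n] that(2) nonneg[OF Ys_comp[OF m, of n]] eq_0[OF Ys_comp[OF m, of n]] by simp
  qed
  moreover have "\<bar>c\<bar> * nrm Ys \<mu> \<le> nrm Ys (c *\<^sub>R \<mu>)" if m: "\<mu> \<in> pts Ys" for c \<mu>
  proof (cases "c = 0")
    case False
    then show ?thesis
      using sc[OF subspace_scale[OF subspace_Ys m, of c], of "1 / c"] by (simp add: field_simps)
  qed (simp add: \<open>nrm Ys 0 = 0\<close>)
  moreover have "nrm Ys (\<mu> + \<nu>) \<le> nrm Ys \<mu> + nrm Ys \<nu>" if m: "\<mu> \<in> pts Ys" "\<nu> \<in> pts Ys" for \<mu> \<nu>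
  proof (rule Ys_nrm_le)
    fix n
    show "nrm D ((\<mu> + \<nu>) n) \<le> nrm Ys \<mu> + nrm Ys \<nu>"
      using triangle[OF Ys_comp[OF m(1)] Ys_comp[OF m(2)], of n n] Ys_nrm_ge[OF m(1), of n] Ys_nrm_ge[OF m(2), of n]
      by simp
  qed
  ultimately show "normed_space Ys"
    unfolding normed_space_def using subspace_Ys sc nn by (auto intro: antisym)
qed

text \<open>A Cauchy sequence has coordinatewise limits \<open>\<mu> n\<close>, and the limits of
  its members converge to some \<open>l\<close>. That \<open>\<mu>\<close> converges to
  \<open>l\<close> is an interchange of limits, justified because the coordinates converge uniformly
  in \<open>n\<close>.\<close>

lemma banach_Ys: "banach_space Ys"
proof -
  interpret Y: normed Ys by (rule normed_Ys)
  show ?thesis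
  proof (rule Y.banach_spaceI)
    fix s :: "nat \<Rightarrow> nat \<Rightarrow> 'a"
    assume s: "\<And>k. s k \<in> pts Ys"
      and cau: "\<And>e. 0 < e \<Longrightarrow> \<exists>N. \<forall>m\<ge>N. \<forall>n\<ge>N. nrm Ys (s m - s n) < e"
    have in_D: "s k n \<in> pts D" for k n using s by (rule Ys_comp)
    have comp_le: "nrm D (s k n - s j n) \<le> nrm Ys (s k - s j)" for k j n
      using Ys_nrm_ge[OF Y.diff_in[OF s s], of k j n] by simp
    \<comment> \<open>Stated for any \<open>t\<close> whose differences are dominated by those of
      \<open>s\<close>, so that it serves for a fixed coordinate and for the limits
      \<open>nlim D (s k)\<close>; both are contractions on \<open>Ys\<close>.\<close>
    have ex: "\<exists>\<mu>\<in>pts D. (\<lambda>k. nrm D (t k - \<mu>)) \<longlonglongrightarrow> 0"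
      if t: "\<And>k. t k \<in> pts D" and le: "\<And>k j. nrm D (t k - t j) \<le> nrm Ys (s k - s j)" for t
    proof -
      have ct: "\<exists>N. \<forall>m\<ge>N. \<forall>n\<ge>N. nrm D (t m - t n) < e" if "0 < e" for e
      proof -
        obtain N where "\<forall>m\<ge>N. \<forall>n\<ge>N. nrm Ys (s m - s n) < e" using cau[OF \<open>0 < e\<close>] by blast
        then show ?thesis by (intro exI[of _ N]) (auto intro: le_less_trans[OF le])
      qed
      obtain l where l: "l \<in> pts D" "\<forall>e>0. \<exists>N. \<forall>n\<ge>N. nrm D (t n - l) < e"
        using banach_spaceD[of t, OF banach t ct] by blast
      then have "(\<lambda>k. nrm D (t k - l)) \<longlonglongrightarrow> 0"
        unfolding LIMSEQ_iff using nonneg[OF diff_in[OF t l(1)]] by simp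
      then show ?thesis using l(1) by blast
    qed
    have "\<exists>\<mu>. \<forall>n. \<mu> n \<in> pts D \<and> (\<lambda>k. nrm D (s k n - \<mu> n)) \<longlonglongrightarrow> 0"
      using ex[OF in_D comp_le] by (intro choice) blast
    then obtain \<mu> where \<mu>: "\<And>n. \<mu> n \<in> pts D" "\<And>n. (\<lambda>k. nrm D (s k n - \<mu> n)) \<longlonglongrightarrow> 0" by blast
    have "nrm D (nlim D (s k) - nlim D (s j)) \<le> nrm Ys (s k - s j)" for k j
    proof -
      have "nlim D (s k - s j) = nlim D (s k) - nlim D (s j)"
        using nlim_add[OF s[of k] Y.neg_in[OF s[of j]]] nlim_scale[OF s[of j], of "-1"] by simp
      then show ?thesis using nlim_nrm_le[OF Y.diff_in[OF s s]] by metis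
    qed
    from ex[OF nlim(1)[OF s] this] obtain l where l: "l \<in> pts D" "(\<lambda>k. nrm D (nlim D (s k) - l)) \<longlonglongrightarrow> 0"
      by blast
    have near: "nrm D (s k n - \<mu> n) \<le> e"
      if N: "\<And>m n. N \<le> m \<Longrightarrow> N \<le> n \<Longrightarrow> nrm Ys (s m - s n) < e" and k: "N \<le> k" for N e k n
    proof (rule nrm_le_limit)
      show "s k n - s j n \<in> pts D" for j by (intro diff_in in_D)
      show "s k n - \<mu> n \<in> pts D" by (intro diff_in in_D \<mu>)
      have "nrm D ((s k n - s j n) - (s k n - \<mu> n)) = nrm D (s j n - \<mu> n)" for j
        using commute[OF \<mu>(1) in_D, of n j n] by simp
      then show "(\<lambda>j. nrm D ((s k n - s j n) - (s k n - \<mu> n))) \<longlonglongrightarrow> 0" using \<mu>(2)[of n] by simp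
      show "nrm D (s k n - s j n) \<le> e" if "N \<le> j" for j
        using comp_le[of k n j] N[OF k that] by simp
    qed
    have E: "\<mu> n \<in> E n" for n
      by (rule E_closed[OF _ \<mu>]) (use s in \<open>simp add: Ys_iff\<close>)
    have "(\<lambda>n. nrm D (\<mu> n - l)) \<longlonglongrightarrow> 0"
      unfolding LIMSEQ_iff
    proof (intro allI impI)
      fix e :: real assume e: "0 < e"
      then have e3: "0 < e / 3" by simp
      obtain N where N: "\<And>m n. N \<le> m \<Longrightarrow> N \<le> n \<Longrightarrow> nrm Ys (s m - s n) < e / 3"
        using cau[OF e3] by blast
      obtain K where K: "\<And>k. K \<le> k \<Longrightarrow> nrm D (nlim D (s k) - l) < e / 3"
        using order_tendstoD(2)[OF l(2) e3] unfolding eventually_sequentially by blast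
      define k where "k = max N K"
      obtain M where M: "\<And>n. M \<le> n \<Longrightarrow> nrm D (s k n - nlim D (s k)) < e / 3"
        using order_tendstoD(2)[OF nlim(2)[OF s[of k]] e3] unfolding eventually_sequentially by blast
      have "nrm D (\<mu> n - l) < e" if "M \<le> n" for n
      proof -
        have "nrm D (\<mu> n - l) \<le> nrm D (\<mu> n - s k n) + nrm D (s k n - l)"
          by (intro triangle_via \<mu> in_D l)
        also have "nrm D (s k n - l) \<le> nrm D (s k n - nlim D (s k)) + nrm D (nlim D (s k) - l)"
          by (intro triangle_via in_D l nlim s)
        finally show ?thesis
          using near[of N "e / 3" k n, OF N] M[OF that] K[of k] commute[OF \<mu>(1)[of n] in_D[of k n]] e
          unfolding k_def by linarith
      qed
      then show "\<exists>no. \<forall>n\<ge>no. norm (nrm D (\<mu> n - l) - 0) < e"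
        using nonneg[OF diff_in[OF \<mu>(1) l(1)]] by auto
    qed
    then have in_Y: "\<mu> \<in> pts Ys" using E l(1) by (auto simp: Ys_iff)
    have "\<exists>N. \<forall>n\<ge>N. nrm Ys (s n - \<mu>) < e" if "0 < e" for e
    proof -
      obtain N where N: "\<And>m n. N \<le> m \<Longrightarrow> N \<le> n \<Longrightarrow> nrm Ys (s m - s n) < e / 2"
        using cau[OF half_gt_zero[OF \<open>0 < e\<close>]] by blast
      have "nrm Ys (s k - \<mu>) < e" if "N \<le> k" for k
      proof -
        have "nrm Ys (s k - \<mu>) \<le> e / 2"
          using near[OF N that] by (intro Ys_nrm_le) simp
        then show ?thesis using \<open>0 < e\<close> by simp
      qed
      then show ?thesis by blast
    qed
    then show "\<exists>l\<in>pts Ys. \<forall>e>0. \<exists>N. \<forall>n\<ge>N. nrm Ys (s n - l) < e" using in_Y by blast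
  qed
qed

end

text \<open>Moves a Banach space to another type: the norm is pulled back along a linear bijection,
  so completeness is inherited. It carries the sequence space into the type over which Banach spaces
  are quantified.\<close>

lemma banach_space_transport:
  fixes R :: "'a::real_vector \<Rightarrow> 'b::real_vector"
  assumes X: "banach_space X" and R: "linear R" and P: "subspace P" and bij: "bij_betw R P (pts X)"
  shows "banach_space \<lparr>pts = P, nrm = \<lambda>x. nrm X (R x)\<rparr>" (is "banach_space ?Y")
proof -
  interpret X: normed X using X by unfold_locales (simp add: banach_space_def)
  have R_in: "R x \<in> pts X" if "x \<in> P" for x using bij that by (auto simp: bij_betw_def)
  have R0: "R x = 0 \<longleftrightarrow> x = 0" if "x \<in> P" for x
    using bij that subspace_0[OF P] linear_0[OF R] unfolding bij_betw_def inj_on_def by metis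
  interpret Y: normed ?Y
  proof
    show "normed_space ?Y"
      unfolding normed_space_def
      using P R_in R0 by (auto simp: linear_add[OF R] linear_scale[OF R] X.nonneg X.eq_0 X.scale X.triangle)
  qed
  show ?thesis
  proof (rule Y.banach_spaceI)
    fix s :: "nat \<Rightarrow> 'a"
    assume s: "\<And>n. s n \<in> pts ?Y" and cau: "\<And>e. 0 < e \<Longrightarrow> \<exists>N. \<forall>m\<ge>N. \<forall>n\<ge>N. nrm ?Y (s m - s n) < e"
    have "\<exists>l\<in>pts X. \<forall>e>0. \<exists>N. \<forall>n\<ge>N. nrm X (R (s n) - l) < e"
      by (rule X.banach_spaceD[OF X]) (use s cau R_in in \<open>auto simp: linear_diff[OF R]\<close>)
    then obtain l where l: "l \<in> pts X" "\<forall>e>0. \<exists>N. \<forall>n\<ge>N. nrm X (R (s n) - l) < e" by blast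
    then obtain x where x: "x \<in> P" "l = R x" using bij unfolding bij_betw_def by blast
    then show "\<exists>l\<in>pts ?Y. \<forall>e>0. \<exists>N. \<forall>n\<ge>N. nrm ?Y (s n - l) < e"
      using l(2) by (intro bexI[of _ x]) (auto simp: linear_diff[OF R])
  qed
qed

section \<open>Lifting to the bidual\<close>

definition tail :: "nat \<Rightarrow> (nat \<Rightarrow> 'a) \<Rightarrow> nat \<Rightarrow> 'a::zero" where
  "tail k \<mu> = (\<lambda>n. if n < k then 0 else \<mu> n)"

text \<open>In the application \<open>'b\<close> is the ambient type of the theorem:
  \<open>I\<close> codes a sequence and \<open>R\<close> decodes it. Both are linear on whole types,
  so identities between codes can be computed on sequences, while \<open>R\<close> has to invert
  \<open>I\<close> only on the sequence space.\<close>

locale encoded = exhausted D E for D :: "'a::real_vector nspace" and E +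
  fixes I :: "(nat \<Rightarrow> 'a) \<Rightarrow> 'b::real_vector" and R :: "'b \<Rightarrow> nat \<Rightarrow> 'a"
  assumes I: "linear I" and R: "linear R" and RI: "\<And>\<mu>. \<mu> \<in> pts (conv_space D E) \<Longrightarrow> R (I \<mu>) = \<mu>"
begin

definition Yc :: "'b nspace" where
  "Yc = \<lparr>pts = I ` pts Ys, nrm = \<lambda>y. nrm Ys (R y)\<rparr>"

lemma Yc_in: "\<mu> \<in> pts Ys \<Longrightarrow> I \<mu> \<in> pts Yc"
  and Yc_nrm: "nrm Yc y = nrm Ys (R y)"
  and R_in: "y \<in> pts Yc \<Longrightarrow> R y \<in> pts Ys"
  by (auto simp: Yc_def RI)

lemma banach_Yc: "banach_space Yc"
  unfolding Yc_def
proof (rule banach_space_transport[OF banach_Ys R])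
  show "subspace (I ` pts Ys)" by (rule linear_subspace_image[OF I subspace_Ys])
  show "bij_betw R (I ` pts Ys) (pts Ys)"
    by (rule bij_betw_byWitness[of _ I]) (auto simp: RI)
qed

sublocale Yc: normed Yc
  using banach_Yc by unfold_locales (simp add: banach_space_def)

sublocale Yc': normed "dual Yc"
  by (rule Yc.normed_dual)

lemma tail_in:
  assumes "\<mu> \<in> pts Ys"
  shows "tail k \<mu> \<in> pts Ys" "nlim D (tail k \<mu>) = nlim D \<mu>"
proof -
  have ev: "\<forall>\<^sub>F n in sequentially. nrm D (\<mu> n - nlim D \<mu>) = nrm D (tail k \<mu> n - nlim D \<mu>)"
    unfolding eventually_sequentially tail_def by (intro exI[of _ k]) auto
  have lim: "(\<lambda>n. nrm D (tail k \<mu> n - nlim D \<mu>)) \<longlonglongrightarrow> 0"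
    using nlim(2)[OF assms] tendsto_cong[OF ev] by simp
  moreover have "tail k \<mu> n \<in> E n" for n
    using assms subspace_0[OF E_sub] by (auto simp: tail_def Ys_iff)
  ultimately show "tail k \<mu> \<in> pts Ys" using nlim(1)[OF assms] unfolding Ys_iff by blast
  from this nlim(1)[OF assms] lim show "nlim D (tail k \<mu>) = nlim D \<mu>" by (rule nlim_eqI)
qed

lemma tail_nrm_le: "0 \<le> C \<Longrightarrow> (\<And>n. k \<le> n \<Longrightarrow> nrm D (\<mu> n) \<le> C) \<Longrightarrow> nrm Ys (tail k \<mu>) \<le> C"
  by (rule Ys_nrm_le) (auto simp: tail_def)

lemma single_in: "v \<in> E k \<Longrightarrow> single k v \<in> pts Ys"
proof -
  assume v: "v \<in> E k"
  have "\<forall>\<^sub>F n in sequentially. 0 = nrm D (single k v n - 0)"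
    unfolding eventually_sequentially single_def by (intro exI[of _ "Suc k"]) auto
  then have "(\<lambda>n. nrm D (single k v n - 0)) \<longlonglongrightarrow> 0"
    by (rule tendsto_cong[THEN iffD1]) simp
  moreover have "single k v n \<in> E n" for n
    using v subspace_0[OF E_sub] by (auto simp: single_def)
  ultimately show ?thesis using zero_in unfolding Ys_iff by blast
qed

text \<open>
  The increments of the sequence are absolutely summable: with suitable signs, finitely many blocks
  \<open>single k (\<mu> k)\<close> add up to an element of norm at most that of \<open>\<mu>\<close>.
\<close>

lemma tail_convergent:
  assumes \<mu>: "\<mu> \<in> pts Ys" and \<phi>: "\<phi> \<in> pts (dual Yc)"
  shows "convergent (\<lambda>k. \<phi> (I (tail k \<mu>)))"
proof -
  interpret Ys: normed Ys by (rule normed_Ys)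
  define t where "t k = \<phi> (I (single k (\<mu> k)))" for k
  have E: "\<mu> k \<in> E k" for k using \<mu> by (simp add: Ys_iff)
  have step: "\<phi> (I (tail k \<mu>)) = t k + \<phi> (I (tail (Suc k) \<mu>))" for k
  proof -
    have "tail k \<mu> = single k (\<mu> k) + tail (Suc k) \<mu>"
      by (auto simp: tail_def single_def fun_eq_iff less_Suc_eq)
    then show ?thesis
      using Yc.dual_add[OF \<phi> Yc_in[OF single_in[OF E]] Yc_in[OF tail_in(1)[OF \<mu>]]]
      by (simp add: linear_add[OF I] t_def)
  qed
  have "(\<Sum>k<m. \<bar>t k\<bar>) \<le> nrm (dual Yc) \<phi> * nrm Ys \<mu>" for m
  proof -
    define w where "w = (\<Sum>k<m. sgn (t k) *\<^sub>R single k (\<mu> k))"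
    have w_in: "w \<in> pts Ys" unfolding w_def
      by (intro Ys.sum_in Ys.scale_in single_in E)
    have w_app: "w n = (if n < m then sgn (t n) *\<^sub>R \<mu> n else 0)" for n
    proof -
      have "w n = (\<Sum>k<m. if k = n then sgn (t n) *\<^sub>R \<mu> n else 0)"
        unfolding w_def sum_fun_app by (rule sum.cong) (auto simp: single_def)
      then show ?thesis by simp
    qed
    have "nrm Ys w \<le> nrm Ys \<mu>"
    proof (rule Ys_nrm_le)
      fix n
      have "nrm D (sgn (t n) *\<^sub>R \<mu> n) \<le> 1 * nrm D (\<mu> n)"
        unfolding scale[OF Ys_comp[OF \<mu>]]
        by (intro mult_right_mono nonneg Ys_comp \<mu>) (auto simp: sgn_if)
      then show "nrm D (w n) \<le> nrm Ys \<mu>"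
        using Ys_nrm_ge[OF \<mu>, of n] Ys.nonneg[OF \<mu>] by (simp add: w_app)
    qed
    have "(\<Sum>k<m. \<bar>t k\<bar>) = \<phi> (I w)"
      unfolding w_def linear_sum[OF I] linear_scale[OF I] t_def
      using Yc_in[OF single_in[OF E]]
      by (subst Yc.dual_sum[OF \<phi>]) (auto simp: Yc.scale_in Yc.dual_scale[OF \<phi>] abs_sgn mult.commute)
    also have "\<dots> \<le> nrm (dual Yc) \<phi> * nrm Ys w"
      using Yc.dual_bound[OF \<phi> Yc_in[OF w_in]] by (simp add: Yc_nrm RI[OF w_in])
    also have "\<dots> \<le> nrm (dual Yc) \<phi> * nrm Ys \<mu>"
      by (intro mult_left_mono Yc.dual_nrm_nonneg \<phi>) fact
    finally show ?thesis .
  qed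
  then have "summable (\<lambda>k. \<bar>t k\<bar>)"
    by (intro summableI_nonneg_bounded) auto
  then have "summable t" by (rule summable_rabs_cancel)
  \<comment> \<open>By telescoping, the values on the tails are a constant minus partial sums of
    \<open>t\<close>.\<close>
  then have conv: "convergent (\<lambda>n. \<phi> (I (tail 0 \<mu>)) - (\<Sum>k<n. t k))"
    by (intro convergent_diff convergent_const) (simp add: summable_iff_convergent)
  have eq: "(\<lambda>n. \<phi> (I (tail n \<mu>))) = (\<lambda>n. \<phi> (I (tail 0 \<mu>)) - (\<Sum>k<n. t k))"
  proof
    show "\<phi> (I (tail n \<mu>)) = \<phi> (I (tail 0 \<mu>)) - (\<Sum>k<n. t k)" for n
    proof (induction n)
      case (Suc n)
      then show ?case using step[of n] by simp
    qed simp
  qed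
  show ?thesis by (rule iffD2[OF arg_cong[OF eq, of convergent] conv])
qed

section \<open>Weak* limits of tails\<close>

definition lift :: "(nat \<Rightarrow> 'a) \<Rightarrow> ('b \<Rightarrow> real) \<Rightarrow> real" where
  "lift \<mu> = (\<lambda>\<phi>. if \<phi> \<in> pts (dual Yc) then lim (\<lambda>k. \<phi> (I (tail k \<mu>))) else 0)"

lemma lift_tendsto:
  assumes "\<mu> \<in> pts Ys" "\<phi> \<in> pts (dual Yc)"
  shows "(\<lambda>k. canon Yc (I (tail k \<mu>)) \<phi>) \<longlonglongrightarrow> lift \<mu> \<phi>"
  using tail_convergent[OF assms] assms(2) by (simp add: canon_def lift_def convergent_LIMSEQ_iff)

lemma lift_in:
  assumes \<mu>: "\<mu> \<in> pts Ys"
  shows "lift \<mu> \<in> pts (dual (dual Yc))"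
proof (rule Yc'.dual_limit(1))
  interpret Ys: normed Ys by (rule normed_Ys)
  fix k
  have "nrm Ys (tail k \<mu>) \<le> nrm Ys \<mu>"
    by (intro tail_nrm_le Ys.nonneg \<mu> Ys_nrm_ge)
  then show "nrm (dual (dual Yc)) (canon Yc (I (tail k \<mu>))) \<le> nrm Ys \<mu>"
    using canon_in(2)[OF Yc.normed_axioms Yc_in[OF tail_in(1)[OF \<mu>]], of k]
    by (simp add: Yc_nrm RI[OF tail_in(1)[OF \<mu>]])
  show "canon Yc (I (tail k \<mu>)) \<in> pts (dual (dual Yc))"
    by (intro canon_in Yc.normed_axioms Yc_in tail_in \<mu>)
  show "(\<lambda>k. canon Yc (I (tail k \<mu>)) \<phi>) \<longlonglongrightarrow> lift \<mu> \<phi>" if "\<phi> \<in> pts (dual Yc)" for \<phi>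
    using \<mu> that by (rule lift_tendsto)
  show "lift \<mu> \<phi> = 0" if "\<phi> \<notin> pts (dual Yc)" for \<phi> using that by (simp add: lift_def)
qed

text \<open>Starting the tails later does not change their weak* limit, so only coordinates from
  \<open>N\<close> on enter the bound. Hence the lift of the evaluation map is 1-Lipschitz although
  the approximating points may be badly placed at small indices.\<close>

lemma lift_diff_le:
  assumes \<mu>: "\<mu> \<in> pts Ys" "\<nu> \<in> pts Ys" and C: "0 \<le> C" "\<And>n. N \<le> n \<Longrightarrow> nrm D (\<mu> n - \<nu> n) \<le> C"
  shows "nrm (dual (dual Yc)) (lift \<mu> - lift \<nu>) \<le> C"
proof (rule Yc'.dual_limit(2))
  interpret Ys: normed Ys by (rule normed_Ys)
  have d: "\<mu> - \<nu> \<in> pts Ys" using \<mu> by (rule Ys.diff_in)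
  let ?s = "\<lambda>k. canon Yc (I (tail (k + N) (\<mu> - \<nu>)))"
  fix k
  have "nrm Ys (tail (k + N) (\<mu> - \<nu>)) \<le> C"
    using C by (intro tail_nrm_le) auto
  then show "nrm (dual (dual Yc)) (?s k) \<le> C"
    using canon_in(2)[OF Yc.normed_axioms Yc_in[OF tail_in(1)[OF d]], of "k + N"]
    by (simp add: Yc_nrm RI[OF tail_in(1)[OF d]])
  show "?s k \<in> pts (dual (dual Yc))"
    by (intro canon_in Yc.normed_axioms Yc_in tail_in d)
  show "(\<lambda>k. ?s k \<phi>) \<longlonglongrightarrow> (lift \<mu> - lift \<nu>) \<phi>" if p: "\<phi> \<in> pts (dual Yc)" for \<phi>
  proof -
    have "tail k (\<mu> - \<nu>) = tail k \<mu> - tail k \<nu>" for k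
      by (auto simp: tail_def fun_eq_iff)
    then have "canon Yc (I (tail k (\<mu> - \<nu>))) \<phi> = canon Yc (I (tail k \<mu>)) \<phi> - canon Yc (I (tail k \<nu>)) \<phi>" for k
      using p Yc.dual_diff[OF p Yc_in[OF tail_in(1)[OF \<mu>(1)]] Yc_in[OF tail_in(1)[OF \<mu>(2)]], of k k]
      by (simp add: canon_def linear_diff[OF I])
    then have "(\<lambda>k. canon Yc (I (tail k (\<mu> - \<nu>))) \<phi>) \<longlonglongrightarrow> (lift \<mu> - lift \<nu>) \<phi>"
      using tendsto_diff[OF lift_tendsto[OF \<mu>(1) p] lift_tendsto[OF \<mu>(2) p]] by simp
    then show ?thesis by (rule LIMSEQ_ignore_initial_segment)
  qed
  show "(lift \<mu> - lift \<nu>) \<phi> = 0" if "\<phi> \<notin> pts (dual Yc)" for \<phi> using that by (simp add: lift_def)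
qed

text \<open>Passing to a tail preserves the limit, so a functional that factors through
  \<open>nlim D\<close> is constant along the tails. In other words, the second transpose of the
  limit map sends \<open>lift \<mu>\<close> to \<open>nlim D \<mu>\<close>.\<close>

lemma lift_limit_functional:
  assumes \<mu>: "\<mu> \<in> pts Ys" and \<phi>: "\<phi> \<in> pts (dual Yc)"
    and \<psi>: "\<And>\<nu>. \<nu> \<in> pts Ys \<Longrightarrow> \<phi> (I \<nu>) = \<psi> (nlim D \<nu>)"
  shows "lift \<mu> \<phi> = \<psi> (nlim D \<mu>)"
proof -
  have "(\<lambda>k. canon Yc (I (tail k \<mu>)) \<phi>) = (\<lambda>k. \<psi> (nlim D \<mu>))"
    using \<phi> \<psi>[OF tail_in(1)[OF \<mu>]] tail_in(2)[OF \<mu>] by (simp add: canon_def)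
  then show ?thesis using LIMSEQ_unique[OF lift_tendsto[OF \<mu> \<phi>]] tendsto_const by metis
qed

lemma lip_maps_Yc_iff:
  "g \<in> lip_maps c Yc \<longleftrightarrow> (\<forall>x. g x \<in> pts Yc) \<and> (\<forall>x y. nrm Yc (g x - g y) \<le> c * dist x y)"
  by (auto simp: lip_maps_def ndist_def image_subset_iff)

definition q :: "'b \<Rightarrow> 'a" where
  "q y = nlim D (R y)"

lemma q_in: "y \<in> pts Yc \<Longrightarrow> q y \<in> pts D"
  and q_add: "y \<in> pts Yc \<Longrightarrow> y' \<in> pts Yc \<Longrightarrow> q (y + y') = q y + q y'"
  and q_scale: "y \<in> pts Yc \<Longrightarrow> q (c *\<^sub>R y) = c *\<^sub>R q y"
  and q_nrm_le: "y \<in> pts Yc \<Longrightarrow> nrm D (q y) \<le> nrm Yc y"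
  by (simp_all add: q_def nlim R_in linear_add[OF R] linear_scale[OF R] nlim_add nlim_scale Yc_nrm nlim_nrm_le)

text \<open>Mazur's theorem for the convex set of the maps \<open>q \<circ> (g - g z)\<close> with \<open>g\<close> \<open>lam\<close>-Lipschitz.\<close>

lemma strong_approximation:
  fixes a :: "'m::metric_space \<Rightarrow> nat \<Rightarrow> 'a" and z :: 'm
  assumes a: "\<And>x. a x \<in> pts Ys" and lam: "0 \<le> lam"
    and weak: "\<And>J \<Phi> \<epsilon>. finite J \<Longrightarrow> finite \<Phi> \<Longrightarrow> \<Phi> \<subseteq> pts (dual Yc) \<Longrightarrow> 0 < \<epsilon> \<Longrightarrow>
      \<exists>g\<in>lip_maps lam Yc. \<forall>x\<in>J. \<forall>\<phi>\<in>\<Phi>. \<bar>\<phi> (g x) - lift (a x) \<phi>\<bar> < \<epsilon>"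
    and J: "finite J" and eps: "0 < \<epsilon>"
  obtains g where "g \<in> lip_maps lam Yc"
    "\<And>x. x \<in> J \<Longrightarrow> nrm D (q (g x) - q (g z) - (nlim D (a x) - nlim D (a z))) < \<epsilon>"
proof (rule ccontr)
  assume contra: "\<not> thesis"
  note witness = that
  obtain \<pi> where \<pi>: "linear \<pi>" "\<And>x. \<pi> x \<in> pts D" "\<And>x. x \<in> pts D \<Longrightarrow> \<pi> x = x"
    using projection by blast
  define n where "n v = nrm D (\<pi> v)" for v
  have n: "sublinear n" using sublinear_nrm[OF \<pi>(1,2)] by (simp add: n_def [abs_def])
  have n_nonneg: "0 \<le> n v" for v by (simp add: n_def nonneg \<pi>)
  define p where "p F = (\<Sum>x\<in>J. n (F x))" for F :: "'m \<Rightarrow> 'a"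
  have p: "sublinear p"
    unfolding sublinear_def p_def
    using sublinear_add[OF n] sublinear_scale[OF n]
    by (auto simp: sum.distrib[symmetric] sum_distrib_left intro!: sum_mono)
  define v where "v x = nlim D (a x) - nlim D (a z)" for x
  have v_in: "v x \<in> pts D" for x unfolding v_def by (intro diff_in nlim a)
  define d where "d g = (\<lambda>x. q (g x) - q (g z) - v x)" for g :: "'m \<Rightarrow> 'b"
  have d_in: "d g x \<in> pts D" if "g \<in> lip_maps lam Yc" for g x
    using that unfolding d_def lip_maps_Yc_iff by (intro diff_in q_in v_in) auto
  have "\<epsilon> \<le> p (d g)" if g: "g \<in> lip_maps lam Yc" for g
  proof (rule ccontr)
    assume "\<not> \<epsilon> \<le> p (d g)"
    then have lt: "p (d g) < \<epsilon>" by simp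
    have "nrm D (d g x) < \<epsilon>" if "x \<in> J" for x
    proof -
      have "n (d g x) \<le> p (d g)"
        unfolding p_def using that J n_nonneg by (intro member_le_sum) auto
      then show ?thesis using lt by (simp add: n_def \<pi>(3)[OF d_in[OF g]])
    qed
    then show False using witness[OF g] contra by (simp add: d_def v_def)
  qed
  moreover have "convex (d ` lip_maps lam Yc)"
  proof (rule convexI)
    fix F G and s t :: real
    assume "F \<in> d ` lip_maps lam Yc" "G \<in> d ` lip_maps lam Yc" and st: "0 \<le> s" "0 \<le> t" "s + t = 1"
    then obtain g g' where g: "F = d g" "G = d g'" "g \<in> lip_maps lam Yc" "g' \<in> lip_maps lam Yc" by blast
    define k where "k = (\<lambda>x. s *\<^sub>R g x + t *\<^sub>R g' x)"
    have in_Y: "g x \<in> pts Yc" "g' x \<in> pts Yc" for x using g by (auto simp: lip_maps_Yc_iff)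
    have "k \<in> lip_maps lam Yc"
      unfolding lip_maps_Yc_iff
    proof (intro conjI allI)
      show "k x \<in> pts Yc" for x unfolding k_def by (intro Yc.add_in Yc.scale_in in_Y)
      fix x y
      have "k x - k y = s *\<^sub>R (g x - g y) + t *\<^sub>R (g' x - g' y)"
        by (simp add: k_def algebra_simps)
      then have "nrm Yc (k x - k y) \<le> s * nrm Yc (g x - g y) + t * nrm Yc (g' x - g' y)"
        using Yc.triangle[of "s *\<^sub>R (g x - g y)" "t *\<^sub>R (g' x - g' y)"] st in_Y
        by (simp add: Yc.scale_in Yc.diff_in Yc.scale)
      also have "\<dots> \<le> s * (lam * dist x y) + t * (lam * dist x y)"
        using g st by (intro add_mono mult_left_mono) (auto simp: lip_maps_Yc_iff)
      also have "\<dots> = lam * dist x y"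
        using st(3) by (simp add: distrib_right[symmetric])
      finally show "nrm Yc (k x - k y) \<le> lam * dist x y" .
    qed
    moreover have "s *\<^sub>R F + t *\<^sub>R G = d k"
    proof
      fix x
      have qk: "q (k x) = s *\<^sub>R q (g x) + t *\<^sub>R q (g' x)" for x
        using in_Y by (simp add: k_def q_add q_scale Yc.scale_in)
      have "s *\<^sub>R v x + t *\<^sub>R v x = v x"
        using st(3) by (simp add: scaleR_add_left[symmetric])
      then show "(s *\<^sub>R F + t *\<^sub>R G) x = d k x"
        by (simp add: g d_def qk algebra_simps)
    qed
    ultimately show "s *\<^sub>R F + t *\<^sub>R G \<in> d ` lip_maps lam Yc" by blast
  qed
  moreover have "(\<lambda>_. 0) \<in> lip_maps lam Yc"
    using lam Yc.zero_in by (simp add: lip_maps_Yc_iff)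
  then have "d ` lip_maps lam Yc \<noteq> {}" by blast
  ultimately obtain h where h: "linear h" "\<And>F. h F \<le> p F" "\<And>F. F \<in> d ` lip_maps lam Yc \<Longrightarrow> \<epsilon> \<le> h F"
    using separation[OF p, of "d ` lip_maps lam Yc" \<epsilon>] by blast
  define \<psi> where "\<psi> x w = h (single x w)" for x w
  have lin: "linear (\<psi> x)" for x
    unfolding \<psi>_def by (rule linear_compose[OF linear_single h(1), unfolded o_def])
  \<comment> \<open>\<open>p\<close> vanishes at \<open>r\<close> and at \<open>- r\<close> because
    \<open>r\<close> is zero on \<open>J\<close>; hence so does \<open>h\<close>.\<close>
  have split: "h F = (\<Sum>x\<in>J. \<psi> x (F x))" for F
  proof -
    define r where "r = F - (\<Sum>x\<in>J. single x (F x))"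
    have "r x = 0" if "x \<in> J" for x using that J by (simp add: r_def sum_single)
    then have "p r = 0" "p (- r) = 0" using sublinear_0[OF n] by (simp_all add: p_def)
    then have "h r = 0" using h(2)[of r] h(2)[of "- r"] linear_neg[OF h(1), of r] by simp
    then show ?thesis by (simp add: r_def linear_diff[OF h(1)] linear_sum[OF h(1)] \<psi>_def)
  qed
  have psi_le: "\<bar>\<psi> x w\<bar> \<le> nrm D w" if w: "w \<in> pts D" for x w
  proof -
    have "p (single x w) \<le> n w" for w
    proof -
      have "p (single x w) = (\<Sum>y\<in>J. if y = x then n w else 0)"
        unfolding p_def by (rule sum.cong) (auto simp: single_def sublinear_0[OF n])
      then show ?thesis using J n_nonneg by simp
    qed
    from this[of w] this[of "- w"] show ?thesis
      using h(2)[of "single x w"] h(2)[of "single x (- w)"] linear_neg[OF lin, of x w] w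
      by (simp add: \<psi>_def[symmetric] n_def \<pi> linear_neg[OF \<pi>(1)] neg)
  qed
  \<comment> \<open>Functionals factoring through \<open>q\<close> belong to the dual of
    \<open>Yc\<close> because \<open>q\<close> is a contraction. On them the lift is known
    explicitly, so the weak hypothesis makes \<open>h (d g)\<close> small for some \<open>g\<close>,
    against the separation.\<close>
  define \<phi> where "\<phi> x y = (if y \<in> pts Yc then \<psi> x (q y) else 0)" for x y
  have \<phi>: "\<phi> x \<in> pts (dual Yc)" for x
  proof (rule dualI[of _ _ 1])
    show "\<bar>\<phi> x y\<bar> \<le> 1 * nrm Yc y" if "y \<in> pts Yc" for y
      using psi_le[OF q_in[OF that], of x] q_nrm_le[OF that] that by (simp add: \<phi>_def)
  qed (auto simp: \<phi>_def Yc.add_in Yc.scale_in q_add q_scale linear_add[OF lin] linear_scale[OF lin])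
  have lift_phi: "lift (a y) (\<phi> x) = \<psi> x (nlim D (a y))" for x y
    by (rule lift_limit_functional[OF a \<phi>]) (simp add: \<phi>_def Yc_in q_def RI)
  \<comment> \<open>Each point of \<open>J\<close> costs \<open>2 * \<delta>\<close>: once at the
    point itself and once at \<open>z\<close>, where the value of \<open>g\<close> is
    subtracted.\<close>
  define \<delta> where "\<delta> = \<epsilon> / (2 * (real (card J) + 1))"
  have \<delta>: "0 < \<delta>" "real (card J) * (2 * \<delta>) < \<epsilon>" using eps by (auto simp: \<delta>_def field_simps)
  have "\<exists>g\<in>lip_maps lam Yc. \<forall>x\<in>insert z J. \<forall>\<phi>'\<in>\<phi> ` J. \<bar>\<phi>' (g x) - lift (a x) \<phi>'\<bar> < \<delta>"
    using J \<phi> \<delta>(1) by (intro weak) auto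
  then obtain g where g: "g \<in> lip_maps lam Yc"
    and near: "\<And>x y. x \<in> insert z J \<Longrightarrow> y \<in> J \<Longrightarrow> \<bar>\<phi> y (g x) - lift (a x) (\<phi> y)\<bar> < \<delta>"
    by blast
  have g_in: "g x \<in> pts Yc" for x using g by (simp add: lip_maps_Yc_iff)
  have "\<epsilon> \<le> h (d g)" using g by (intro h) auto
  also have "h (d g) \<le> (\<Sum>x\<in>J. 2 * \<delta>)"
    unfolding split
  proof (rule sum_mono)
    fix x assume x: "x \<in> J"
    have "\<psi> x (d g x) = (\<phi> x (g x) - lift (a x) (\<phi> x)) - (\<phi> x (g z) - lift (a z) (\<phi> x))"
      unfolding lift_phi by (simp add: d_def v_def linear_diff[OF lin] \<phi>_def g_in)
    then show "\<psi> x (d g x) \<le> 2 * \<delta>"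
      using near[of x x] near[of z x] x by force
  qed
  also have "\<dots> < \<epsilon>" using \<delta>(2) by simp
  finally show False by simp
qed

end

section \<open>The bounded approximation property of the free space\<close>

text \<open>Norm convergence of functionals is pointwise, and the representation by sample points is
  an identity that passes to pointwise limits.\<close>

lemma (in normed) span_closed_in_dual:
  assumes B: "finite B" and v: "\<And>k. v k \<in> span B" "\<And>k. v k \<in> pts (dual X)" and l: "l \<in> pts (dual X)"
    and lim: "(\<lambda>k. nrm (dual X) (v k - l)) \<longlonglongrightarrow> 0"
  shows "l \<in> span B"
proof -
  interpret X': normed "dual X" by (rule normed_dual)
  have pw: "(\<lambda>k. v k x) \<longlonglongrightarrow> l x" for x
  proof (cases "x \<in> pts X")
    case False
    then show ?thesis using dual_outside[OF v(2) False] dual_outside[OF l False] by simp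
  next
    case True
    have "(\<lambda>k. v k x - l x) \<longlonglongrightarrow> 0"
    proof (rule Lim_null_comparison)
      show "(\<lambda>k. nrm (dual X) (v k - l) * nrm X x) \<longlonglongrightarrow> 0"
        using tendsto_mult_left_zero[OF lim] .
      show "\<forall>\<^sub>F k in sequentially. norm (v k x - l x) \<le> nrm (dual X) (v k - l) * nrm X x"
        using dual_bound[OF X'.diff_in[OF v(2) l] True] by simp
    qed
    then show ?thesis by (simp add: LIM_zero_iff)
  qed
  obtain S e where S: "finite S" and e: "\<And>s. s \<in> S \<Longrightarrow> e s \<in> span B"
    and rep: "\<And>v. v \<in> span B \<Longrightarrow> v = (\<Sum>s\<in>S. v s *\<^sub>R e s)"
    by (rule finite_dim_functions_samples[OF B]) (rule that)
  have "l = (\<Sum>s\<in>S. l s *\<^sub>R e s)"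
  proof
    fix x
    have "(\<lambda>k. \<Sum>s\<in>S. v k s * e s x) \<longlonglongrightarrow> (\<Sum>s\<in>S. l s * e s x)"
      by (intro tendsto_sum tendsto_mult pw tendsto_const)
    moreover have "(\<Sum>s\<in>S. v k s * e s x) = v k x" for k
      using fun_cong[OF rep[OF v(1)], of k x] by (simp add: sum_fun_app)
    ultimately show "l x = (\<Sum>s\<in>S. l s *\<^sub>R e s) x"
      using LIMSEQ_unique[OF pw] by (simp add: sum_fun_app)
  qed
  moreover have "(\<Sum>s\<in>S. l s *\<^sub>R e s) \<in> span B"
    using e by (intro span_sum span_scale)
  ultimately show ?thesis by metis
qed

text \<open>Each \<open>\<mu> n\<close> is determined by its values on a finite sample set, so a
  sequence is determined by countably many reals and fits into the second factor of the ambient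
  type, whatever \<open>'u\<close> is. The left inverse comes from pure linear algebra.\<close>

lemma conv_space_encoding:
  fixes B :: "nat \<Rightarrow> ('a \<Rightarrow> real) set"
  assumes ex: "exhausted D (\<lambda>n. span (B n))" and fin: "\<And>n. finite (B n)"
  obtains I :: "(nat \<Rightarrow> 'a \<Rightarrow> real) \<Rightarrow> 'u::real_vector ambient" and R
    where "encoded D (\<lambda>n. span (B n)) I R"
proof -
  interpret exhausted D "\<lambda>n. span (B n)" by (rule ex)
  have "\<forall>n. \<exists>S. finite S \<and> (\<forall>v\<in>span (B n). (\<forall>s\<in>S. v s = 0) \<longrightarrow> v = 0)"
  proof
    fix n
    obtain S e where S: "finite S" and rep: "\<And>v. v \<in> span (B n) \<Longrightarrow> v = (\<Sum>s\<in>S. v s *\<^sub>R e s)"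
      by (rule finite_dim_functions_samples[OF fin[of n]]) (rule that)
    have "v = 0" if "v \<in> span (B n)" "\<forall>s\<in>S. v s = 0" for v
      using rep[OF that(1)] that(2) by simp
    then show "\<exists>S. finite S \<and> (\<forall>v\<in>span (B n). (\<forall>s\<in>S. v s = 0) \<longrightarrow> v = 0)" using S by blast
  qed
  then obtain S where S: "\<And>n. finite (S n)"
    and sep: "\<And>n v. v \<in> span (B n) \<Longrightarrow> (\<And>s. s \<in> S n \<Longrightarrow> v s = 0) \<Longrightarrow> v = 0"
    by metis
  \<comment> \<open>Position \<open>k\<close> codes a coordinate \<open>n\<close> together with an
    index into \<open>S n\<close>. Indices beyond the size of \<open>S n\<close> merely record
    further values, which does no harm to linearity or injectivity.\<close>
  define I :: "(nat \<Rightarrow> 'a \<Rightarrow> real) \<Rightarrow> 'u ambient" where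
    "I \<mu> = (0, \<lambda>k. \<mu> (fst (prod_decode k)) (from_nat_into (S (fst (prod_decode k))) (snd (prod_decode k))))" for \<mu>
  have lin: "linear I"
    by (rule linearI) (auto simp: I_def fun_eq_iff)
  have "\<mu> = 0" if m: "\<mu> \<in> pts Ys" and "I \<mu> = 0" for \<mu>
  proof
    fix n
    have "\<mu> n s = 0" if s: "s \<in> S n" for s
    proof -
      obtain i where i: "s = from_nat_into (S n) i"
        using from_nat_into_surj[OF countable_finite[OF S] s] by metis
      have "snd (I \<mu>) (prod_encode (n, i)) = 0" using \<open>I \<mu> = 0\<close> by simp
      then show ?thesis by (simp add: I_def i)
    qed
    then show "\<mu> n = 0 n" using sep[of "\<mu> n" n] m by (simp add: Ys_iff)
  qed
  then have "inj_on I (pts Ys)"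
    using linear_injective_on_subspace_0[OF lin subspace_Ys] by blast
  then have "\<exists>g. g ` UNIV \<subseteq> pts Ys \<and> linear g \<and> (\<forall>v\<in>pts Ys. g (I v) = v)"
    by (rule linear_exists_left_inverse_on[OF lin subspace_Ys])
  then obtain R where "linear R" "\<And>v. v \<in> pts Ys \<Longrightarrow> R (I v) = v" by blast
  with lin have "encoded D (\<lambda>n. span (B n)) I R"
    by (intro encoded.intro ex encoded_axioms.intro) auto
  then show ?thesis by (rule that)
qed

lemma span_eval_at_in: "span (eval_at z ` A) \<subseteq> pts (free_space z)"
  by (rule order_trans[OF span_mono span_subset_free_space]) auto

text \<open>The surrounding space is the full dual of \<open>lip0 z\<close>, whose completeness is
  \<open>banach_dual\<close>; the subspaces are closed as finite-dimensional spaces of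
  functionals.\<close>

lemma exhausted_free_space:
  assumes "\<And>n. finite (A n)"
  shows "exhausted (lip0_dual z) (\<lambda>n. span (eval_at z ` A n))"
proof -
  interpret L: normed "lip0 z" by (rule normed_lip0)
  interpret D: normed "lip0_dual z" by (rule normed_lip0_dual)
  have sub: "span (eval_at z ` A n) \<subseteq> pts (lip0_dual z)" for n
    using span_eval_at_in free_space_subset by blast
  show ?thesis
  proof
    fix n v l
    assume v: "\<And>k :: nat. v k \<in> span (eval_at z ` A n)" and l: "l \<in> pts (lip0_dual z)"
      and lim: "(\<lambda>k. nrm (lip0_dual z) (v k - l)) \<longlonglongrightarrow> 0"
    show "l \<in> span (eval_at z ` A n)"
      by (rule L.span_closed_in_dual[OF _ v _ l lim]) (use assms sub v in auto)
  qed (use L.banach_dual sub in \<open>auto simp: subspace_span\<close>)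
qed

text \<open>Writing \<open>u x\<close> in the coordinates of \<open>span B\<close> turns the
  linearization into a combination of the \<open>e s\<close> with coefficients
  \<open>\<mu> (\<lambda>x. u x s)\<close>. These make sense because the sample points lie in
  \<open>lip0 z\<close>, so that \<open>\<lambda>x. u x s\<close> does too.\<close>

lemma linearization_in_span:
  fixes u :: "'m::metric_space \<Rightarrow> ('m \<Rightarrow> real) \<Rightarrow> real"
  assumes B: "finite B" "span B \<subseteq> pts (lip0_dual z)" and u: "\<And>x. u x \<in> span B" "u z = 0" and c: "0 \<le> c"
    and lip: "\<And>x y. nrm (lip0_dual z) (u x - u y) \<le> c * dist x y" and \<mu>: "\<mu> \<in> pts (lip0_dual z)"
  shows "linearization (lip0 z) u \<mu> \<in> span B"
proof -
  interpret L: normed "lip0 z" by (rule normed_lip0)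
  have u_in: "u x \<in> pts (lip0_dual z)" for x using u(1) B(2) by blast
  note pb = pullback_lip0[OF normed_lip0 u_in u(2) c lip]
  obtain S e where S: "finite S" "\<And>s. s \<in> S \<Longrightarrow> \<exists>v\<in>B. v s \<noteq> 0" and e: "\<And>s. s \<in> S \<Longrightarrow> e s \<in> span B"
    and rep: "\<And>v. v \<in> span B \<Longrightarrow> v = (\<Sum>s\<in>S. v s *\<^sub>R e s)"
    by (rule finite_dim_functions_samples[OF B(1)]) (rule that)
  have S_in: "s \<in> pts (lip0 z)" if s: "s \<in> S" for s
  proof -
    obtain v where "v \<in> B" "v s \<noteq> 0" using S(2)[OF s] by blast
    then show ?thesis using B(2) span_base dual_outside by blast
  qed
  have "linearization (lip0 z) u \<mu> = (\<Sum>s\<in>S. \<mu> (\<lambda>x. u x s) *\<^sub>R e s)"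
  proof
    fix \<phi>
    show "linearization (lip0 z) u \<mu> \<phi> = (\<Sum>s\<in>S. \<mu> (\<lambda>x. u x s) *\<^sub>R e s) \<phi>"
    proof (cases "\<phi> \<in> pts (lip0 z)")
      case True
      have "(\<lambda>x. u x \<phi>) = (\<Sum>s\<in>S. e s \<phi> *\<^sub>R (\<lambda>x. u x s))"
      proof
        fix x
        show "u x \<phi> = (\<Sum>s\<in>S. e s \<phi> *\<^sub>R (\<lambda>x. u x s)) x"
          using fun_cong[OF rep[OF u(1)], of x \<phi>] by (simp add: sum_fun_app mult.commute)
      qed
      then have "\<mu> (\<lambda>x. u x \<phi>) = (\<Sum>s\<in>S. e s \<phi> * \<mu> (\<lambda>x. u x s))"
        using pb(1)[OF S_in] by (simp add: L.dual_sum[OF \<mu>] L.dual_scale[OF \<mu>] L.scale_in)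
      then show ?thesis using True by (simp add: linearization_apply sum_fun_app mult.commute)
    next
      case False
      have "e s \<phi> = 0" if "s \<in> S" for s
        using e[OF that] B(2) dual_outside[OF _ False] by blast
      then show ?thesis using False by (simp add: linearization_def sum_fun_app)
    qed
  qed
  then show ?thesis using e by (simp add: span_sum span_scale)
qed

text \<open>Here \<open>weak\<close> is the finite form of the net property, for the one space
  \<open>Yc\<close>. A coordinate never exceeds the supremum norm, so every \<open>u n\<close> is
  \<open>lam\<close>-Lipschitz, and its values lie in the finite-dimensional \<open>E n\<close>; its
  linearization inherits both properties. The index must be late since only the limits of the
  coordinates are known to be near the evaluations.\<close>

lemma finite_rank_approximation:
  fixes z :: "'m::metric_space" and I :: "(nat \<Rightarrow> ('m \<Rightarrow> real) \<Rightarrow> real) \<Rightarrow> 'b::real_vector"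
  assumes dense: "\<And>x e. 0 < e \<Longrightarrow> \<exists>i. dist (d i) x < e" and lam: "0 \<le> lam"
    and E: "\<And>n. E n = span (eval_at z ` insert z (d ` {..<n}))"
    and enc: "encoded (lip0_dual z) E I R"
    and weak: "\<And>f J \<Phi> \<epsilon>. f \<in> lip_maps 1 (dual (dual (encoded.Yc (lip0_dual z) E I R))) \<Longrightarrow>
      finite J \<Longrightarrow> finite \<Phi> \<Longrightarrow> \<Phi> \<subseteq> pts (dual (encoded.Yc (lip0_dual z) E I R)) \<Longrightarrow> 0 < \<epsilon> \<Longrightarrow>
      \<exists>g\<in>lip_maps lam (encoded.Yc (lip0_dual z) E I R).
        \<forall>x\<in>J. \<forall>\<phi>\<in>\<Phi>. \<bar>\<phi> (g x) - f (x :: 'm) \<phi>\<bar> < \<epsilon>"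
    and J: "finite J" and eps: "0 < \<epsilon>"
  obtains T where "T \<in> bounded_ops (free_space z) (free_space z)" "finite_rank (free_space z) T"
    "op_norm (free_space z) (free_space z) T \<le> lam"
    "\<And>x. x \<in> J \<Longrightarrow> nrm (lip0_dual z) (T (eval_at z x) - eval_at z x) < \<epsilon>"
proof -
  define A where "A n = insert z (d ` {..<n})" for n
  have E_def: "E n = span (eval_at z ` A n)" for n by (simp add: A_def E)
  interpret encoded "lip0_dual z" E I R by (rule enc)
  interpret L: normed "lip0 z" by (rule normed_lip0)
  interpret X: normed "free_space z" by (rule normed_free_space)
  interpret Ys: normed Ys by (rule normed_Ys)
  have finA: "finite (A n)" "A n \<noteq> {}" for n by (auto simp: A_def)
  \<comment> \<open>A nearest point to \<open>x\<close> among \<open>z\<close> and the first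
    \<open>n\<close> points of the dense sequence. Including \<open>z\<close> keeps the set nonempty
    at \<open>n = 0\<close>, and minimality makes the distance to \<open>x\<close> tend to
    0.\<close>
  define a where "a x n = arg_min_on (\<lambda>b. dist b x) (A n)" for x n
  have a_in: "a x n \<in> A n" for x n unfolding a_def using finA by (rule arg_min_if_finite)
  have a_near: "\<exists>N. \<forall>n\<ge>N. dist (a x n) x < e" if e: "0 < e" for x e
  proof -
    obtain i where i: "dist (d i) x < e" using dense[OF e] by blast
    have "dist (a x n) x < e" if "Suc i \<le> n" for n
    proof -
      have "dist (a x n) x \<le> dist (d i) x"
        unfolding a_def by (rule arg_min_least[OF finA]) (use that in \<open>auto simp: A_def\<close>)
      then show ?thesis using i by simp
    qed
    then show ?thesis by blast
  qed
  define w where "w x = (\<lambda>n. eval_at z (a x n))" for x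
  have w_lim: "(\<lambda>n. nrm (lip0_dual z) (w x n - eval_at z x)) \<longlonglongrightarrow> 0" for x
    unfolding LIMSEQ_iff
  proof (intro allI impI)
    fix e :: real assume "0 < e"
    then obtain N where N: "\<And>n. N \<le> n \<Longrightarrow> dist (a x n) x < e" using a_near by blast
    have "\<bar>nrm (lip0_dual z) (w x n - eval_at z x)\<bar> < e" if "N \<le> n" for n
      using N[OF that] eval_at_lipschitz[of z "a x n" x] nonneg[OF diff_in[OF eval_at_in eval_at_in], of "a x n" x]
      by (simp add: w_def)
    then show "\<exists>no. \<forall>n\<ge>no. norm (nrm (lip0_dual z) (w x n - eval_at z x) - 0) < e" by auto
  qed
  have w_in: "w x \<in> pts Ys" for x
    unfolding Ys_iff using w_lim eval_at_in[of z x] a_in by (auto simp: w_def E_def intro: span_base)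
  have w_nlim: "nlim (lip0_dual z) (w x) = eval_at z x" for x
    by (rule nlim_eqI[OF w_in eval_at_in w_lim])
  define f where "f x = lift (w x)" for x
  have f_in: "f x \<in> pts (dual (dual Yc))" for x unfolding f_def by (rule lift_in[OF w_in])
  have f_lip: "nrm (dual (dual Yc)) (f x - f y) \<le> dist x y" for x y
  \<comment> \<open>At late indices the detour through \<open>a x n\<close> and \<open>a y n\<close>
    costs at most \<open>e\<close>, and \<open>lift_diff_le\<close> looks at no other indices. As
    \<open>e\<close> is arbitrary, the Lipschitz constant is exactly 1.\<close>
  proof (rule field_le_epsilon)
    fix e :: real assume e: "0 < e"
    obtain N where N: "\<And>n. N \<le> n \<Longrightarrow> dist (a x n) x < e / 2" using a_near[OF half_gt_zero[OF e]] by blast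
    obtain N' where N': "\<And>n. N' \<le> n \<Longrightarrow> dist (a y n) y < e / 2" using a_near[OF half_gt_zero[OF e]] by blast
    show "nrm (dual (dual Yc)) (f x - f y) \<le> dist x y + e"
      unfolding f_def
    proof (rule lift_diff_le[OF w_in w_in])
      show "0 \<le> dist x y + e" using e by simp
      fix n assume n: "max N N' \<le> n"
      have "nrm (lip0_dual z) (w x n - w y n) \<le> dist (a x n) (a y n)"
        unfolding w_def by (rule eval_at_lipschitz)
      also have "\<dots> \<le> dist (a x n) x + (dist x y + dist (a y n) y)"
        using dist_triangle[of "a x n" "a y n" x] dist_triangle[of x "a y n" y] by (simp add: dist_commute)
      also have "\<dots> \<le> dist x y + e" using N[of n] N'[of n] n by simp
      finally show "nrm (lip0_dual z) (w x n - w y n) \<le> dist x y + e" .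
    qed
  qed
  have f: "f \<in> lip_maps 1 (dual (dual Yc))"
    using f_in f_lip by (auto simp: lip_maps_def ndist_def)
  obtain g where g: "g \<in> lip_maps lam Yc"
    and g_near: "\<And>x. x \<in> J \<Longrightarrow> nrm (lip0_dual z) (q (g x) - q (g z) - (nlim (lip0_dual z) (w x) - nlim (lip0_dual z) (w z))) < \<epsilon> / 2"
  proof (rule strong_approximation[OF w_in lam _ J half_gt_zero[OF eps], where z = z])
    show "\<exists>g\<in>lip_maps lam Yc. \<forall>x\<in>J. \<forall>\<phi>\<in>\<Phi>. \<bar>\<phi> (g x) - lift (w x) \<phi>\<bar> < \<epsilon>"
      if "finite J" "finite \<Phi>" "\<Phi> \<subseteq> pts (dual Yc)" "0 < \<epsilon>" for J \<Phi> \<epsilon>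
      using weak[OF f that] by (simp add: f_def)
  qed (rule that)
  have g_in: "g x \<in> pts Yc" for x using g by (simp add: lip_maps_Yc_iff)
  have Rg: "R (g x) \<in> pts Ys" for x using g_in by (rule R_in)
  \<comment> \<open>Subtracting the value at \<open>z\<close> makes \<open>u n\<close> vanish at the
    base point, as linearization requires.\<close>
  define u where "u n x = R (g x) n - R (g z) n" for n x
  have u_span: "u n x \<in> E n" for n x
    unfolding u_def using Rg by (intro subspace_diff[OF E_sub]) (auto simp: Ys_iff)
  have u0: "u n z = 0" for n by (simp add: u_def)
  have u_lip: "nrm (lip0_dual z) (u n x - u n y) \<le> lam * dist x y" for n x y
  proof -
    have eq: "u n x - u n y = R (g x - g y) n" by (simp add: u_def linear_diff[OF R])
    have "nrm (lip0_dual z) (u n x - u n y) \<le> nrm Yc (g x - g y)"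
      unfolding Yc_nrm eq by (intro Ys_nrm_ge R_in Yc.diff_in g_in)
    then show ?thesis using g unfolding lip_maps_Yc_iff by (meson order_trans)
  qed
  have u_in: "u n x \<in> pts (lip0_dual z)" for n x using u_span E_in by blast
  have "\<forall>x\<in>J. \<exists>N. \<forall>n\<ge>N. nrm (lip0_dual z) (u n x - (q (g x) - q (g z))) < \<epsilon> / 2"
  proof
    fix x
    have d: "R (g x) - R (g z) \<in> pts Ys" by (intro Ys.diff_in Rg)
    have "nlim (lip0_dual z) (R (g x) - R (g z)) = q (g x) - q (g z)"
      using nlim_add[OF Rg[of x] Ys.neg_in[OF Rg[of z]]] nlim_scale[OF Rg[of z], of "-1"] by (simp add: q_def)
    with nlim(2)[OF d] have "(\<lambda>n. nrm (lip0_dual z) (u n x - (q (g x) - q (g z)))) \<longlonglongrightarrow> 0"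
      by (simp add: u_def)
    from order_tendstoD(2)[OF this half_gt_zero[OF eps]]
    show "\<exists>N. \<forall>n\<ge>N. nrm (lip0_dual z) (u n x - (q (g x) - q (g z))) < \<epsilon> / 2"
      by (simp add: eventually_sequentially)
  qed
  then obtain N where N: "\<And>x n. x \<in> J \<Longrightarrow> N x \<le> n \<Longrightarrow> nrm (lip0_dual z) (u n x - (q (g x) - q (g z))) < \<epsilon> / 2"
    by metis
  \<comment> \<open>A common index for all points of \<open>J\<close>; a sum avoids the maximum of a
    possibly empty set.\<close>
  define n where "n = (\<Sum>x\<in>J. N x)"
  have n: "N x \<le> n" if "x \<in> J" for x unfolding n_def using that J by (intro member_le_sum) auto
  define T where "T = linearization (lip0 z) (u n)"
  note lin = linearization_in[OF normed_lip0 u_in u0 lam u_lip, of _ n]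
  have T_span: "T \<mu> \<in> E n" if "\<mu> \<in> pts (free_space z)" for \<mu>
    unfolding T_def E_def
    by (rule linearization_in_span[OF _ _ _ u0 lam u_lip free_space_subset[OF that]])
      (use finA u_span[of n] E_in[of n] in \<open>auto simp: E_def\<close>)
  have E_X: "E n \<subseteq> pts (free_space z)" unfolding E_def by (rule span_eval_at_in)
  have T_nrm: "nrm (free_space z) (T \<mu>) \<le> lam * nrm (free_space z) \<mu>" if "\<mu> \<in> pts (free_space z)" for \<mu>
    using lin(2)[OF free_space_subset[OF that]] by (simp add: T_def)
  have T: "T \<in> bounded_ops (free_space z) (free_space z)"
    by (rule bounded_opsI[OF _ _ _ T_nrm])
      (use T_span E_X linear_linearization[of "lip0 z" "u n"] in
        \<open>auto simp: T_def linear_add linear_scale\<close>)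
  moreover have "finite_rank (free_space z) T"
    unfolding finite_rank_def using T_span finA
    by (intro exI[of _ "eval_at z ` A n"]) (auto simp: E_def)
  moreover have "op_norm (free_space z) (free_space z) T \<le> lam"
    by (rule op_norm_le[OF normed_free_space lam T_nrm])
  moreover have "nrm (lip0_dual z) (T (eval_at z x) - eval_at z x) < \<epsilon>" if x: "x \<in> J" for x
  proof -
    have Tx: "T (eval_at z x) = u n x"
      unfolding T_def by (rule linearization_eval_at[OF normed_lip0 u_in u0 lam u_lip])
    \<comment> \<open>The evaluation at the base point is 0, so the limit of \<open>w x\<close>
      minus that of \<open>w z\<close> is \<open>eval_at z x\<close> itself. Each of the two terms
      is below \<open>\<epsilon> / 2\<close>.\<close>
    have "nrm (lip0_dual z) (u n x - eval_at z x) \<le>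
        nrm (lip0_dual z) (u n x - (q (g x) - q (g z))) + nrm (lip0_dual z) (q (g x) - q (g z) - eval_at z x)"
      by (intro triangle_via u_in diff_in q_in g_in eval_at_in)
    then show ?thesis
      using N[OF x n[OF x]] g_near[OF x] unfolding Tx w_nlim eval_at_base by simp
  qed
  ultimately show ?thesis by (rule that)
qed

text \<open>The generating sets are centred at arbitrary operators \<open>T\<close>. If such a set
  contains \<open>id\<close>, then \<open>x - T x\<close> has norm below \<open>e\<close> at every
  point of \<open>K\<close>; compactness makes the gap uniform, and the operators within this gap of
  \<open>id\<close> on the same \<open>K\<close> stay in the set.\<close>

lemma compact_convergence_neighbourhood:
  assumes X: "normed X" and U: "openin (compact_convergence_topology X) U" "id \<in> U"
  obtains K e where "compactin (norm_topology X) K" "0 < e"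
    "\<And>S. S \<in> bounded_ops X X \<Longrightarrow> (\<And>x. x \<in> K \<Longrightarrow> nrm X (S x - x) < e) \<Longrightarrow> S \<in> U"
proof -
  interpret X: normed X by (rule X)
  let ?B = "{{S \<in> bounded_ops X X. \<forall>x\<in>K. ndist X (S x) (T x) < e} | T K e.
        T \<in> bounded_ops X X \<and> compactin (norm_topology X) K \<and> 0 < e}"
  have "generate_topology_on ?B U"
    using U(1) unfolding compact_convergence_topology_def openin_topology_generated_by_iff .
  then have "id \<in> U \<longrightarrow> (\<exists>K e. compactin (norm_topology X) K \<and> 0 < e \<and>
    (\<forall>S\<in>bounded_ops X X. (\<forall>x\<in>K. nrm X (S x - x) < e) \<longrightarrow> S \<in> U))"
  proof induction
    case (Int a b)
    show ?case
    proof
      assume "id \<in> a \<inter> b"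
      then obtain K e K' e' where "compactin (norm_topology X) K" "0 < e"
        "\<forall>S\<in>bounded_ops X X. (\<forall>x\<in>K. nrm X (S x - x) < e) \<longrightarrow> S \<in> a"
        "compactin (norm_topology X) K'" "0 < e'"
        "\<forall>S\<in>bounded_ops X X. (\<forall>x\<in>K'. nrm X (S x - x) < e') \<longrightarrow> S \<in> b"
        using Int by blast
      then show "\<exists>K e. compactin (norm_topology X) K \<and> 0 < e \<and>
          (\<forall>S\<in>bounded_ops X X. (\<forall>x\<in>K. nrm X (S x - x) < e) \<longrightarrow> S \<in> a \<inter> b)"
        by (intro exI[of _ "K \<union> K'"] exI[of _ "min e e'"]) (auto intro: compactin_Un)
    qed
  next
    case (UN \<K>)
    show ?case
    proof
      assume "id \<in> \<Union>\<K>"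
      then obtain k where k: "k \<in> \<K>" "id \<in> k" by blast
      then have "k \<subseteq> \<Union>\<K>" by blast
      with UN(2)[OF k(1)] k(2) show "\<exists>K e. compactin (norm_topology X) K \<and> 0 < e \<and>
          (\<forall>S\<in>bounded_ops X X. (\<forall>x\<in>K. nrm X (S x - x) < e) \<longrightarrow> S \<in> \<Union>\<K>)"
        by (meson subsetD)
    qed
  next
    case (Basis s)
    then obtain T K e where s: "s = {S \<in> bounded_ops X X. \<forall>x\<in>K. ndist X (S x) (T x) < e}"
      and T: "T \<in> bounded_ops X X" and K: "compactin (norm_topology X) K" and e: "0 < e" by blast
    have KX: "x \<in> pts X" if "x \<in> K" for x using compactin_subset_topspace[OF K] that by auto
    have T_in: "T x \<in> pts X" if "x \<in> pts X" for x using bounded_ops_in[OF T that] .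
    show ?case
    proof
      assume id: "id \<in> s"
      have lt: "nrm X (x - T x) < e" if "x \<in> K" for x
        using id that KX T_in by (auto simp: s ndist_def)
      \<comment> \<open>Uniform gap by sequential compactness: points violating it subconverge to
        some \<open>l\<close> in \<open>K\<close>, where by continuity the norm of
        \<open>l - T l\<close> could not be below \<open>e\<close>.\<close>
      have "\<exists>m :: nat. \<forall>x\<in>K. nrm X (x - T x) + 1 / (real m + 1) \<le> e"
      proof (rule ccontr)
        assume "\<not> ?thesis"
        then have "\<forall>m :: nat. \<exists>x. x \<in> K \<and> e < nrm X (x - T x) + 1 / (real m + 1)"
          by (auto simp: not_le)
        then obtain \<sigma> :: "nat \<Rightarrow> 'a" where \<sigma>: "\<And>m. \<sigma> m \<in> K" "\<And>m. e < nrm X (\<sigma> m - T (\<sigma> m)) + 1 / (real m + 1)"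
          by metis
        then have "range \<sigma> \<subseteq> K" by blast
        then obtain l r where l: "l \<in> K" "strict_mono r" "limitin (norm_topology X) (\<sigma> \<circ> r) l sequentially"
          using K unfolding X.compactin_sequentially by blast
        \<comment> \<open>A Lipschitz constant of \<open>\<lambda>x. x - T x\<close>.\<close>
        define C where "C = 1 + op_norm X X T"
        have C: "1 \<le> C" using op_norm_nonneg[OF X X T] by (simp add: C_def)
        define \<gamma> where "\<gamma> = e - nrm X (l - T l)"
        have \<gamma>: "0 < \<gamma>" using lt[OF l(1)] by (simp add: \<gamma>_def)
        have "0 < \<gamma> / (2 * C)" using \<gamma> C by simp
        then obtain M where M: "\<And>n. M \<le> n \<Longrightarrow> ndist X (\<sigma> (r n)) l < \<gamma> / (2 * C)"
          using l(3) unfolding X.limit_metric_sequentially by (auto simp: o_def) blast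
        obtain M' :: nat where M': "2 / \<gamma> < real M'" using reals_Archimedean2 by blast
        define n where "n = max M M'"
        let ?x = "\<sigma> (r n)"
        have x: "?x \<in> pts X" "l \<in> pts X" using KX \<sigma>(1) l(1) by auto
        have near: "nrm X (?x - l) < \<gamma> / (2 * C)"
          using M[of n] x by (simp add: n_def ndist_def)
        have eq: "?x - T ?x = (l - T l) + ((?x - l) - T (?x - l))"
          using bounded_ops_diff[OF X X T x] by simp
        have "nrm X (?x - T ?x) \<le> nrm X (l - T l) + nrm X ((?x - l) - T (?x - l))"
          unfolding eq by (intro X.triangle X.diff_in T_in x)
        also have "nrm X ((?x - l) - T (?x - l)) \<le> nrm X (?x - l) + nrm X (T (?x - l))"
          using x T_in X.diff_in by (intro X.triangle_diff) auto
        also have "nrm X (T (?x - l)) \<le> op_norm X X T * nrm X (?x - l)"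
          using x by (intro op_norm_bound[OF X X T] X.diff_in)
        finally have "nrm X (?x - T ?x) \<le> nrm X (l - T l) + C * nrm X (?x - l)"
          by (simp add: C_def algebra_simps)
        also have "C * nrm X (?x - l) < \<gamma> / 2" using near C by (simp add: field_simps)
        finally have "e < nrm X (l - T l) + \<gamma> / 2 + 1 / (real (r n) + 1)"
          using \<sigma>(2)[of "r n"] by linarith
        moreover have "1 / (real (r n) + 1) < \<gamma> / 2"
        proof -
          have "M' \<le> r n" using seq_suble[OF l(2), of n] by (simp add: n_def)
          then have "2 / \<gamma> < real (r n) + 1" using M' by linarith
          then show ?thesis using \<gamma> by (simp add: field_simps)
        qed
        ultimately show False by (simp add: \<gamma>_def field_simps)
      qed
      then obtain m :: nat where m: "\<And>x. x \<in> K \<Longrightarrow> nrm X (x - T x) + 1 / (real m + 1) \<le> e" by blast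
      have "S \<in> s" if S: "S \<in> bounded_ops X X" "\<forall>x\<in>K. nrm X (S x - x) < 1 / (real m + 1)" for S
      proof -
        have "ndist X (S x) (T x) < e" if x: "x \<in> K" for x
        proof -
          have "nrm X (S x - T x) \<le> nrm X (S x - x) + nrm X (x - T x)"
            using KX[OF x] T_in bounded_ops_in[OF S(1)] by (intro X.triangle_via) auto
          also have "\<dots> < e" using S(2) x m[OF x] by fastforce
          finally show ?thesis using KX[OF x] T_in bounded_ops_in[OF S(1)] by (simp add: ndist_def)
        qed
        then show ?thesis using S(1) by (simp add: s)
      qed
      moreover have "0 < 1 / (real m + 1)" by simp
      ultimately show "\<exists>K e. compactin (norm_topology X) K \<and> 0 < e \<and>
          (\<forall>S\<in>bounded_ops X X. (\<forall>x\<in>K. nrm X (S x - x) < e) \<longrightarrow> S \<in> s)"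
        using K by blast
    qed
  qed simp
  then show ?thesis using U(2) that by blast
qed

text \<open>\<open>J\<close> and \<open>B\<close> depend on \<open>v\<close> but not on
  \<open>T\<close>, so a tolerance can be fixed before the operator is chosen. Membership of
  \<open>v\<close> in the free space is carried along for the induction.\<close>

lemma span_eval_at_control:
  assumes "v \<in> span (range (eval_at z))"
  shows "v \<in> pts (free_space z) \<and> (\<exists>J B. finite J \<and> 0 \<le> B \<and>
    (\<forall>T \<eta>. T \<in> bounded_ops (free_space z) (free_space z) \<longrightarrow> 0 \<le> \<eta> \<longrightarrow>
      (\<forall>x\<in>J. nrm (free_space z) (T (eval_at z x) - eval_at z x) \<le> \<eta>) \<longrightarrow>
      nrm (free_space z) (T v - v) \<le> B * \<eta>))"
    (is "?P v")
  using assms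
proof (induction rule: span_induct_alt)
  interpret X: normed "free_space z" by (rule normed_free_space)
  note zero = bounded_ops_zero[OF normed_free_space normed_free_space]
  show "?P 0"
  proof (intro conjI exI[of _ "{}"] exI[of _ "0 :: real"] allI impI)
    fix T and \<eta> :: real assume T: "T \<in> bounded_ops (free_space z) (free_space z)"
    show "nrm (free_space z) (T 0 - 0) \<le> 0 * \<eta>"
      unfolding zero[OF T] by (simp add: X.zero[unfolded nrm_free_space])
  qed (rule X.zero_in order_refl finite.emptyI)+
  fix c \<mu> v assume "\<mu> \<in> range (eval_at z)" and v: "?P v"
  then obtain x where x: "\<mu> = eval_at z x" by blast
  from v obtain J B where J: "finite J" "0 \<le> B" and JB: "\<And>T \<eta>. T \<in> bounded_ops (free_space z) (free_space z) \<Longrightarrow> 0 \<le> \<eta> \<Longrightarrow>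
      (\<forall>x\<in>J. nrm (free_space z) (T (eval_at z x) - eval_at z x) \<le> \<eta>) \<Longrightarrow>
      nrm (free_space z) (T v - v) \<le> B * \<eta>" by blast
  have v_in: "v \<in> pts (free_space z)" and x_in: "eval_at z x \<in> pts (free_space z)"
    using v eval_at_in_free_space by auto
  have "nrm (free_space z) (T (c *\<^sub>R \<mu> + v) - (c *\<^sub>R \<mu> + v)) \<le> (\<bar>c\<bar> + B) * \<eta>"
    if T: "T \<in> bounded_ops (free_space z) (free_space z)" and \<eta>: "0 \<le> \<eta>"
      "\<forall>x\<in>insert x J. nrm (free_space z) (T (eval_at z x) - eval_at z x) \<le> \<eta>" for T \<eta>
  proof -
    have Tin: "T \<nu> \<in> pts (free_space z)" if "\<nu> \<in> pts (free_space z)" for \<nu> using bounded_ops_in[OF T that] .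
    have eq: "T (c *\<^sub>R \<mu> + v) - (c *\<^sub>R \<mu> + v) = c *\<^sub>R (T \<mu> - \<mu>) + (T v - v)"
      using x_in v_in unfolding x
      by (simp add: bounded_ops_add[OF T] bounded_ops_scale[OF T] X.scale_in scaleR_diff_right)
    have "nrm (free_space z) (T (c *\<^sub>R \<mu> + v) - (c *\<^sub>R \<mu> + v)) \<le>
        \<bar>c\<bar> * nrm (free_space z) (T \<mu> - \<mu>) + nrm (free_space z) (T v - v)"
      unfolding eq
      using X.triangle[of "c *\<^sub>R (T \<mu> - \<mu>)" "T v - v"] X.scale[of "T \<mu> - \<mu>" c] x_in v_in Tin
      unfolding x by (simp add: X.scale_in X.diff_in del: nrm_free_space)
    also have "\<dots> \<le> \<bar>c\<bar> * \<eta> + B * \<eta>"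
      using \<eta> JB[OF T \<eta>(1)] unfolding x by (intro add_mono mult_left_mono) auto
    finally show ?thesis by (simp add: algebra_simps)
  qed
  note bound = this
  show "?P (c *\<^sub>R \<mu> + v)"
  proof (intro conjI exI[of _ "insert x J"] exI[of _ "\<bar>c\<bar> + B"] allI impI)
    show "c *\<^sub>R \<mu> + v \<in> pts (free_space z)"
      unfolding x by (intro X.add_in X.scale_in x_in v_in)
  qed (use J in \<open>simp_all only: bound finite_insert add_nonneg_nonneg abs_ge_zero\<close>)
qed

text \<open>The common bound \<open>lam\<close> makes the operators equicontinuous, so closeness to
  the identity on a finite net of \<open>K\<close> extends to all of \<open>K\<close>. The net
  points are replaced by nearby combinations of evaluations, where closeness on finitely many
  evaluations suffices.\<close>

lemma bap_of_finite_approximation: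
  assumes lam: "0 \<le> lam"
    and fin: "\<And>J \<epsilon>. finite J \<Longrightarrow> 0 < \<epsilon> \<Longrightarrow> \<exists>T\<in>bounded_ops (free_space z) (free_space z).
      finite_rank (free_space z) T \<and> op_norm (free_space z) (free_space z) T \<le> lam \<and>
      (\<forall>x\<in>J. nrm (free_space z) (T (eval_at z x) - eval_at z x) < \<epsilon>)"
  shows "bounded_approximation_property lam (free_space z)"
proof -
  let ?X = "free_space z"
  interpret X: normed ?X by (rule normed_free_space)
  have id_in: "id \<in> bounded_ops ?X ?X" by (rule bounded_opsI[of _ _ _ 1]) auto
  have "\<exists>T. T \<in> bounded_ops ?X ?X \<and> finite_rank ?X T \<and> op_norm ?X ?X T \<le> lam \<and> T \<in> U"
    if U: "id \<in> U" "openin (compact_convergence_topology ?X) U" for U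
  proof -
    obtain K e where K: "compactin (norm_topology ?X) K" and e: "0 < e"
      and KU: "\<And>S. S \<in> bounded_ops ?X ?X \<Longrightarrow> (\<And>x. x \<in> K \<Longrightarrow> nrm ?X (S x - x) < e) \<Longrightarrow> S \<in> U"
      using compact_convergence_neighbourhood[OF normed_free_space U(2,1)] by metis
    \<comment> \<open>A point of \<open>K\<close> is within \<open>2 * e'\<close> of some
      \<open>v k\<close>: one \<open>e'\<close> to the net and one from the net to the span. This
      contributes \<open>lam + 1\<close> times as much, that is \<open>e / 4\<close>, and the error
      of \<open>T\<close> at \<open>v k\<close> contributes another \<open>e / 4\<close>.\<close>
    define e' where "e' = e / (8 * (lam + 1))"
    have e': "0 < e'" "(lam + 1) * (2 * e') = e / 4" using e lam by (auto simp: e'_def field_simps)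
    obtain K0 where K0: "finite K0" "K0 \<subseteq> K" "K \<subseteq> (\<Union>x\<in>K0. X.mball x e')"
      using X.compactin_imp_mtotally_bounded[OF K, unfolded X.mtotally_bounded_def, rule_format, OF e'(1)]
      by (elim exE conjE)
    have KX: "k \<in> pts ?X" if "k \<in> K" for k using compactin_subset_topspace[OF K] that by auto
    have "\<forall>k\<in>K0. \<exists>v. v \<in> span (range (eval_at z)) \<and> nrm ?X (k - v) < e'"
    proof
      fix k assume "k \<in> K0"
      then have "k \<in> pts ?X" using KX K0(2) by blast
      then show "\<exists>v. v \<in> span (range (eval_at z)) \<and> nrm ?X (k - v) < e'"
        using e'(1) unfolding free_space_iff nrm_free_space by blast
    qed
    then obtain v where v: "\<And>k. k \<in> K0 \<Longrightarrow> v k \<in> span (range (eval_at z))" "\<And>k. k \<in> K0 \<Longrightarrow> nrm ?X (k - v k) < e'"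
      by metis
    have v_in: "v k \<in> pts ?X" if "k \<in> K0" for k using v(1)[OF that] span_subset_free_space by blast
    have "\<forall>k\<in>K0. \<exists>J B. finite J \<and> 0 \<le> B \<and> (\<forall>T \<eta>. T \<in> bounded_ops ?X ?X \<longrightarrow> 0 \<le> \<eta> \<longrightarrow>
      (\<forall>x\<in>J. nrm ?X (T (eval_at z x) - eval_at z x) \<le> \<eta>) \<longrightarrow> nrm ?X (T (v k) - v k) \<le> B * \<eta>)"
      using span_eval_at_control v(1) by blast
    then obtain J B where J: "\<And>k. k \<in> K0 \<Longrightarrow> finite (J k)" and B: "\<And>k. k \<in> K0 \<Longrightarrow> 0 \<le> B k"
      and JB: "\<And>k T \<eta>. k \<in> K0 \<Longrightarrow> T \<in> bounded_ops ?X ?X \<Longrightarrow> 0 \<le> \<eta> \<Longrightarrow>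
      (\<forall>x\<in>J k. nrm ?X (T (eval_at z x) - eval_at z x) \<le> \<eta>) \<Longrightarrow> nrm ?X (T (v k) - v k) \<le> B k * \<eta>"
      by metis
    define Bs where "Bs = (\<Sum>k\<in>K0. B k)"
    have Bs: "B k \<le> Bs" if "k \<in> K0" for k unfolding Bs_def using that K0(1) B by (intro member_le_sum) auto
    have Bs0: "0 \<le> Bs" unfolding Bs_def using B by (intro sum_nonneg)
    define \<eta> where "\<eta> = e / (4 * (1 + Bs))"
    have \<eta>: "0 < \<eta>" "Bs * \<eta> \<le> e / 4" using e Bs0 by (auto simp: \<eta>_def field_simps)
    obtain T where T: "T \<in> bounded_ops ?X ?X" "finite_rank ?X T" "op_norm ?X ?X T \<le> lam"
      and near: "\<And>x. x \<in> (\<Union>k\<in>K0. J k) \<Longrightarrow> nrm ?X (T (eval_at z x) - eval_at z x) < \<eta>"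
      using fin[of "\<Union>k\<in>K0. J k" \<eta>] K0(1) J \<eta>(1) by blast
    have Tin: "T \<mu> \<in> pts ?X" if "\<mu> \<in> pts ?X" for \<mu> using bounded_ops_in[OF T(1) that] .
    have "nrm ?X (T x - x) < e" if x: "x \<in> K" for x
    proof -
      obtain k where k: "k \<in> K0" "nrm ?X (k - x) < e'"
        using subsetD[OF K0(3) x] by (auto simp: ndist_def)
      have in': "x \<in> pts ?X" "k \<in> pts ?X" "v k \<in> pts ?X" using KX x k K0(2) v_in by auto
      have xv: "nrm ?X (x - v k) \<le> 2 * e'"
        using X.triangle_via[OF in'] v(2)[OF k(1)] k(2) X.commute[OF in'(1,2)] by linarith
      have eq: "T x - x = T (x - v k) + ((T (v k) - v k) + (v k - x))"
        using bounded_ops_diff[OF normed_free_space normed_free_space T(1) in'(1,3)] by simp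
      have m: "T (x - v k) \<in> pts ?X" "T (v k) - v k \<in> pts ?X" "v k - x \<in> pts ?X"
        by (intro Tin X.diff_in in')+
      have "nrm ?X (T x - x) \<le> nrm ?X (T (x - v k)) + (nrm ?X (T (v k) - v k) + nrm ?X (v k - x))"
        unfolding eq
        by (rule order_trans[OF X.triangle[OF m(1) X.add_in[OF m(2,3)]] add_left_mono[OF X.triangle[OF m(2,3)]]])
      also have "nrm ?X (T (x - v k)) \<le> lam * (2 * e')"
      proof -
        have "nrm ?X (T (x - v k)) \<le> op_norm ?X ?X T * nrm ?X (x - v k)"
          by (intro op_norm_bound[OF normed_free_space normed_free_space T(1)] X.diff_in in')
        also have "\<dots> \<le> lam * (2 * e')"
          by (intro mult_mono T(3) xv lam X.nonneg X.diff_in in')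
        finally show ?thesis .
      qed
      also have "nrm ?X (T (v k) - v k) \<le> e / 4"
      proof -
        have "nrm ?X (T (v k) - v k) \<le> B k * \<eta>"
          by (rule JB[OF k(1) T(1)]) (use near k(1) \<eta>(1) in \<open>auto simp del: nrm_free_space intro: less_imp_le\<close>)
        also have "\<dots> \<le> Bs * \<eta>" using Bs[OF k(1)] \<eta>(1) by (intro mult_right_mono) auto
        finally show ?thesis using \<eta>(2) by simp
      qed
      also have "nrm ?X (v k - x) \<le> 2 * e'"
        using xv X.commute[OF in'(1,3)] by simp
      finally have "nrm ?X (T x - x) \<le> (lam + 1) * (2 * e') + e / 4" by (simp add: algebra_simps)
      then show ?thesis using e'(2) e by simp
    qed
    then show ?thesis using KU T by blast
  qed
  \<comment> \<open>Membership in a closure includes membership in the carrier of the topology; the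
    generating set with empty \<open>K\<close> contains \<open>id\<close>.\<close>
  moreover have "id \<in> topspace (compact_convergence_topology ?X)"
  proof -
    have "{S \<in> bounded_ops ?X ?X. \<forall>x\<in>{}. ndist ?X (S x) (id x) < 1} \<in>
      {{S \<in> bounded_ops ?X ?X. \<forall>x\<in>K. ndist ?X (S x) (T x) < e} | T K e.
        T \<in> bounded_ops ?X ?X \<and> compactin (norm_topology ?X) K \<and> 0 < e}"
      using id_in compactin_empty zero_less_one by blast
    moreover have "id \<in> {S \<in> bounded_ops ?X ?X. \<forall>x\<in>{}. ndist ?X (S x) (id x) < 1}"
      using id_in by simp
    ultimately show ?thesis
      unfolding compact_convergence_topology_def topology_generated_by_topspace by (rule UnionI)
  qed
  ultimately show ?thesis
    unfolding bounded_approximation_property_def in_closure_of by blast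
qed

section \<open>Nets as filters, and the equivalence\<close>

lemma limitin_pointwise_weak_star:
  "limitin (pointwise_weak_star Y) G f F \<longleftrightarrow>
     (\<forall>x. f x \<in> pts (dual (dual Y))) \<and> (\<forall>\<^sub>F g in F. \<forall>x. G g x \<in> pts (dual (dual Y))) \<and>
     (\<forall>x \<phi>. ((\<lambda>g. G g x \<phi>) \<longlongrightarrow> f x \<phi>) F)"
proof -
  have fun_lim: "(h \<longlongrightarrow> l) F \<longleftrightarrow> (\<forall>\<phi>. ((\<lambda>g. h g \<phi>) \<longlongrightarrow> l \<phi>) F)"
    for h :: "_ \<Rightarrow> ('b \<Rightarrow> real) \<Rightarrow> real" and l
    using limitin_componentwise[of "\<lambda>_. euclidean" UNIV h l F]
    by (simp add: euclidean_product_topology)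
  have "(\<forall>\<^sub>F g in F. G g x \<in> pts (dual (dual Y)))" if "\<forall>\<^sub>F g in F. \<forall>x. G g x \<in> pts (dual (dual Y))" for x
    using that by (rule eventually_mono) blast
  then show ?thesis
    unfolding pointwise_weak_star_def weak_star_def limitin_componentwise
    by (auto simp: limitin_subtopology fun_lim topspace_product_topology PiE_UNIV_domain Pi_iff)
qed

text \<open>Nets appear as proper filters on the set of maps: a net gives the filter generated by
  its tails, and every proper filter that eventually consists of \<open>lam\<close>-Lipschitz maps
  arises from a net of such maps.\<close>

theorem theorem2:
  fixes z :: "'m::metric_space" and lam :: real
  assumes "separable_space (euclidean :: 'm topology)"
    and "1 \<le> lam"
  shows "bounded_approximation_property lam (free_space z) \<longleftrightarrow>
    (\<forall>Y :: 'u::real_vector ambient nspace. banach_space Y \<longrightarrow>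
      (\<forall>f :: 'm \<Rightarrow> ('u ambient \<Rightarrow> real) \<Rightarrow> real. f \<in> lip_maps 1 (dual (dual Y)) \<longrightarrow>
        (\<exists>F :: ('m \<Rightarrow> 'u ambient) filter.
           F \<noteq> bot \<and> (\<forall>\<^sub>F g in F. g \<in> lip_maps lam Y) \<and>
           limitin (pointwise_weak_star Y) (\<lambda>g x. canon Y (g x)) f F)))"
    (is "?bap \<longleftrightarrow> (\<forall>Y. banach_space Y \<longrightarrow> (\<forall>f. f \<in> lip_maps 1 (dual (dual Y)) \<longrightarrow> ?net Y f))")
proof (intro iffI allI impI)
  fix Y :: "'u ambient nspace" and f :: "'m \<Rightarrow> ('u ambient \<Rightarrow> real) \<Rightarrow> real"
  assume bap: ?bap and "banach_space Y" and f: "f \<in> lip_maps 1 (dual (dual Y))"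
  then interpret Y: normed Y by unfold_locales (simp add: banach_space_def)
  \<comment> \<open>Finite sets of points and functionals together with a tolerance. The sets
    \<open>V b\<close> generate \<open>F\<close>, and \<open>F\<close> is proper because each of
    these finite conditions can be satisfied.\<close>
  define B where "B = {(J :: 'm set, \<Phi>, \<epsilon> :: real). finite J \<and> finite \<Phi> \<and> \<Phi> \<subseteq> pts (dual Y) \<and> 0 < \<epsilon>}"
  define V where "V = (\<lambda>(J, \<Phi>, \<epsilon>). {g \<in> lip_maps lam Y. \<forall>x\<in>J. \<forall>\<phi>\<in>\<Phi>. \<bar>\<phi> (g x) - f x \<phi>\<bar> < \<epsilon>})"
  define F where "F = (INF b\<in>B. principal (V b))"
  have ne: "B \<noteq> {}" by (auto simp: B_def intro!: exI[of _ "{}"] exI[of _ "1::real"])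
  have dir: "\<exists>x\<in>B. principal (V x) \<le> inf (principal (V a)) (principal (V b))" if "a \<in> B" "b \<in> B" for a b
  proof -
    obtain J \<Phi> \<epsilon> J' \<Phi>' \<epsilon>' where ab: "a = (J, \<Phi>, \<epsilon>)" "b = (J', \<Phi>', \<epsilon>')" by (metis prod_cases3)
    show ?thesis
      using that by (intro bexI[of _ "(J \<union> J', \<Phi> \<union> \<Phi>', min \<epsilon> \<epsilon>')"]) (auto simp: ab B_def V_def)
  qed
  have ev: "eventually P F \<longleftrightarrow> (\<exists>b\<in>B. \<forall>g\<in>V b. P g)" for P
    using eventually_INF_base[OF ne dir, of P] by (simp add: F_def eventually_principal)
  have "V b \<noteq> {}" if bB: "b \<in> B" for b
  proof -
    obtain J \<Phi> \<epsilon> where b: "b = (J, \<Phi>, \<epsilon>)" by (metis prod_cases3)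
    obtain g where "g \<in> lip_maps lam Y" "\<And>x \<phi>. x \<in> J \<Longrightarrow> \<phi> \<in> \<Phi> \<Longrightarrow> \<bar>\<phi> (g x) - f x \<phi>\<bar> < \<epsilon>"
      by (rule lip_approximation_of_bap[OF bap _ Y.normed_axioms f, of J \<Phi> \<epsilon>])
        (use assms(2) bB in \<open>auto simp: b B_def\<close>)
    then show ?thesis by (auto simp: V_def b)
  qed
  then have "F \<noteq> bot"
    using ev[of "\<lambda>_. False"] by (auto simp: eventually_False[symmetric] simp del: eventually_False)
  moreover have lip: "\<forall>\<^sub>F g in F. g \<in> lip_maps lam Y"
    unfolding ev using ne by (auto simp: V_def)
  moreover have "limitin (pointwise_weak_star Y) (\<lambda>g x. canon Y (g x)) f F"
    unfolding limitin_pointwise_weak_star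
  proof (intro conjI allI)
    show f_in: "f x \<in> pts (dual (dual Y))" for x using f by (auto simp: lip_maps_def)
    show "\<forall>\<^sub>F g in F. \<forall>x. canon Y (g x) \<in> pts (dual (dual Y))"
      using lip by (rule eventually_mono) (auto simp: lip_maps_def intro!: canon_in Y.normed_axioms)
    fix x \<phi>
    show "((\<lambda>g. canon Y (g x) \<phi>) \<longlongrightarrow> f x \<phi>) F"
    \<comment> \<open>The product topology has a coordinate for every function; outside the dual of
      \<open>Y\<close> both sides are 0.\<close>
    proof (cases "\<phi> \<in> pts (dual Y)")
      case False
      then show ?thesis using dual_outside[OF f_in False] by (simp add: canon_def)
    next
      case True
      show ?thesis
      proof (rule tendstoI)
        fix e :: real assume "0 < e"
        then have "({x}, {\<phi>}, e) \<in> B" using True by (simp add: B_def)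
        then show "\<forall>\<^sub>F g in F. dist (canon Y (g x) \<phi>) (f x \<phi>) < e"
          unfolding ev using True by (rule_tac bexI) (auto simp: V_def canon_def dist_real_def)
      qed
    qed
  qed
  ultimately show "?net Y f" by blast
next
  assume net: "\<forall>Y :: 'u ambient nspace. banach_space Y \<longrightarrow> (\<forall>f. f \<in> lip_maps 1 (dual (dual Y)) \<longrightarrow> ?net Y f)"
  have lam: "0 \<le> lam" using assms(2) by simp
  obtain C :: "'m set" where C: "countable C" "closure C = UNIV"
    using assms(1) by (auto simp: separable_space_def)
  define d where "d = from_nat_into C"
  have "C \<noteq> {}" using C(2) by auto
  then have dC: "range d = C" unfolding d_def using C(1) by (rule range_from_nat_into)
  have dense: "\<exists>i. dist (d i) x < e" if e: "0 < e" for x e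
  proof -
    have "x \<in> closure C" using C(2) by simp
    then obtain y where "y \<in> C" "dist y x < e" using e by (auto simp: closure_approachable)
    then show ?thesis using dC by blast
  qed
  define E where "E n = span (eval_at z ` insert z (d ` {..<n}))" for n
  have "exhausted (lip0_dual z) (\<lambda>n. span (eval_at z ` insert z (d ` {..<n})))"
    by (rule exhausted_free_space) simp
  then obtain I :: "_ \<Rightarrow> 'u ambient" and R where enc: "encoded (lip0_dual z) E I R"
    unfolding E_def by (rule conv_space_encoding) auto
  interpret encoded "lip0_dual z" E I R by (rule enc)
  have weak: "\<exists>g\<in>lip_maps lam Yc. \<forall>x\<in>J. \<forall>\<phi>\<in>\<Phi>. \<bar>\<phi> (g x) - f x \<phi>\<bar> < \<epsilon>"
    if f: "f \<in> lip_maps 1 (dual (dual Yc))" and fin: "finite J" "finite \<Phi>" and \<Phi>: "\<Phi> \<subseteq> pts (dual Yc)" and eps: "0 < \<epsilon>"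
    for f :: "'m \<Rightarrow> ('u ambient \<Rightarrow> real) \<Rightarrow> real" and J \<Phi> \<epsilon>
  proof -
    \<comment> \<open>Every property that holds eventually along a proper filter has a witness, so
      finitely many of the limits can be approximated by a single \<open>lam\<close>-Lipschitz
      map.\<close>
    obtain F where F: "F \<noteq> bot" and lip: "\<forall>\<^sub>F g in F. g \<in> lip_maps lam Yc"
      and lim: "\<And>x \<phi>. ((\<lambda>g. canon Yc (g x) \<phi>) \<longlongrightarrow> f x \<phi>) F"
      using net banach_Yc f unfolding limitin_pointwise_weak_star by blast
    have "\<forall>\<^sub>F g in F. \<bar>\<phi> (g x) - f x \<phi>\<bar> < \<epsilon>" if "\<phi> \<in> \<Phi>" for x \<phi>
    proof -
      have "\<phi> \<in> pts (dual Yc)" using that \<Phi> by blast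
      then show ?thesis using tendstoD[OF lim eps, of x \<phi>] by (simp add: canon_def dist_real_def)
    qed
    then have "\<forall>\<^sub>F g in F. \<forall>x\<in>J. \<forall>\<phi>\<in>\<Phi>. \<bar>\<phi> (g x) - f x \<phi>\<bar> < \<epsilon>"
      using fin by (intro eventually_ball_finite ballI)
    from eventually_happens'[OF F eventually_conj[OF lip this]] show ?thesis by blast
  qed
  show ?bap
  proof (rule bap_of_finite_approximation[OF lam])
    fix J :: "'m set" and \<epsilon> :: real assume J: "finite J" "0 < \<epsilon>"
    obtain T where "T \<in> bounded_ops (free_space z) (free_space z)" "finite_rank (free_space z) T"
      "op_norm (free_space z) (free_space z) T \<le> lam"
      "\<And>x. x \<in> J \<Longrightarrow> nrm (lip0_dual z) (T (eval_at z x) - eval_at z x) < \<epsilon>"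
      by (rule finite_rank_approximation[OF dense lam E_def enc weak J]) (assumption | rule that)+
    then show "\<exists>T\<in>bounded_ops (free_space z) (free_space z). finite_rank (free_space z) T \<and>
        op_norm (free_space z) (free_space z) T \<le> lam \<and>
        (\<forall>x\<in>J. nrm (free_space z) (T (eval_at z x) - eval_at z x) < \<epsilon>)"
      by auto
  qed
qed

end
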